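(* There is an algorithm $\mathcal{A}$ such that for every input transition system $(\mathit{Init},\delta,\mathit{Bad})$ over $n$ Boolean variables and every $k\in\mathbb{N}$, if the system admits an inductive invariant $I$ that can be written as a DNF formula with $m_1$ terms and also as a CNF formula with $m_2$ clauses, and $I$ is both backwards $k$-fenced and forwards $k$-fenced, then $\mathcal{A}(\mathit{Init},\delta,\mathit{Bad},k)$ converges to an inductive invariant in $O(m_1\cdot m_2)$ inductiveness checks, $O(m_1\cdot m_2\cdot n^3)$ $k$-BMC checks, and $O(m_1\cdot m_2\cdot n^3)$ time.
   Context: Transition systems. $\Sigma=\{p_1,\dots,p_n\}$ is a finite set of Boolean variables; a state is a valuation of $\Sigma$; a formula over $\Sigma$ is identified with the set of states satisfying it, and $\varphi\Longrightarrow\psi$ means that $\varphi\to\psi$ is valid. A transition system is a triple $(\mathit{Init},\delta,\mathit{Bad})$ with $\mathit{Init},\mathit{Bad}$ formulas over $\Sigma$ and $\delta$ a formula over $\Sigma\uplus\Sigma'$ ($\Sigma'$ a primed copy), describing pairs (pre-state, post-state). Standing assumptions: $\mathit{Init}\not\equiv\mathit{false}$, $\mathit{Bad}\not\equiv\mathit{true},\mathit{false}$, $\mathit{Init}\Longrightarrow\neg\mathit{Bad}$. An inductive invariant is a formula $I$ over $\Sigma$ with (i) $\mathit{Init}\Longrightarrow I$, (ii) $I\wedge\delta\Longrightarrow I'$, (iii) $I\Longrightarrow\neg\mathit{Bad}$, where $I'$ is $I$ with variables primed. $\delta^{\le k}(S)$ is the set of states reachable from some state in $S$ in at most $k$ steps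 of $\delta$; $(\delta^{-1})^{\le k}(\mathit{Bad})$ is the set of states from which some state of $\mathit{Bad}$ is reachable in at most $k$ steps. Two states are neighbors if they differ in exactly one variable. $\partial^+(I)=\{\sigma\models I : \sigma\text{ has a neighbor }\not\models I\}$ and $\partial^-(I)=\{\sigma\not\models I : \sigma \text{ has a neighbor } \models I\}$. An inductive invariant $I$ is forwards $k$-fenced if $\partial^+(I)\subseteq\delta^{\le k}(\mathit{Init})$, and backwards $k$-fenced if $\partial^-(I)\subseteq(\delta^{-1})^{\le k}(\mathit{Bad})$. A DNF formula is a disjunction of terms (conjunctions of literals); a CNF formula is a conjunction of clauses (disjunctions of literals). Complexity measure. The algorithm does not know $I$. It may perform inductiveness checks (deciding whether a candidate is an inductive invariant, and obtaining a counterexample if not; a counterexample to (ii) is a pair $(\sigma,\sigma')\models \varphi\wedge\delta\wedge\neg\varphi'$) and $k$-BMC checks (deciding whether $\delta^{\le k}(\psi)\cap\mathit{Bad}=\emptyset$ or whether $\delta^{\le k}(\mathit{Init})\cap\psi=\emptyset$ for a given $\psi$). Time counts each such check (SAT oracle call) as one step. *)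

theory Defs
  imports Main
begin

section \<open>Transition systems and inductive invariants\<close>

text \<open>A state over the variables \<open>0, \<dots>, n - 1\<close> is a Boolean list of length \<open>n\<close>.  The formulas
  of a transition system are identified with the sets of states, or of pairs of a pre-state and
  a post-state, that satisfy them.\<close>

type_synonym state = "bool list"

definition states :: "nat \<Rightarrow> state set" where
  "states n = {\<sigma>. length \<sigma> = n}"

record tsys =
  nvars :: nat
  Init :: "state set"
  Trans :: "(state \<times> state) set"
  Bad :: "state set"

definition transition_system :: "tsys \<Rightarrow> bool" where
  "transition_system T \<longleftrightarrow>
     Init T \<subseteq> states (nvars T) \<and>
     Trans T \<subseteq> states (nvars T) \<times> states (nvars T) \<and>
     Bad T \<subseteq> states (nvars T) \<and>
     Init T \<noteq> {} \<and> Bad T \<noteq> {} \<and> Bad T \<noteq> states (nvars T) \<and>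
     Init T \<inter> Bad T = {}"

definition inductive_invariant :: "tsys \<Rightarrow> state set \<Rightarrow> bool" where
  "inductive_invariant T I \<longleftrightarrow>
     I \<subseteq> states (nvars T) \<and>
     Init T \<subseteq> I \<and>
     (\<forall>\<sigma> \<sigma>'. \<sigma> \<in> I \<and> (\<sigma>, \<sigma>') \<in> Trans T \<longrightarrow> \<sigma>' \<in> I) \<and>
     I \<inter> Bad T = {}"

definition reach_le :: "(state \<times> state) set \<Rightarrow> nat \<Rightarrow> state set \<Rightarrow> state set" where
  "reach_le R k S = {\<tau>. \<exists>\<sigma>\<in>S. \<exists>j\<le>k. (\<sigma>, \<tau>) \<in> R ^^ j}"

definition neighbors :: "state \<Rightarrow> state \<Rightarrow> bool" where
  "neighbors \<sigma> \<tau> \<longleftrightarrow> length \<sigma> = length \<tau> \<and> card {i. i < length \<sigma> \<and> \<sigma> ! i \<noteq> \<tau> ! i} = 1"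

definition inner_boundary :: "nat \<Rightarrow> state set \<Rightarrow> state set" where
  "inner_boundary n I = {\<sigma> \<in> states n. \<sigma> \<in> I \<and> (\<exists>\<tau>\<in>states n. neighbors \<sigma> \<tau> \<and> \<tau> \<notin> I)}"

definition outer_boundary :: "nat \<Rightarrow> state set \<Rightarrow> state set" where
  "outer_boundary n I = {\<sigma> \<in> states n. \<sigma> \<notin> I \<and> (\<exists>\<tau>\<in>states n. neighbors \<sigma> \<tau> \<and> \<tau> \<in> I)}"

definition forwards_fenced :: "tsys \<Rightarrow> nat \<Rightarrow> state set \<Rightarrow> bool" where
  "forwards_fenced T k I \<longleftrightarrow> inner_boundary (nvars T) I \<subseteq> reach_le (Trans T) k (Init T)"

definition backwards_fenced :: "tsys \<Rightarrow> nat \<Rightarrow> state set \<Rightarrow> bool" where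
  "backwards_fenced T k I \<longleftrightarrow> outer_boundary (nvars T) I \<subseteq> reach_le ((Trans T)\<inverse>) k (Bad T)"

section \<open>Normal forms\<close>

text \<open>The literal \<open>(i, b)\<close> says that variable \<open>i\<close> has the value \<open>b\<close>.\<close>

type_synonym literal = "nat \<times> bool"

definition lit_holds :: "state \<Rightarrow> literal \<Rightarrow> bool" where
  "lit_holds \<sigma> l \<longleftrightarrow> \<sigma> ! fst l = snd l"

definition literals_over :: "nat \<Rightarrow> literal list list \<Rightarrow> bool" where
  "literals_over n F \<longleftrightarrow> (\<forall>C\<in>set F. \<forall>l\<in>set C. fst l < n)"

definition dnf_holds :: "state \<Rightarrow> literal list list \<Rightarrow> bool" where
  "dnf_holds \<sigma> F \<longleftrightarrow> (\<exists>t\<in>set F. \<forall>l\<in>set t. lit_holds \<sigma> l)"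

definition cnf_holds :: "state \<Rightarrow> literal list list \<Rightarrow> bool" where
  "cnf_holds \<sigma> F \<longleftrightarrow> (\<forall>c\<in>set F. \<exists>l\<in>set c. lit_holds \<sigma> l)"

definition has_dnf :: "nat \<Rightarrow> state set \<Rightarrow> nat \<Rightarrow> bool" where
  "has_dnf n I m \<longleftrightarrow>
     (\<exists>F. length F = m \<and> literals_over n F \<and> I = {\<sigma> \<in> states n. dnf_holds \<sigma> F})"

definition has_cnf :: "nat \<Rightarrow> state set \<Rightarrow> nat \<Rightarrow> bool" where
  "has_cnf n I m \<longleftrightarrow>
     (\<exists>F. length F = m \<and> literals_over n F \<and> I = {\<sigma> \<in> states n. cnf_holds \<sigma> F})"

section \<open>Formulas built by an algorithm\<close>

datatype fml = FF | TT | Var nat | Neg fml | Conj fml fml | Disj fml fml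

fun sat :: "state \<Rightarrow> fml \<Rightarrow> bool" where
  "sat \<sigma> FF = False"
| "sat \<sigma> TT = True"
| "sat \<sigma> (Var i) = \<sigma> ! i"
| "sat \<sigma> (Neg f) = (\<not> sat \<sigma> f)"
| "sat \<sigma> (Conj f g) = (sat \<sigma> f \<and> sat \<sigma> g)"
| "sat \<sigma> (Disj f g) = (sat \<sigma> f \<or> sat \<sigma> g)"

fun vars :: "fml \<Rightarrow> nat set" where
  "vars FF = {}"
| "vars TT = {}"
| "vars (Var i) = {i}"
| "vars (Neg f) = vars f"
| "vars (Conj f g) = vars f \<union> vars g"
| "vars (Disj f g) = vars f \<union> vars g"

definition models :: "nat \<Rightarrow> fml \<Rightarrow> state set" where
  "models n f = {\<sigma> \<in> states n. sat \<sigma> f}"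

section \<open>Answers to inductiveness checks\<close>

datatype answer = Yes | CexInit state | CexStep state state | CexBad state

fun correct_answer :: "tsys \<Rightarrow> state set \<Rightarrow> answer \<Rightarrow> bool" where
  "correct_answer T S Yes \<longleftrightarrow> inductive_invariant T S"
| "correct_answer T S (CexInit \<sigma>) \<longleftrightarrow> \<sigma> \<in> Init T \<and> \<sigma> \<notin> S"
| "correct_answer T S (CexStep \<sigma> \<sigma>') \<longleftrightarrow> \<sigma> \<in> S \<and> (\<sigma>, \<sigma>') \<in> Trans T \<and> \<sigma>' \<notin> S"
| "correct_answer T S (CexBad \<sigma>) \<longleftrightarrow> \<sigma> \<in> S \<and> \<sigma> \<in> Bad T"

text \<open>The first argument of an oracle is the number of inductiveness checks made before, so that
  the choice of the counterexample need not be the same when a candidate is checked again.\<close>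

type_synonym oracle_fun = "nat \<Rightarrow> state set \<Rightarrow> answer"

definition correct_oracle :: "tsys \<Rightarrow> oracle_fun \<Rightarrow> bool" where
  "correct_oracle T \<omega> \<longleftrightarrow> (\<forall>q S. S \<subseteq> states (nvars T) \<longrightarrow> correct_answer T S (\<omega> q S))"

section \<open>The machine model\<close>

text \<open>An algorithm is a program for a random access machine under the uniform cost criterion,
  with addition and truncated subtraction as its only arithmetic.  Its memory consists of
  arrays of natural numbers that are addressed by name; a scalar variable is the cell 0 of an
  array.  The program is one finite text, independent of the number of variables of the input
  system, and it has access to the system only through the three checks.\<close>

type_synonym vname = string
type_synonym mem = "vname \<Rightarrow> nat \<Rightarrow> nat"

datatype aexp = N nat | Cell vname aexp | Plus aexp aexp | Minus aexp aexp

datatype bexp = Less aexp aexp | NotB bexp | AndB bexp bexp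

datatype com =
    Skip
  | Assign vname aexp aexp  \<comment> \<open>array, index, new value\<close>
  | Seq com com
  | Cond bexp com com
  | While bexp com
  | IndCheck aexp
  | BmcBad aexp
  | BmcInit aexp

fun aval :: "aexp \<Rightarrow> mem \<Rightarrow> nat" where
  "aval (N c) m = c"
| "aval (Cell x e) m = m x (aval e m)"
| "aval (Plus e1 e2) m = aval e1 m + aval e2 m"
| "aval (Minus e1 e2) m = aval e1 m - aval e2 m"

fun bval :: "bexp \<Rightarrow> mem \<Rightarrow> bool" where
  "bval (Less e1 e2) m \<longleftrightarrow> aval e1 m < aval e2 m"
| "bval (NotB b) m \<longleftrightarrow> \<not> bval b m"
| "bval (AndB b1 b2) m \<longleftrightarrow> bval b1 m \<and> bval b2 m"

definition store :: "vname \<Rightarrow> nat \<Rightarrow> nat \<Rightarrow> mem \<Rightarrow> mem" where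
  "store x i v m = m(x := (m x)(i := v))"

definition store_state :: "vname \<Rightarrow> state \<Rightarrow> mem \<Rightarrow> mem" where
  "store_state x \<sigma> m =
     m(x := (\<lambda>i. if i < length \<sigma> then (if \<sigma> ! i then 1 else 0) else m x i))"

text \<open>A formula is held in memory as a circuit whose gates are numbered: \<open>op\<close> gives the kind of a
  gate, \<open>arg1\<close> and \<open>arg2\<close> its inputs (for a variable, \<open>arg1\<close> is its index).  A gate may feed
  several others.  Gate \<open>a\<close> represents no formula if a cycle or an unknown kind is reachable
  from it.\<close>

inductive represents :: "mem \<Rightarrow> nat \<Rightarrow> fml \<Rightarrow> bool" for m :: mem where
  "m ''op'' a = 0 \<Longrightarrow> represents m a FF"
| "m ''op'' a = 1 \<Longrightarrow> represents m a TT"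
| "m ''op'' a = 2 \<Longrightarrow> represents m a (Var (m ''arg1'' a))"
| "m ''op'' a = 3 \<Longrightarrow> represents m (m ''arg1'' a) f \<Longrightarrow> represents m a (Neg f)"
| "m ''op'' a = 4 \<Longrightarrow> represents m (m ''arg1'' a) f \<Longrightarrow> represents m (m ''arg2'' a) g \<Longrightarrow>
     represents m a (Conj f g)"
| "m ''op'' a = 5 \<Longrightarrow> represents m (m ''arg1'' a) f \<Longrightarrow> represents m (m ''arg2'' a) g \<Longrightarrow>
     represents m a (Disj f g)"

definition represents_over :: "nat \<Rightarrow> mem \<Rightarrow> nat \<Rightarrow> fml \<Rightarrow> bool" where
  "represents_over n m a f \<longleftrightarrow> represents m a f \<and> vars f \<subseteq> {..<n}"

fun store_answer :: "answer \<Rightarrow> mem \<Rightarrow> mem" where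
  "store_answer Yes m = store ''ans'' 0 0 m"
| "store_answer (CexInit \<sigma>) m = store ''ans'' 0 1 (store_state ''cex1'' \<sigma> m)"
| "store_answer (CexStep \<sigma> \<sigma>') m =
     store ''ans'' 0 2 (store_state ''cex2'' \<sigma>' (store_state ''cex1'' \<sigma> m))"
| "store_answer (CexBad \<sigma>) m = store ''ans'' 0 3 (store_state ''cex1'' \<sigma> m)"

record config =
  mem_of :: mem
  ind_checks :: nat
  bmc_checks :: nat
  steps :: nat

definition tick :: "mem \<Rightarrow> config \<Rightarrow> config" where
  "tick m s = s\<lparr>mem_of := m, steps := steps s + 1\<rparr>"

definition tick_ind :: "mem \<Rightarrow> config \<Rightarrow> config" where
  "tick_ind m s = (tick m s)\<lparr>ind_checks := ind_checks s + 1\<rparr>"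

definition tick_bmc :: "bool \<Rightarrow> config \<Rightarrow> config" where
  "tick_bmc disjoint s =
     (tick (store ''ans'' 0 (if disjoint then 0 else 1) (mem_of s)) s)
       \<lparr>bmc_checks := bmc_checks s + 1\<rparr>"

text \<open>Assignments, tests and checks take one step each.  The expressions in them are of constant
  size since they belong to the program text.  A check of a gate that represents no formula over
  the variables of the system has no execution.\<close>

inductive exec :: "tsys \<Rightarrow> nat \<Rightarrow> oracle_fun \<Rightarrow> com \<Rightarrow> config \<Rightarrow> config \<Rightarrow> bool"
  for T :: tsys and k :: nat and \<omega> :: oracle_fun where
  Skip: "exec T k \<omega> Skip s (tick (mem_of s) s)"
| Assign: "exec T k \<omega> (Assign x i e) s
     (tick (store x (aval i (mem_of s)) (aval e (mem_of s)) (mem_of s)) s)"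
| Seq: "exec T k \<omega> c1 s s1 \<Longrightarrow> exec T k \<omega> c2 s1 s2 \<Longrightarrow> exec T k \<omega> (Seq c1 c2) s s2"
| CondTrue: "bval b (mem_of s) \<Longrightarrow> exec T k \<omega> c1 (tick (mem_of s) s) t \<Longrightarrow>
     exec T k \<omega> (Cond b c1 c2) s t"
| CondFalse: "\<not> bval b (mem_of s) \<Longrightarrow> exec T k \<omega> c2 (tick (mem_of s) s) t \<Longrightarrow>
     exec T k \<omega> (Cond b c1 c2) s t"
| WhileTrue: "bval b (mem_of s) \<Longrightarrow> exec T k \<omega> c (tick (mem_of s) s) s1 \<Longrightarrow>
     exec T k \<omega> (While b c) s1 t \<Longrightarrow> exec T k \<omega> (While b c) s t"
| WhileFalse: "\<not> bval b (mem_of s) \<Longrightarrow> exec T k \<omega> (While b c) s (tick (mem_of s) s)"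
| IndCheck: "represents_over (nvars T) (mem_of s) (aval e (mem_of s)) f \<Longrightarrow>
     exec T k \<omega> (IndCheck e) s
       (tick_ind (store_answer (\<omega> (ind_checks s) (models (nvars T) f)) (mem_of s)) s)"
| BmcBad: "represents_over (nvars T) (mem_of s) (aval e (mem_of s)) f \<Longrightarrow>
     exec T k \<omega> (BmcBad e) s
       (tick_bmc (reach_le (Trans T) k (models (nvars T) f) \<inter> Bad T = {}) s)"
| BmcInit: "represents_over (nvars T) (mem_of s) (aval e (mem_of s)) f \<Longrightarrow>
     exec T k \<omega> (BmcInit e) s
       (tick_bmc (reach_le (Trans T) k (Init T) \<inter> models (nvars T) f = {}) s)"

definition start :: "nat \<Rightarrow> nat \<Rightarrow> config" where
  "start n k =
     \<lparr>mem_of = store ''n'' 0 n (store ''k'' 0 k (\<lambda>x i. 0)),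
      ind_checks = 0, bmc_checks = 0, steps = 0\<rparr>"

definition outputs_invariant :: "tsys \<Rightarrow> config \<Rightarrow> bool" where
  "outputs_invariant T s \<longleftrightarrow>
     (\<exists>f. represents_over (nvars T) (mem_of s) (mem_of s ''out'' 0) f \<and>
          inductive_invariant T (models (nvars T) f))"

text \<open>Programs are deterministic, so the existence of an execution with some property says that
  the execution terminates and has this property.\<close>

lemma represents_unique: "represents m a f \<Longrightarrow> represents m a g \<Longrightarrow> f = g"
proof (induction arbitrary: g rule: represents.induct)
  case (1 a)
  from 1(2) show ?case by cases (use 1(1) in auto)
next
  case (2 a)
  from 2(2) show ?case by cases (use 2(1) in auto)
next
  case (3 a)
  from 3(2) show ?case by cases (use 3(1) in auto)
next
  case (4 a f)
  from 4(4) show ?case by cases (use 4(1,3) in auto)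
next
  case (5 a f g')
  from 5(6) show ?case by cases (use 5(1,4,5) in auto)
next
  case (6 a f g')
  from 6(6) show ?case by cases (use 6(1,4,5) in auto)
qed

lemma represents_over_unique:
  "represents_over n m a f \<Longrightarrow> represents_over n m a g \<Longrightarrow> f = g"
  unfolding represents_over_def using represents_unique by blast

lemma exec_deterministic: "exec T k \<omega> c s t \<Longrightarrow> exec T k \<omega> c s u \<Longrightarrow> t = u"
proof (induction arbitrary: u rule: exec.induct)
  case (Skip s)
  then show ?case by cases auto
next
  case (Assign x i e s)
  then show ?case by cases auto
next
  case (Seq c1 s s1 c2 s2)
  from Seq.prems show ?case by cases (use Seq.IH in metis)
next
  case (CondTrue b s c1 t c2)
  from CondTrue.prems show ?case by cases (use CondTrue in metis)+
next
  case (CondFalse b s c2 t c1)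
  from CondFalse.prems show ?case by cases (use CondFalse in metis)+
next
  case (WhileTrue b s c s1 t)
  from WhileTrue.prems show ?case by cases (use WhileTrue in metis)+
next
  case (WhileFalse b s c)
  from WhileFalse.prems show ?case by cases (use WhileFalse in metis)+
next
  case (IndCheck s e f)
  from IndCheck.prems show ?case
    by cases (use IndCheck.hyps represents_over_unique in metis)
next
  case (BmcBad s e f)
  from BmcBad.prems show ?case
    by cases (use BmcBad.hyps represents_over_unique in metis)
next
  case (BmcInit s e f)
  from BmcInit.prems show ?case
    by cases (use BmcInit.hyps represents_over_unique in metis)
qed

end

theory Submission
  imports Defs
begin

text \<open>The algorithm is Bshouty's CDNF learner.  The candidate is a conjunction of hypotheses
  \<open>H a\<close>, one for each point \<open>a\<close> outside \<open>I\<close> met so far, and \<open>H a\<close> is a disjunction of terms,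
  each consisting of the literals in which a point \<open>u\<close> of \<open>I\<close>, locally closest to \<open>a\<close>, differs
  from \<open>a\<close>.  A new negative point falsifies a new clause of the CNF, and each \<open>H a\<close> receives at
  most one term for each term of the DNF, which bounds the number of rounds by
  \<open>m2 + m1 * m2 + 1\<close>.  Along a path of neighbors that starts in \<open>I\<close>, the fences turn a bounded
  model check into a membership test.  Scanning the hypotheses for one that rejects a positive
  point would be too expensive, so it is found by binary search: the variables of the circuit are
  replaced by constants, whereupon a single check against \<open>Init\<close> evaluates the conjunction of
  any number of the first hypotheses.\<close>

section \<open>Learning from boundary points\<close>

text \<open>\<open>I\<close> need not be monotone, so flipping one coordinate can make flips at
  earlier coordinates possible. Only a pass without any change certifies local minimality; every
  other pass removes at least one of at most \<open>n\<close> differences, so \<open>n\<close>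
  passes of \<open>n\<close> checks suffice. This walk makes a round quadratic in \<open>n\<close>;
  the rest of a round is linear. Rebuilding or scanning the candidate would bring its size into the
  cost of every round, hence the persistent shared circuit: a new term or hypothesis takes a
  constant number of writes per variable and a constant number of further writes. A counterexample
  to a step does not say which of its two states misclassifies. The membership test on the
  post-state decides this, since a post-state outside \<open>I\<close> forces the pre-state outside
  \<open>I\<close>. The test needs a known point of \<open>I\<close>; it comes from checking the
  constant false, which can only be refuted by an initial state. The binary search takes
  \<open>n + 1\<close> probes because the stored negative points are distinct, hence at most
  \<open>2 ^ n\<close>.\<close>

definition above :: "nat \<Rightarrow> state \<Rightarrow> state \<Rightarrow> state \<Rightarrow> bool" where
  "above n a u \<sigma> \<longleftrightarrow> (\<forall>j<n. u ! j \<noteq> a ! j \<longrightarrow> \<sigma> ! j = u ! j)"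

text \<open>After shifting coordinates by xor with \<open>a\<close>, \<open>above\<close> is the
  componentwise order, so \<open>hyp\<close> is the upward closure of \<open>us\<close>: a monotone
  DNF in the shifted coordinates. A point \<open>a\<close> of length \<open>n\<close> outside
  \<open>I\<close> is rejected by it when all of \<open>us\<close> are in \<open>I\<close>, as each
  of them differs from \<open>a\<close> somewhere.\<close>

definition hyp :: "nat \<Rightarrow> state \<Rightarrow> state list \<Rightarrow> state \<Rightarrow> bool" where
  "hyp n a us \<sigma> \<longleftrightarrow> (\<exists>u\<in>set us. above n a u \<sigma>)"

definition prefix_hyp :: "nat \<Rightarrow> state list \<Rightarrow> state list list \<Rightarrow> nat \<Rightarrow> state \<Rightarrow> bool" where
  "prefix_hyp n as us l \<sigma> \<longleftrightarrow> (\<forall>i<l. hyp n (as ! i) (us ! i) \<sigma>)"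

lemma prefix_hyp_0: "prefix_hyp n as us 0 \<sigma>"
  by (simp add: prefix_hyp_def)

lemma prefix_hyp_Suc:
  "prefix_hyp n as us (Suc l) \<sigma> \<longleftrightarrow> prefix_hyp n as us l \<sigma> \<and> hyp n (as ! l) (us ! l) \<sigma>"
  by (auto simp: prefix_hyp_def less_Suc_eq)

lemma list_update_same: "w ! j = b \<Longrightarrow> w[j := b] = w"
  by (erule subst) (rule list_update_id)

section \<open>Greedy descent towards a negative point inside \<open>I\<close>\<close>

definition local_min :: "nat \<Rightarrow> state set \<Rightarrow> state \<Rightarrow> state \<Rightarrow> bool" where
  "local_min n I a u \<longleftrightarrow> (\<forall>j<n. u ! j \<noteq> a ! j \<longrightarrow> u[j := a ! j] \<notin> I)"

definition flip_step :: "state set \<Rightarrow> state \<Rightarrow> nat \<Rightarrow> state \<Rightarrow> state" where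
  "flip_step I a j w = (if w[j := a ! j] \<in> I then w[j := a ! j] else w)"

primrec partial_pass :: "state set \<Rightarrow> state \<Rightarrow> state \<Rightarrow> nat \<Rightarrow> state" where
  "partial_pass I a w 0 = w"
| "partial_pass I a w (Suc j) = flip_step I a j (partial_pass I a w j)"

primrec passes :: "nat \<Rightarrow> state set \<Rightarrow> state \<Rightarrow> state \<Rightarrow> nat \<Rightarrow> state" where
  "passes n I a w 0 = w"
| "passes n I a w (Suc r) = partial_pass I a (passes n I a w r) n"

definition diffs :: "nat \<Rightarrow> state \<Rightarrow> state \<Rightarrow> nat set" where
  "diffs n a w = {j. j < n \<and> w ! j \<noteq> a ! j}"

lemma finite_diffs [simp]: "finite (diffs n a w)"
  by (simp add: diffs_def)

lemma partial_pass_in: "w \<in> I \<Longrightarrow> partial_pass I a w j \<in> I"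
  by (induction j) (auto simp: flip_step_def)

lemma length_partial_pass [simp]: "length (partial_pass I a w j) = length w"
  by (induction j) (auto simp: flip_step_def)

lemma diffs_flip_step: "diffs n a (flip_step I a j w) \<subseteq> diffs n a w"
  by (cases "j < length w")
    (auto simp: diffs_def flip_step_def nth_list_update list_update_beyond split: if_splits)

lemma diffs_partial_pass: "diffs n a (partial_pass I a w j) \<subseteq> diffs n a w"
  by (induction j) (use diffs_flip_step in \<open>auto, blast\<close>)

text \<open>As long as nothing has changed, all positions have been tested at one and the same
  point, which is what local minimality asks for. A single successful flip removes an index from
  \<open>diffs\<close>, and later flips never add one.\<close>

lemma partial_pass_progress:
  assumes "length w = n" "j \<le> n"
  shows "(partial_pass I a w j = w \<and> (\<forall>i<j. w ! i \<noteq> a ! i \<longrightarrow> w[i := a ! i] \<notin> I)) \<or>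
    diffs n a (partial_pass I a w j) \<subset> diffs n a w"
  using assms(2)
proof (induction j)
  case (Suc j)
  let ?w = "partial_pass I a w j"
  have sub: "diffs n a (flip_step I a j ?w) \<subseteq> diffs n a ?w" by (rule diffs_flip_step)
  show ?case
  proof (cases "diffs n a ?w \<subset> diffs n a w")
    case True
    then show ?thesis using sub by auto
  next
    case False
    with Suc have eq: "?w = w" and min: "\<forall>i<j. w ! i \<noteq> a ! i \<longrightarrow> w[i := a ! i] \<notin> I" by auto
    show ?thesis
    proof (cases "w ! j \<noteq> a ! j \<and> w[j := a ! j] \<in> I")
      case True
      then have "j \<in> diffs n a w" "j \<notin> diffs n a (w[j := a ! j])"
        using Suc.prems assms(1) by (auto simp: diffs_def)
      then have "diffs n a (flip_step I a j w) \<subset> diffs n a w"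
        using True sub eq by (auto simp: flip_step_def)
      then show ?thesis using eq by simp
    next
      case False
      then have "flip_step I a j w = w"
        unfolding flip_step_def using list_update_same[of w j "a ! j"] by auto
      then show ?thesis using eq min False by (auto simp: less_Suc_eq)
    qed
  qed
qed simp

lemma passes_in: "w \<in> I \<Longrightarrow> passes n I a w r \<in> I"
  by (induction r) (auto simp: partial_pass_in)

lemma length_passes [simp]: "length (passes n I a w r) = length w"
  by (induction r) auto

lemma diffs_passes: "diffs n a (passes n I a w r) \<subseteq> diffs n a w"
  by (induction r) (use diffs_partial_pass in \<open>auto, blast\<close>)

text \<open>A pass that changes something uses up one of the at most \<open>n\<close> differences,
  so \<open>r\<close> such passes leave at most \<open>n - r\<close>.\<close>

lemma passes_progress:
  assumes "length w = n"
  shows "local_min n I a (passes n I a w r) \<or> card (diffs n a (passes n I a w r)) + r \<le> n"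
proof (induction r)
  case 0
  have "diffs n a w \<subseteq> {..<n}" by (auto simp: diffs_def)
  then show ?case using card_mono[of "{..<n}" "diffs n a w"] by simp
next
  case (Suc r)
  let ?w = "passes n I a w r"
  \<comment> \<open>A local minimum is a fixed point of every pass, so minimality persists once it
    has been reached.\<close>
  have fixed: "partial_pass I a u j = u" if "local_min n I a u" "j \<le> n" for u j
    using that(2)
  proof (induction j)
    case (Suc j)
    show ?case using Suc that(1) list_update_same[of u j "a ! j"]
      by (cases "u ! j = a ! j") (auto simp: flip_step_def local_min_def)
  qed simp
  consider "partial_pass I a ?w n = ?w" "local_min n I a ?w"
    | "diffs n a (partial_pass I a ?w n) \<subset> diffs n a ?w"
    using partial_pass_progress[of ?w n n I a] assms by (auto simp: local_min_def)
  then show ?case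
  proof cases
    case 2
    then have "card (diffs n a (partial_pass I a ?w n)) < card (diffs n a ?w)"
      by (intro psubset_card_mono) auto
    then show ?thesis using Suc fixed[of ?w n] by auto
  qed simp
qed

text \<open>If no earlier pass was stable, the difference set is empty after \<open>n\<close>
  passes, and then there is nothing left to flip.\<close>

lemma local_min_passes:
  assumes "length w = n"
  shows "local_min n I a (passes n I a w n)"
proof -
  have "local_min n I a (passes n I a w n) \<or> diffs n a (passes n I a w n) = {}"
    using passes_progress[OF assms, of I a n] by auto
  then show ?thesis by (auto simp: local_min_def diffs_def)
qed

text \<open>Each coordinate of the end point comes from \<open>w\<close> or from \<open>a\<close>;
  where it differs from \<open>a\<close> it is still that of \<open>w\<close>. Hence the term built
  from the end point of the walk accepts the counterexample \<open>w\<close> from which the walk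
  started.\<close>

lemma above_passes: "above n a (passes n I a w r) w" if "length w = n"
proof -
  have "\<forall>j<n. passes n I a w r ! j \<noteq> w ! j \<longrightarrow> passes n I a w r ! j = a ! j"
    using diffs_passes[of n a I w r] unfolding diffs_def by blast
  then show ?thesis unfolding above_def by metis
qed

text \<open>A locally minimal point agrees with \<open>a\<close> outside the term that it satisfies, so it is
  determined by that term.\<close>

lemma card_local_min:
  assumes I: "I = {\<sigma> \<in> states n. dnf_holds \<sigma> G}" and G: "literals_over n G"
    and U: "\<And>u. u \<in> U \<Longrightarrow> u \<in> I \<and> local_min n I a u"
  shows "card U \<le> length G"
proof -
  have "\<exists>t. t \<in> set G \<and> (\<forall>l\<in>set t. lit_holds u l)" if "u \<in> U" for u
    using U[OF that] I by (auto simp: dnf_holds_def)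
  then obtain f where f: "\<And>u. u \<in> U \<Longrightarrow> f u \<in> set G \<and> (\<forall>l\<in>set (f u). lit_holds u l)"
    by metis
  have det: "u ! j = (if \<exists>b. (j, b) \<in> set (f u) then (j, True) \<in> set (f u) else a ! j)"
    if u: "u \<in> U" and j: "j < n" for u j
  proof (cases "\<exists>b. (j, b) \<in> set (f u)")
    case True
    then obtain b where b: "(j, b) \<in> set (f u)" by auto
    have "u ! j = c" if "(j, c) \<in> set (f u)" for c
      using f[OF u] that by (auto simp: lit_holds_def)
    then show ?thesis using b by (metis (full_types))
  next
    case False
    \<comment> \<open>The chosen term does not mention \<open>j\<close>, so it survives resetting
      \<open>j\<close>, and the modified point is still in \<open>I\<close>. Minimality then leaves
      only \<open>u ! j = a ! j\<close>.\<close>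
    have "u[j := a ! j] \<in> I"
    proof -
      have "lit_holds (u[j := a ! j]) l" if "l \<in> set (f u)" for l
      proof -
        have "fst l \<noteq> j" using False that by (metis prod.collapse)
        then show ?thesis using f[OF u] that by (auto simp: lit_holds_def)
      qed
      then have "dnf_holds (u[j := a ! j]) G" using f[OF u] unfolding dnf_holds_def by blast
      then show ?thesis using U[OF u] I by (auto simp: states_def)
    qed
    then show ?thesis using U[OF u] j False unfolding local_min_def by auto
  qed
  have "inj_on f U"
  proof (rule inj_onI)
    fix u u' assume *: "u \<in> U" "u' \<in> U" "f u = f u'"
    then have "length u = n" "length u' = n" using U I by (auto simp: states_def)
    moreover have "u ! j = u' ! j" if "j < n" for j
      using det[OF *(1) that] det[OF *(2) that] *(3) by simp
    ultimately show "u = u'" by (simp add: nth_equalityI)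
  qed
  moreover have "f ` U \<subseteq> set G" using f by auto
  ultimately have "card U \<le> card (set G)" by (meson List.finite_set card_inj_on_le)
  then show ?thesis using card_length le_trans by blast
qed

text \<open>Together with its CNF counterpart this gives \<open>m1 * m2\<close> \<ge> 1, so that
  additive terms can be absorbed into the final bounds.\<close>

lemma dnf_nonempty: "has_dnf n I m \<Longrightarrow> I \<noteq> {} \<Longrightarrow> m \<ge> 1"
  by (cases m) (auto simp: has_dnf_def dnf_holds_def)

lemma cnf_nonempty: "has_cnf n I m \<Longrightarrow> I \<noteq> states n \<Longrightarrow> m \<ge> 1"
  by (cases m) (auto simp: has_cnf_def cnf_holds_def)

lemma card_states: "finite (states n)" "card (states n) = 2 ^ n"
  unfolding states_def
  using finite_lists_length_eq[of "UNIV :: bool set" n] card_lists_length_eq[of "UNIV :: bool set" n]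
  by (auto simp: card_UNIV_bool)

section \<open>Bounded reachability and neighboring states\<close>

lemma reach_le_invariant:
  assumes "inductive_invariant T I" "S \<subseteq> I"
  shows "reach_le (Trans T) k S \<subseteq> I"
proof -
  have step: "\<sigma> \<in> I \<Longrightarrow> (\<sigma>, \<tau>) \<in> Trans T \<Longrightarrow> \<tau> \<in> I" for \<sigma> \<tau>
    using assms(1) unfolding inductive_invariant_def by blast
  have "\<sigma> \<in> I \<Longrightarrow> (\<sigma>, \<tau>) \<in> Trans T ^^ j \<Longrightarrow> \<tau> \<in> I" for \<sigma> \<tau> j
    by (induction j arbitrary: \<tau>) (auto intro: step)
  then show ?thesis using assms(2) by (auto simp: reach_le_def)
qed

lemma relpow_converse_iff:
  fixes R :: "('a \<times> 'a) set"
  shows "(x, y) \<in> (R\<inverse>) ^^ j \<longleftrightarrow> (y, x) \<in> R ^^ j"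
proof (induction j arbitrary: x y)
  case (Suc j)
  have "(x, y) \<in> (R\<inverse>) ^^ Suc j \<longleftrightarrow> (\<exists>z. (x, z) \<in> (R\<inverse>) ^^ j \<and> (y, z) \<in> R)" by auto
  also have "\<dots> \<longleftrightarrow> (\<exists>z. (y, z) \<in> R \<and> (z, x) \<in> R ^^ j)" using Suc by blast
  also have "\<dots> \<longleftrightarrow> (y, x) \<in> R ^^ Suc j" by (meson relpow_Suc_D2 relpow_Suc_I2)
  finally show ?case .
qed auto

lemma neighbors_update:
  assumes "length w = n" "j < n" "w[j := b] \<noteq> w"
  shows "neighbors (w[j := b]) w"
proof -
  have "{i. i < length w \<and> w[j := b] ! i \<noteq> w ! i} = {j}"
    using assms by (auto simp: nth_list_update list_update_same_conv split: if_splits)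
  then show ?thesis by (simp add: neighbors_def)
qed

section \<open>Programs and their running time\<close>

text \<open>Each bounded model check is itself one step, so the time bound is also a bound on these
  checks and no separate count is kept.\<close>

lemma bmc_checks_le_steps:
  "exec T k \<omega> c s t \<Longrightarrow> bmc_checks t + steps s \<le> bmc_checks s + steps t"
  by (induction rule: exec.induct) (auto simp: tick_def tick_ind_def tick_bmc_def)

text \<open>A total-correctness triple with a time budget \<open>D\<close>. It demands that
  \<open>ind_checks\<close> stays unchanged because inductiveness checks occur only at the start and
  at the head of the main loop, where they are counted by hand.\<close>

definition run :: "tsys \<Rightarrow> nat \<Rightarrow> oracle_fun \<Rightarrow> com \<Rightarrow> nat \<Rightarrow> (mem \<Rightarrow> bool) \<Rightarrow> mem \<Rightarrow> bool" where
  "run T k \<omega> c D Q m \<longleftrightarrow>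
     (\<forall>s. mem_of s = m \<longrightarrow> (\<exists>s'. exec T k \<omega> c s s' \<and> Q (mem_of s') \<and>
        ind_checks s' = ind_checks s \<and> steps s' \<le> steps s + D))"

text \<open>Weakest preconditions for straight-line code with branches and bounded checks. The value
  \<open>False\<close> for loops and inductiveness checks restricts the calculus to code that
  \<open>run\<close> can describe with a bound read off from the program text; loops get their own
  rule.\<close>

fun wps :: "tsys \<Rightarrow> nat \<Rightarrow> com \<Rightarrow> (mem \<Rightarrow> bool) \<Rightarrow> mem \<Rightarrow> bool" where
  "wps T k Skip Q m \<longleftrightarrow> Q m"
| "wps T k (Assign x i e) Q m \<longleftrightarrow> Q (store x (aval i m) (aval e m) m)"
| "wps T k (Seq c1 c2) Q m \<longleftrightarrow> wps T k c1 (wps T k c2 Q) m"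
| "wps T k (Cond b c1 c2) Q m \<longleftrightarrow> (if bval b m then wps T k c1 Q m else wps T k c2 Q m)"
| "wps T k (While b c) Q m \<longleftrightarrow> False"
| "wps T k (IndCheck e) Q m \<longleftrightarrow> False"
| "wps T k (BmcBad e) Q m \<longleftrightarrow> (\<exists>f. represents_over (nvars T) m (aval e m) f \<and>
     Q (store ''ans'' 0
          (if reach_le (Trans T) k (models (nvars T) f) \<inter> Bad T = {} then 0 else 1) m))"
| "wps T k (BmcInit e) Q m \<longleftrightarrow> (\<exists>f. represents_over (nvars T) m (aval e m) f \<and>
     Q (store ''ans'' 0
          (if reach_le (Trans T) k (Init T) \<inter> models (nvars T) f = {} then 0 else 1) m))"

fun loop_free_cost :: "com \<Rightarrow> nat" where
  "loop_free_cost (Seq c1 c2) = loop_free_cost c1 + loop_free_cost c2"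
| "loop_free_cost (Cond b c1 c2) = 1 + max (loop_free_cost c1) (loop_free_cost c2)"
| "loop_free_cost c = 1"

lemma run_mono:
  assumes "run T k \<omega> c D Q m" "\<And>m'. Q m' \<Longrightarrow> Q' m'" "D \<le> D'"
  shows "run T k \<omega> c D' Q' m"
  unfolding run_def
proof (intro allI impI)
  fix s :: config assume "mem_of s = m"
  then obtain s' where "exec T k \<omega> c s s'" "Q (mem_of s')" "ind_checks s' = ind_checks s"
    "steps s' \<le> steps s + D"
    using assms(1) unfolding run_def by blast
  then show "\<exists>s'. exec T k \<omega> c s s' \<and> Q' (mem_of s') \<and>
    ind_checks s' = ind_checks s \<and> steps s' \<le> steps s + D'"
    using assms(2,3) by (intro exI[of _ s']) auto
qed

lemma run_Seq:
  assumes "run T k \<omega> c1 D1 R m" "\<And>m'. R m' \<Longrightarrow> run T k \<omega> c2 D2 Q m'" "D1 + D2 \<le> D"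
  shows "run T k \<omega> (Seq c1 c2) D Q m"
  unfolding run_def
proof (intro allI impI)
  fix s :: config assume "mem_of s = m"
  then obtain s1 where s1: "exec T k \<omega> c1 s s1" "R (mem_of s1)" "ind_checks s1 = ind_checks s"
    "steps s1 \<le> steps s + D1"
    using assms(1) unfolding run_def by blast
  then obtain s2 where s2: "exec T k \<omega> c2 s1 s2" "Q (mem_of s2)" "ind_checks s2 = ind_checks s1"
    "steps s2 \<le> steps s1 + D2"
    using assms(2) unfolding run_def by blast
  show "\<exists>s'. exec T k \<omega> (Seq c1 c2) s s' \<and> Q (mem_of s') \<and>
    ind_checks s' = ind_checks s \<and> steps s' \<le> steps s + D"
    using exec.Seq[OF s1(1) s2(1)] s1 s2 assms(3) by (intro exI[of _ s2]) auto
qed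

lemma run_Cond:
  assumes "bval b m \<Longrightarrow> run T k \<omega> c1 D Q m" "\<not> bval b m \<Longrightarrow> run T k \<omega> c2 D Q m" "D + 1 \<le> D'"
  shows "run T k \<omega> (Cond b c1 c2) D' Q m"
  unfolding run_def
proof (intro allI impI)
  fix s :: config assume m: "mem_of s = m"
  let ?s = "tick (mem_of s) s"
  have [simp]: "mem_of ?s = m" "ind_checks ?s = ind_checks s" "steps ?s = steps s + 1"
    using m by (auto simp: tick_def)
  show "\<exists>s'. exec T k \<omega> (Cond b c1 c2) s s' \<and> Q (mem_of s') \<and>
    ind_checks s' = ind_checks s \<and> steps s' \<le> steps s + D'"
  proof (cases "bval b m")
    case True
    then obtain t where "exec T k \<omega> c1 ?s t" "Q (mem_of t)" "ind_checks t = ind_checks s"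
      "steps t \<le> steps s + 1 + D"
      using assms(1)[OF True] unfolding run_def by force
    then show ?thesis using exec.CondTrue[of b s T k \<omega> c1 t c2] True m assms(3)
      by (intro exI[of _ t]) auto
  next
    case False
    then obtain t where "exec T k \<omega> c2 ?s t" "Q (mem_of t)" "ind_checks t = ind_checks s"
      "steps t \<le> steps s + 1 + D"
      using assms(2)[OF False] unfolding run_def by force
    then show ?thesis using exec.CondFalse[of b s T k \<omega> c2 t c1] False m assms(3)
      by (intro exI[of _ t]) auto
  qed
qed

lemma run_wps:
  "wps T k c Q m \<Longrightarrow> loop_free_cost c \<le> D \<Longrightarrow> run T k \<omega> c D Q m"
proof (induction c arbitrary: Q m D)
  case Skip
  then show ?case by (force simp: run_def tick_def intro: exec.Skip)
next
  case (Assign x i e)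
  show ?case unfolding run_def
  proof (intro allI impI)
    fix s :: config assume "mem_of s = m"
    then show "\<exists>s'. exec T k \<omega> (Assign x i e) s s' \<and> Q (mem_of s') \<and>
      ind_checks s' = ind_checks s \<and> steps s' \<le> steps s + D"
      using Assign exec.Assign[of T k \<omega> x i e s] by (auto simp: tick_def)
  qed
next
  case (Seq c1 c2)
  have "run T k \<omega> c1 (loop_free_cost c1) (wps T k c2 Q) m" using Seq by auto
  then show ?case by (rule run_Seq) (use Seq in auto)
next
  case (Cond b c1 c2)
  show ?case by (rule run_Cond[where D = "max (loop_free_cost c1) (loop_free_cost c2)"]) (use Cond in auto)
next
  case (BmcBad e)
  show ?case unfolding run_def
  proof (intro allI impI)
    fix s :: config assume "mem_of s = m"
    then show "\<exists>s'. exec T k \<omega> (BmcBad e) s s' \<and> Q (mem_of s') \<and>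
      ind_checks s' = ind_checks s \<and> steps s' \<le> steps s + D"
      using BmcBad exec.BmcBad[of T s e _ k \<omega>] by (force simp: tick_def tick_bmc_def)
  qed
next
  case (BmcInit e)
  show ?case unfolding run_def
  proof (intro allI impI)
    fix s :: config assume "mem_of s = m"
    then show "\<exists>s'. exec T k \<omega> (BmcInit e) s s' \<and> Q (mem_of s') \<and>
      ind_checks s' = ind_checks s \<and> steps s' \<le> steps s + D"
      using BmcInit exec.BmcInit[of T s e _ k \<omega>] by (force simp: tick_def tick_bmc_def)
  qed
qed auto

section \<open>Counted loops and their cost\<close>

definition for_com :: "vname \<Rightarrow> aexp \<Rightarrow> com \<Rightarrow> com" where
  "for_com x e c = Seq (Assign x (N 0) (N 0))
     (While (Less (Cell x (N 0)) e) (Seq c (Assign x (N 0) (Plus (Cell x (N 0)) (N 1)))))"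

lemma run_While_count:
  assumes body: "\<And>j m. j < M \<Longrightarrow> P j m \<Longrightarrow> bval b m \<and> run T k \<omega> c D (P (Suc j)) m"
    and exit: "\<And>m. P M m \<Longrightarrow> \<not> bval b m"
    and "P j m" "j \<le> M"
  shows "run T k \<omega> (While b c) ((M - j) * (D + 1) + 1) (P M) m"
  using assms(3,4)
proof (induction "M - j" arbitrary: j m)
  case 0
  then have [simp]: "j = M" by simp
  show ?case unfolding run_def
  proof (intro allI impI)
    fix s :: config assume "mem_of s = m"
    then show "\<exists>s'. exec T k \<omega> (While b c) s s' \<and> P M (mem_of s') \<and>
      ind_checks s' = ind_checks s \<and> steps s' \<le> steps s + ((M - j) * (D + 1) + 1)"
      using exec.WhileFalse[of b s T k \<omega> c] exit[of m] 0 by (force simp: tick_def)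
  qed
next
  case (Suc d)
  then have j: "j < M" by simp
  show ?case unfolding run_def
  proof (intro allI impI)
    fix s :: config assume m: "mem_of s = m"
    let ?s = "tick (mem_of s) s"
    have [simp]: "mem_of ?s = m" "ind_checks ?s = ind_checks s" "steps ?s = steps s + 1"
      using m by (auto simp: tick_def)
    obtain s1 where s1: "exec T k \<omega> c ?s s1" "P (Suc j) (mem_of s1)"
      "ind_checks s1 = ind_checks s" "steps s1 \<le> steps s + 1 + D"
      using body[OF j Suc.prems(1)] unfolding run_def by force
    have "run T k \<omega> (While b c) ((M - Suc j) * (D + 1) + 1) (P M) (mem_of s1)"
      using Suc.hyps s1(2) j by (intro Suc.hyps(1)) auto
    then obtain t where t: "exec T k \<omega> (While b c) s1 t" "P M (mem_of t)"
      "ind_checks t = ind_checks s1" "steps t \<le> steps s1 + ((M - Suc j) * (D + 1) + 1)"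
      unfolding run_def by blast
    have "exec T k \<omega> (While b c) s t"
      using exec.WhileTrue[of b s T k \<omega> c s1 t] body[OF j Suc.prems(1)] m s1(1) t(1) by simp
    moreover have "(M - j) * (D + 1) = (M - Suc j) * (D + 1) + (D + 1)"
      using j by (metis Suc_diff_Suc add.commute mult_Suc)
    ultimately show "\<exists>s'. exec T k \<omega> (While b c) s s' \<and> P M (mem_of s') \<and>
      ind_checks s' = ind_checks s \<and> steps s' \<le> steps s + ((M - j) * (D + 1) + 1)"
      using t s1 by (intro exI[of _ t]) auto
  qed
qed

text \<open>Of the cost, 2 pays for the initial assignment and the failing last test; each iteration
  adds a test and an increment to its body. The limit \<open>e\<close> is evaluated anew before each
  iteration, hence the requirement that the invariant fixes its value.\<close>

lemma run_for:
  assumes init: "P 0 (store x 0 0 m)"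
    and body: "\<And>j m. j < M \<Longrightarrow> P j m \<Longrightarrow> m x 0 = j \<Longrightarrow>
      run T k \<omega> c D (\<lambda>m'. m' x 0 = j \<and> P (Suc j) (store x 0 (Suc j) m')) m"
    and bound: "\<And>j m. P j m \<Longrightarrow> aval e m = M"
    and exit: "\<And>m. P M m \<Longrightarrow> Q m"
    and cost: "2 + M * (D + 2) \<le> D'"
  shows "run T k \<omega> (for_com x e c) D' Q m"
proof -
  let ?P = "\<lambda>j m. m x 0 = j \<and> P j m"
  let ?c = "Seq c (Assign x (N 0) (Plus (Cell x (N 0)) (N 1)))"
  have step: "run T k \<omega> ?c (D + 1) (?P (Suc j)) m" if "j < M" "?P j m" for j m
  proof (rule run_Seq)
    show "run T k \<omega> c D (\<lambda>m'. m' x 0 = j \<and> P (Suc j) (store x 0 (Suc j) m')) m"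
      using body that by blast
    show "run T k \<omega> (Assign x (N 0) (Plus (Cell x (N 0)) (N 1))) 1 (?P (Suc j)) m'"
      if "m' x 0 = j \<and> P (Suc j) (store x 0 (Suc j) m')" for m'
      using that by (intro run_wps) (auto simp: store_def)
  qed simp
  show ?thesis unfolding for_com_def
  proof (rule run_Seq)
    show "run T k \<omega> (Assign x (N 0) (N 0)) 1 (?P 0) m"
      using init by (intro run_wps) (auto simp: store_def)
    show "run T k \<omega> (While (Less (Cell x (N 0)) e) ?c) (M * (D + 2) + 1) Q m'" if "?P 0 m'" for m'
    proof (rule run_mono)
      show "run T k \<omega> (While (Less (Cell x (N 0)) e) ?c) ((M - 0) * ((D + 1) + 1) + 1) (?P M) m'"
        by (rule run_While_count) (use that step bound in auto)
    qed (use exit in auto)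
  qed (use cost in auto)
qed

section \<open>Circuits\<close>

text \<open>The meaning of a gate is a predicate rather than a formula, so that it can be stated
  uniformly whether the variable gates hold variables or constants.\<close>

definition den :: "nat \<Rightarrow> mem \<Rightarrow> nat \<Rightarrow> (state \<Rightarrow> bool) \<Rightarrow> bool" where
  "den n m a P \<longleftrightarrow> (\<exists>f. represents_over n m a f \<and> (\<forall>\<sigma>. sat \<sigma> f \<longleftrightarrow> P \<sigma>))"

lemma den_FF: "m ''op'' a = 0 \<Longrightarrow> den n m a (\<lambda>_. False)"
  unfolding den_def represents_over_def
  by (intro exI[of _ FF]) (auto intro: represents.intros)

lemma den_TT: "m ''op'' a = 1 \<Longrightarrow> den n m a (\<lambda>_. True)"
  unfolding den_def represents_over_def
  by (intro exI[of _ TT]) (auto intro: represents.intros)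

lemma den_Var: "m ''op'' a = 2 \<Longrightarrow> m ''arg1'' a = i \<Longrightarrow> i < n \<Longrightarrow> den n m a (\<lambda>\<sigma>. \<sigma> ! i)"
  unfolding den_def represents_over_def
  by (intro exI[of _ "Var i"]) (auto intro: represents.intros)

lemma den_Neg: "m ''op'' a = 3 \<Longrightarrow> den n m (m ''arg1'' a) P \<Longrightarrow> den n m a (\<lambda>\<sigma>. \<not> P \<sigma>)"
  unfolding den_def represents_over_def
  by (elim exE, rename_tac f, rule_tac x = "Neg f" in exI) (auto intro: represents.intros)

lemma den_Conj:
  "m ''op'' a = 4 \<Longrightarrow> den n m (m ''arg1'' a) P \<Longrightarrow> den n m (m ''arg2'' a) P' \<Longrightarrow>
    den n m a (\<lambda>\<sigma>. P \<sigma> \<and> P' \<sigma>)"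
  unfolding den_def represents_over_def
  by (elim exE, rename_tac f f', rule_tac x = "Conj f f'" in exI) (auto intro: represents.intros)

lemma den_Disj:
  "m ''op'' a = 5 \<Longrightarrow> den n m (m ''arg1'' a) P \<Longrightarrow> den n m (m ''arg2'' a) P' \<Longrightarrow>
    den n m a (\<lambda>\<sigma>. P \<sigma> \<or> P' \<sigma>)"
  unfolding den_def represents_over_def
  by (elim exE, rename_tac f f', rule_tac x = "Disj f f'" in exI) (auto intro: represents.intros)

lemma den_cong: "den n m a P \<Longrightarrow> (\<And>\<sigma>. P \<sigma> \<longleftrightarrow> P' \<sigma>) \<Longrightarrow> den n m a P'"
  by (simp add: den_def)

lemma den_models:
  "den n m a P \<longleftrightarrow> (\<exists>f. represents_over n m a f \<and> (\<forall>\<sigma>. sat \<sigma> f \<longleftrightarrow> P \<sigma>) \<and>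
     models n f = {\<sigma> \<in> states n. P \<sigma>})"
  by (auto simp: den_def models_def)

text \<open>The gates from \<open>g\<close> on form a linked list that ends in the constant true at
  \<open>g + n'\<close>; the induction runs from that end. Point formulas and terms of hypotheses
  share this shape.\<close>

lemma den_Conj_chain:
  assumes "m ''op'' (g + n') = 1"
    and "\<And>j. j < n' \<Longrightarrow> m ''op'' (g + j) = 4"
    and "\<And>j. j < n' \<Longrightarrow> den n m (m ''arg1'' (g + j)) (L j)"
    and "\<And>j. j < n' \<Longrightarrow> m ''arg2'' (g + j) = Suc (g + j)"
  shows "den n m g (\<lambda>\<sigma>. \<forall>j<n'. L j \<sigma>)"
proof -
  have "den n m (g + j) (\<lambda>\<sigma>. \<forall>i. j \<le> i \<and> i < n' \<longrightarrow> L i \<sigma>)" if "j \<le> n'" for j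
    using that
  proof (induction "n' - j" arbitrary: j)
    case 0
    then show ?case by (intro den_cong[OF den_TT]) (use assms(1) in auto)
  next
    case (Suc d)
    then have "j < n'" by simp
    have "den n m (Suc (g + j)) (\<lambda>\<sigma>. \<forall>i. Suc j \<le> i \<and> i < n' \<longrightarrow> L i \<sigma>)"
      using Suc.hyps(1)[of "Suc j"] Suc.hyps(2) \<open>j < n'\<close> by simp
    then have "den n m (g + j) (\<lambda>\<sigma>. L j \<sigma> \<and> (\<forall>i. Suc j \<le> i \<and> i < n' \<longrightarrow> L i \<sigma>))"
      using assms(2-4)[OF \<open>j < n'\<close>] by (intro den_Conj) auto
    then show ?case
      by (rule den_cong) (use \<open>j < n'\<close> in \<open>auto simp: Suc_le_eq\<close>, metis le_neq_implies_less)
  qed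
  from this[of 0] show ?thesis by simp
qed

section \<open>Layout of points, terms and hypotheses in memory\<close>

definition lit_gate :: "nat \<Rightarrow> bool \<Rightarrow> nat \<Rightarrow> nat" where
  "lit_gate n b j = j + (if b then 0 else n)"

text \<open>The gates \<open>0, \<dots>, n - 1\<close> stand for the variables, the next \<open>n\<close> for their negations, and
  gate \<open>2 n\<close> for the characteristic formula of the point \<open>p\<close>; gates \<open>3 n\<close> and \<open>3 n + 1\<close> are
  constants.  Replacing the kinds \<open>kd\<close> of the first \<open>n\<close> gates by truth values, which are coded as
  the kinds 0 and 1, evaluates every formula of the heap at a point without copying it.\<close>

definition fixed :: "nat \<Rightarrow> state \<Rightarrow> (nat \<Rightarrow> nat) \<Rightarrow> mem \<Rightarrow> bool" where
  "fixed n p kd m \<longleftrightarrow>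
     m ''n'' 0 = n \<and> m ''sel'' 0 = n \<and> m ''sel'' 1 = 0 \<and> (\<forall>j\<le>n. m ''pw'' j = 2 ^ j) \<and>
     length p = n \<and>
     (\<forall>j<n. m ''op'' j = kd j \<and> m ''arg1'' j = j \<and>
        m ''op'' (n + j) = 3 \<and> m ''arg1'' (n + j) = j \<and>
        m ''op'' (2 * n + j) = 4 \<and> m ''arg1'' (2 * n + j) = lit_gate n (p ! j) j \<and>
        m ''arg2'' (2 * n + j) = Suc (2 * n + j) \<and> m ''w'' j = of_bool (p ! j)) \<and>
     m ''op'' (3 * n) = 1 \<and> m ''op'' (3 * n + 1) = 0"

text \<open>Where \<open>u\<close> agrees with \<open>a\<close> the list has the constant true, gate
  \<open>3 * n\<close>, in place of a literal. So every term occupies exactly \<open>n + 1\<close>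
  consecutive gates, and gate addresses need no bookkeeping.\<close>

definition term_gates :: "mem \<Rightarrow> nat \<Rightarrow> nat set \<Rightarrow> state \<Rightarrow> state \<Rightarrow> nat \<Rightarrow> bool" where
  "term_gates m n Z a u g \<longleftrightarrow> {g..g + n} \<subseteq> Z \<and> m ''op'' (g + n) = 1 \<and>
     (\<forall>j<n. m ''op'' (g + j) = 4 \<and>
        m ''arg1'' (g + j) = (if u ! j = a ! j then 3 * n else lit_gate n (u ! j) j) \<and>
        m ''arg2'' (g + j) = Suc (g + j))"

text \<open>A linked list of disjunction gates: a term is prepended with one new cell, and all the
  old cells stay as they are.\<close>

fun dnf_gates :: "mem \<Rightarrow> nat \<Rightarrow> nat set \<Rightarrow> state \<Rightarrow> nat \<Rightarrow> state list \<Rightarrow> bool" where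
  "dnf_gates m n Z a g [] \<longleftrightarrow> g \<in> Z \<and> m ''op'' g = 0"
| "dnf_gates m n Z a g (u # us) \<longleftrightarrow> g \<in> Z \<and> m ''op'' g = 5 \<and>
     term_gates m n Z a u (m ''arg1'' g) \<and> dnf_gates m n Z a (m ''arg2'' g) us"

text \<open>The top gate \<open>g\<close> conjoins the preceding prefix \<open>pr\<close> with the
  DNF of this hypothesis. It lies outside \<open>Z\<close> because its second input is redirected
  whenever a term is prepended. The same number \<open>g\<close> serves as the offset of
  \<open>a\<close> in the array \<open>A\<close>; reserving \<open>g\<close> to \<open>g + n\<close>
  keeps the copies of different points apart.\<close>

definition block :: "nat \<Rightarrow> nat set \<Rightarrow> mem \<Rightarrow> nat \<Rightarrow> nat \<Rightarrow> state \<Rightarrow> state list \<Rightarrow> bool" where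
  "block n Z m pr g a us \<longleftrightarrow> 3 * n + 1 < g \<and> g + n < m ''free'' 0 \<and> g \<notin> Z \<and>
     m ''op'' g = 4 \<and> m ''arg1'' g = pr \<and> dnf_gates m n Z a (m ''arg2'' g) us \<and>
     (\<forall>j<n. m ''A'' (g + j) = of_bool (a ! j))"

text \<open>Gate \<open>pg i\<close> holds the conjunction of the first \<open>i\<close> hypotheses.  Only the gates in \<open>Z\<close>,
  which hold the hypotheses themselves, are never changed.\<close>

definition heap :: "nat \<Rightarrow> state list \<Rightarrow> state list list \<Rightarrow> nat set \<Rightarrow> mem \<Rightarrow> bool" where
  "heap n as us Z m \<longleftrightarrow>
     length us = length as \<and> m ''t'' 0 = length as \<and> m ''pg'' 0 = 3 * n \<and>
     3 * n + 1 < m ''free'' 0 \<and> Z \<subseteq> {3 * n + 1..<m ''free'' 0} \<and> 3 * n + 1 \<in> Z \<and>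
     inj_on (m ''pg'') {..length as} \<and>
     (\<forall>i<length as. block n Z m (m ''pg'' i) (m ''pg'' (Suc i)) (as ! i) (us ! i))"

lemma dnf_gates_cong:
  assumes "\<And>x g. x \<in> {''op'', ''arg1'', ''arg2''} \<Longrightarrow> g \<in> Z \<Longrightarrow> m' x g = m x g" "Z \<subseteq> Z'"
  shows "dnf_gates m n Z a g us \<Longrightarrow> dnf_gates m' n Z' a g us"
proof (induction us arbitrary: g)
  case Nil
  then show ?case using assms by auto
next
  case (Cons u us)
  then have g: "g \<in> Z" "{m ''arg1'' g..m ''arg1'' g + n} \<subseteq> Z" by (auto simp: term_gates_def)
  have "m ''arg1'' g + j \<in> Z" if "j \<le> n" for j using g(2) that by auto
  then show ?case using Cons g assms by (auto simp: term_gates_def)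
qed

text \<open>The blocks read only gates above \<open>3 * n\<close> and below \<open>free\<close>, so
  the variable gates and the point formula may change underneath, and fresh gates may be prepared
  above, without disturbing any hypothesis.\<close>

lemma heap_cong:
  assumes "heap n as us Z m"
    and "\<And>x. x \<in> {''pg'', ''t'', ''free''} \<Longrightarrow> m' x = m x"
    and "\<And>x g. x \<in> {''op'', ''arg1'', ''arg2'', ''A''} \<Longrightarrow> 3 * n < g \<Longrightarrow> g < m ''free'' 0 \<Longrightarrow>
      m' x g = m x g"
  shows "heap n as us Z m'"
proof -
  have Z: "g \<in> Z \<Longrightarrow> 3 * n < g \<and> g < m ''free'' 0" for g
    using assms(1) unfolding heap_def by force
  have "block n Z m' pr g a us" if "block n Z m pr g a us" for pr g a us
  proof -
    have "3 * n < g" "g + n < m ''free'' 0" using that unfolding block_def by auto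
    then have "m' x (g + j) = m x (g + j)" if "x \<in> {''op'', ''arg1'', ''arg2'', ''A''}" "j \<le> n" for x j
      using assms(3)[OF that(1)] that(2) by auto
    note * = this[of _ 0] this[of "''A''"]
    have "dnf_gates m' n Z a (m ''arg2'' g) us"
      by (rule dnf_gates_cong[of Z m' m Z]) (use assms(3) Z that in \<open>auto simp: block_def\<close>)
    then show ?thesis using that assms(2) * unfolding block_def by auto
  qed
  then show ?thesis using assms(1,2) unfolding heap_def by auto
qed

lemma fixed_cong:
  assumes "fixed n p kd m"
    and "\<And>x. x \<in> {''n'', ''sel'', ''pw'', ''w''} \<Longrightarrow> m' x = m x"
    and "\<And>x g. x \<in> {''op'', ''arg1'', ''arg2''} \<Longrightarrow> g \<le> 3 * n + 1 \<Longrightarrow> m' x g = m x g"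
  shows "fixed n p kd m'"
  using assms unfolding fixed_def by auto

section \<open>Denotation of the stored circuits\<close>

lemma den_lit:
  assumes "fixed n p kd m" "\<And>j. j < n \<Longrightarrow> den n m j (\<lambda>\<sigma>. r \<sigma> ! j)" "j < n"
  shows "den n m (lit_gate n b j) (\<lambda>\<sigma>. r \<sigma> ! j = b)"
proof (cases b)
  case True
  then show ?thesis using assms(2)[OF assms(3)] by (simp add: lit_gate_def)
next
  case False
  have "den n m (n + j) (\<lambda>\<sigma>. \<not> r \<sigma> ! j)"
    using assms by (intro den_Neg) (auto simp: fixed_def)
  then show ?thesis using False by (simp add: lit_gate_def add.commute)
qed

lemma den_point:
  assumes "fixed n p kd m" "\<And>j. j < n \<Longrightarrow> den n m j (\<lambda>\<sigma>. r \<sigma> ! j)"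
  shows "den n m (2 * n) (\<lambda>\<sigma>. \<forall>j<n. r \<sigma> ! j = p ! j)"
  by (rule den_Conj_chain) (use assms den_lit[OF assms] in \<open>auto simp: fixed_def\<close>)

lemma den_term:
  assumes "fixed n p kd m" "\<And>j. j < n \<Longrightarrow> den n m j (\<lambda>\<sigma>. r \<sigma> ! j)" "term_gates m n Z a u g"
  shows "den n m g (\<lambda>\<sigma>. above n a u (r \<sigma>))"
  unfolding above_def
proof (rule den_Conj_chain)
  fix j assume j: "j < n"
  have "den n m (3 * n) (\<lambda>_. True)" using assms(1) by (intro den_TT) (simp add: fixed_def)
  then show "den n m (m ''arg1'' (g + j)) (\<lambda>\<sigma>. u ! j \<noteq> a ! j \<longrightarrow> r \<sigma> ! j = u ! j)"
    using den_lit[OF assms(1,2) j] assms(3) j by (auto simp: term_gates_def)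
qed (use assms(3) in \<open>auto simp: term_gates_def\<close>)

lemma den_dnf:
  assumes "fixed n p kd m" "\<And>j. j < n \<Longrightarrow> den n m j (\<lambda>\<sigma>. r \<sigma> ! j)"
  shows "dnf_gates m n Z a g us \<Longrightarrow> den n m g (\<lambda>\<sigma>. hyp n a us (r \<sigma>))"
proof (induction us arbitrary: g)
  case Nil
  then show ?case by (auto simp: hyp_def intro: den_FF)
next
  case (Cons u us)
  have "den n m g (\<lambda>\<sigma>. above n a u (r \<sigma>) \<or> hyp n a us (r \<sigma>))"
    using Cons den_term[OF assms] by (intro den_Disj) auto
  then show ?case by (rule den_cong) (auto simp: hyp_def)
qed

text \<open>The map \<open>r\<close> records what the variable gates currently mean. With the
  identity the gate denotes the candidate; with a constant map to \<open>v\<close> it denotes the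
  value of the candidate at \<open>v\<close>. One induction covers both.\<close>

lemma den_prefix:
  assumes "fixed n p kd m" "\<And>j. j < n \<Longrightarrow> den n m j (\<lambda>\<sigma>. r \<sigma> ! j)" "heap n as us Z m"
  shows "l \<le> length as \<Longrightarrow> den n m (m ''pg'' l) (\<lambda>\<sigma>. prefix_hyp n as us l (r \<sigma>))"
proof (induction l)
  case 0
  then show ?case using assms(1,3)
    by (intro den_cong[OF den_TT]) (auto simp: fixed_def heap_def prefix_hyp_0)
next
  case (Suc l)
  then have b: "block n Z m (m ''pg'' l) (m ''pg'' (Suc l)) (as ! l) (us ! l)"
    using assms(3) by (auto simp: heap_def)
  have "den n m (m ''pg'' (Suc l)) (\<lambda>\<sigma>. prefix_hyp n as us l (r \<sigma>) \<and> hyp n (as ! l) (us ! l) (r \<sigma>))"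
    using b Suc den_dnf[OF assms(1,2)] by (intro den_Conj) (auto simp: block_def)
  then show ?case by (simp add: prefix_hyp_Suc)
qed

lemma den_vars: "fixed n p (\<lambda>_. 2) m \<Longrightarrow> j < n \<Longrightarrow> den n m j (\<lambda>\<sigma>. \<sigma> ! j)"
  by (intro den_Var) (auto simp: fixed_def)

lemma den_consts:
  assumes "fixed n p (\<lambda>j. of_bool (v ! j)) m" "j < n"
  shows "den n m j (\<lambda>\<sigma>. v ! j)"
proof (cases "v ! j")
  case True
  then show ?thesis using assms den_TT[of m j n] by (simp add: fixed_def)
next
  case False
  then show ?thesis using assms den_FF[of m j n] by (simp add: fixed_def)
qed

section \<open>Preservation and growth of the memory invariant\<close>

definition core :: "nat \<Rightarrow> state \<Rightarrow> (nat \<Rightarrow> nat) \<Rightarrow> state list \<Rightarrow> state list list \<Rightarrow> nat set \<Rightarrow> mem \<Rightarrow> bool" where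
  "core n p kd as us Z m \<longleftrightarrow> fixed n p kd m \<and> heap n as us Z m"

definition arr :: "mem \<Rightarrow> vname \<Rightarrow> state \<Rightarrow> bool" where
  "arr m x \<sigma> \<longleftrightarrow> (\<forall>j<length \<sigma>. m x j = of_bool (\<sigma> ! j))"

definition frame :: "vname set \<Rightarrow> mem \<Rightarrow> mem \<Rightarrow> bool" where
  "frame X m m' \<longleftrightarrow> (\<forall>x. x \<notin> X \<longrightarrow> m' x = m x)"

lemma store_apply: "store x i v m y j = (if x = y \<and> i = j then v else m y j)"
  by (auto simp: store_def)

lemma store_other: "x \<noteq> y \<Longrightarrow> store x i v m y = m y"
  by (auto simp: store_def)

lemma arr_store [simp]: "x \<noteq> y \<Longrightarrow> arr (store y i v m) x \<sigma> = arr m x \<sigma>"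
  by (simp add: arr_def store_other)

lemma frame_refl [simp]: "frame X m m"
  by (simp add: frame_def)

lemma frame_store [simp]: "x \<in> X \<Longrightarrow> frame X m (store x i v m') \<longleftrightarrow> frame X m m'"
  by (auto simp: frame_def store_def)

lemma frame_trans: "frame X m m' \<Longrightarrow> frame Y m' m'' \<Longrightarrow> X \<subseteq> Z \<Longrightarrow> Y \<subseteq> Z \<Longrightarrow> frame Z m m''"
  by (simp add: frame_def subset_iff) metis

lemma frameD: "frame X m m' \<Longrightarrow> x \<notin> X \<Longrightarrow> m' x = m x"
  by (simp add: frame_def)

lemma arr_frame: "frame X m m' \<Longrightarrow> x \<notin> X \<Longrightarrow> arr m x \<sigma> \<Longrightarrow> arr m' x \<sigma>"
  by (simp add: frame_def arr_def)

lemma core_frame: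
  assumes c: "core n p kd as us Z m1" and "frame X m1 m2"
    and "X \<inter> {''n'', ''sel'', ''pw'', ''w'', ''op'', ''arg1'', ''arg2'', ''pg'', ''t'', ''free'', ''A''} = {}"
  shows "core n p kd as us Z m2"
proof -
  have eq: "m2 y = m1 y"
    if "y \<in> {''n'', ''sel'', ''pw'', ''w'', ''op'', ''arg1'', ''arg2'', ''pg'', ''t'', ''free'', ''A''}" for y
    by (rule frameD[OF assms(2)]) (rule notI, drule IntI[OF _ that], simp only: assms(3) empty_iff)
  have "fixed n p kd m2"
    by (rule fixed_cong[of n p kd m1]) (use c in \<open>simp_all add: core_def, (elim disjE; simp add: eq)+\<close>)
  moreover have "heap n as us Z m2"
    by (rule heap_cong[of n as us Z m1]) (use c in \<open>simp_all add: core_def, (elim disjE; simp add: eq)+\<close>)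
  ultimately show ?thesis by (simp add: core_def)
qed

lemma core_store:
  assumes "x \<notin> {''n'', ''sel'', ''pw'', ''w'', ''op'', ''arg1'', ''arg2'', ''pg'', ''t'', ''free'', ''A''}"
  shows "core n p kd as us Z (store x i v m) \<longleftrightarrow> core n p kd as us Z m"
proof
  have "frame {x} (store x i v m) m" by (simp add: frame_def store_other)
  then show "core n p kd as us Z m" if "core n p kd as us Z (store x i v m)"
    using that assms by (intro core_frame[of n p kd as us Z "store x i v m" "{x}" m]) simp_all
  have "frame {x} m (store x i v m)" by simp
  then show "core n p kd as us Z (store x i v m)" if "core n p kd as us Z m"
    using that assms by (intro core_frame[of n p kd as us Z m "{x}" "store x i v m"]) simp_all
qed

text \<open>The array \<open>w\<close> and the literal in the point formula must change together.
  That takes two writes, so moving to a neighbor never rebuilds the formula of the current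
  point.\<close>

lemma core_set_bit:
  assumes "core n p kd as us Z m" "j < n"
  shows "core n (p[j := b]) kd as us Z
    (store ''arg1'' (2 * n + j) (lit_gate n b j) (store ''w'' j (of_bool b) m))"
  unfolding core_def
proof
  show "fixed n (p[j := b]) kd (store ''arg1'' (2 * n + j) (lit_gate n b j) (store ''w'' j (of_bool b) m))"
    using assms unfolding core_def fixed_def by (auto simp: store_apply)
  show "heap n as us Z (store ''arg1'' (2 * n + j) (lit_gate n b j) (store ''w'' j (of_bool b) m))"
    by (rule heap_cong[of n as us Z m]) (use assms in \<open>auto simp: core_def store_apply store_other\<close>)
qed

lemma core_set_kind:
  assumes "core n p kd as us Z m" "j < n"
  shows "core n p (kd(j := b)) as us Z (store ''op'' j b m)"
  unfolding core_def
proof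
  show "fixed n p (kd(j := b)) (store ''op'' j b m)"
    using assms unfolding core_def fixed_def by (auto simp: store_apply)
  show "heap n as us Z (store ''op'' j b m)"
    by (rule heap_cong[of n as us Z m]) (use assms in \<open>auto simp: core_def store_apply store_other\<close>)
qed

lemma core_kind_cong:
  "core n p kd as us Z m \<Longrightarrow> (\<And>j. j < n \<Longrightarrow> kd j = kd' j) \<Longrightarrow> core n p kd' as us Z m"
  by (simp add: core_def fixed_def)

text \<open>This allows a term or a block to be assembled beyond \<open>free\<close> write by write,
  with the invariant intact until the finished piece is linked in.\<close>

lemma core_store_free:
  assumes "core n p kd as us Z m" "x \<in> {''op'', ''arg1'', ''arg2'', ''A''}" "m ''free'' 0 \<le> g"
  shows "core n p kd as us Z (store x g v m)"
proof -
  have c: "fixed n p kd m" "heap n as us Z m" using assms(1) by (auto simp: core_def)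
  have low: "store x g v m y g' = m y g'" if "g' < m ''free'' 0" for y g'
    using that assms(3) by (simp add: store_apply)
  have other: "store x g v m y = m y"
    if "y \<in> {''n'', ''sel'', ''pw'', ''w'', ''pg'', ''t'', ''free''}" for y
  proof -
    have "x \<noteq> y" using that assms(2) by blast
    then show ?thesis by (rule store_other)
  qed
  have free: "3 * n + 1 < m ''free'' 0" using c(2) by (simp add: heap_def)
  have "fixed n p kd (store x g v m)"
  proof (rule fixed_cong[OF c(1)])
    show "store x g v m y = m y" if "y \<in> {''n'', ''sel'', ''pw'', ''w''}" for y
      by (rule other) (use that in blast)
    show "store x g v m y g' = m y g'" if "g' \<le> 3 * n + 1" for y g'
      using free that by (intro low) simp
  qed
  moreover have "heap n as us Z (store x g v m)"
  proof (rule heap_cong[OF c(2)])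
    show "store x g v m y = m y" if "y \<in> {''pg'', ''t'', ''free''}" for y
      by (rule other) (use that in blast)
  qed (rule low)
  ultimately show ?thesis by (simp add: core_def)
qed

text \<open>The only change below \<open>free\<close> is the second input of \<open>g\<close>. No
  DNF passes through \<open>g\<close>, since \<open>g\<close> is not in \<open>Z\<close>, and no
  other block has \<open>g\<close> as its top gate, since \<open>pg\<close> is injective; hence
  every other hypothesis keeps its meaning, and the prefixes built on \<open>g\<close> pick up the
  new term without being touched.\<close>

lemma core_add_term:
  assumes c: "core n p kd as us Z m" and i: "i < length as"
    and g: "m ''pg'' (Suc i) = g" and f: "m ''free'' 0 = f"
    and t: "term_gates m n {f..f + n} (as ! i) u f"
    and d: "m ''op'' (Suc (f + n)) = 5" "m ''arg1'' (Suc (f + n)) = f" "m ''arg2'' (Suc (f + n)) = m ''arg2'' g"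
  shows "core n p kd as (us[i := u # us ! i]) (Z \<union> {f..Suc (f + n)})
    (store ''free'' 0 (f + n + 2) (store ''arg2'' g (Suc (f + n)) m))"
    (is "core n p kd as ?us ?Z ?m")
proof -
  have h: "heap n as us Z m" and fx: "fixed n p kd m" using c by (auto simp: core_def)
  have Z: "x \<in> Z \<Longrightarrow> 3 * n < x \<and> x < f" for x using h f unfolding heap_def by force
  have bl: "block n Z m (m ''pg'' l) (m ''pg'' (Suc l)) (as ! l) (us ! l)" if "l < length as" for l
    using h that by (simp add: heap_def)
  have g': "3 * n + 1 < g" "g + n < f" "g \<notin> Z" using bl[OF i] g f by (auto simp: block_def)
  have same: "?m x = m x" if "x \<noteq> ''arg2''" "x \<noteq> ''free''" for x
    using that by (simp add: store_other)
  have fx': "fixed n p kd ?m"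
    by (rule fixed_cong[OF fx]) (use g' in \<open>auto simp: store_apply store_other\<close>)
  have dn: "dnf_gates ?m n ?Z a x ws" if "dnf_gates m n Z a x ws" for a x ws
    by (rule dnf_gates_cong[OF _ _ that]) (use g' in \<open>auto simp: store_apply\<close>)
  have b': "block n ?Z ?m (?m ''pg'' l) (?m ''pg'' (Suc l)) (as ! l) (?us ! l)" if l: "l < length as" for l
  proof -
    have low: "3 * n + 1 < m ''pg'' (Suc l)" "m ''pg'' (Suc l) + n < f" "m ''pg'' (Suc l) \<notin> Z"
      using bl[OF l] f by (auto simp: block_def)
    have "dnf_gates ?m n ?Z (as ! l) (?m ''arg2'' (m ''pg'' (Suc l))) (?us ! l)"
    proof (cases "l = i")
      case True
      have "term_gates ?m n ?Z (as ! i) u f"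
        using t g' unfolding term_gates_def by (auto simp: store_apply)
      moreover have "dnf_gates ?m n ?Z (as ! i) (m ''arg2'' g) (us ! i)"
        using bl[OF i] g by (intro dn) (simp add: block_def)
      ultimately show ?thesis
        using True i g d g' h by (simp add: store_apply heap_def)
    next
      case False
      have "inj_on (m ''pg'') {..length as}" using h by (simp add: heap_def)
      then have "m ''pg'' (Suc l) \<noteq> g"
        using False g i l by (auto dest!: inj_onD)
      then show ?thesis
        using False dn bl[OF l] by (simp add: block_def store_apply)
    qed
    then show ?thesis using bl[OF l] low by (simp add: block_def store_other store_apply)
  qed
  have "heap n as ?us ?Z ?m"
    unfolding heap_def
  proof (intro conjI allI impI)
    show "?Z \<subseteq> {3 * n + 1..<?m ''free'' 0}" "3 * n + 1 < ?m ''free'' 0"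
      using Z g' by (force simp: store_apply Suc_le_eq)+
    show "inj_on (?m ''pg'') {..length as}" "?m ''t'' 0 = length as" "?m ''pg'' 0 = 3 * n"
      "3 * n + 1 \<in> ?Z" "length ?us = length as"
      using h by (simp_all add: heap_def store_other)
  qed (rule b')
  then show ?thesis using fx' by (simp add: core_def)
qed

text \<open>The new top gate extends the chain of prefixes by pointing to the last one. Its DNF is
  the shared constant false at \<open>3 * n + 1\<close>, so the hypothesis accepts nothing until a
  positive counterexample supplies a term.\<close>

lemma core_add_block:
  assumes c: "core n p kd as us Z m"
    and f: "m ''free'' 0 = f" and t: "length as = t"
    and gate: "m ''op'' f = 4" "m ''arg1'' f = m ''pg'' t" "m ''arg2'' f = 3 * n + 1"
    and a: "\<And>j. j < n \<Longrightarrow> m ''A'' (f + j) = of_bool (a ! j)"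
  shows "core n p kd (as @ [a]) (us @ [[]]) Z
    (store ''free'' 0 (f + n + 1) (store ''pg'' (Suc t) f (store ''t'' 0 (Suc t) m)))"
    (is "core n p kd ?as ?us Z ?m")
proof -
  have h: "heap n as us Z m" and fx: "fixed n p kd m" using c by (auto simp: core_def)
  have Z: "x \<in> Z \<Longrightarrow> 3 * n < x \<and> x < f" for x using h f unfolding heap_def by force
  have bl: "block n Z m (m ''pg'' l) (m ''pg'' (Suc l)) (as ! l) (us ! l)" if "l < length as" for l
    using h that by (simp add: heap_def)
  have same: "?m x = m x" if "x \<noteq> ''pg''" "x \<noteq> ''free''" "x \<noteq> ''t''" for x
    using that by (simp add: store_other)
  have pg: "?m ''pg'' l = m ''pg'' l" if "l \<noteq> Suc t" for l using that by (simp add: store_apply)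
  have fx': "fixed n p kd ?m"
    by (rule fixed_cong[OF fx]) (auto simp: store_other)
  have dn: "dnf_gates ?m n Z a x ws" if "dnf_gates m n Z a x ws" for a x ws
    by (rule dnf_gates_cong[OF _ _ that]) (auto simp: store_other)
  have b': "block n Z ?m (?m ''pg'' l) (?m ''pg'' (Suc l)) (?as ! l) (?us ! l)" if l: "l < length ?as" for l
  proof (cases "l = t")
    case True
    have "dnf_gates ?m n Z a (3 * n + 1) []"
      using h fx by (auto simp: heap_def fixed_def store_other)
    moreover have "length us = t" "3 * n + 1 < f" using h t f by (simp_all add: heap_def)
    moreover have "f \<notin> Z" using Z by blast
    ultimately show ?thesis
      using True t gate a by (simp add: block_def store_other pg nth_append) (simp add: store_apply)
  next
    case False
    then have "l < length as" using l t by simp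
    from bl[OF this] f have low: "m ''pg'' (Suc l) + n < f" by (simp add: block_def)
    show ?thesis using bl[OF \<open>l < length as\<close>] dn False t h f \<open>l < length as\<close>
      by (simp add: block_def store_other pg nth_append heap_def)
        (simp add: store_apply, use low in linarith)
  qed
  have "heap n ?as ?us Z ?m"
    unfolding heap_def
  proof (intro conjI allI impI)
    have "3 * n + 1 < f" using h f by (simp add: heap_def)
    then show "Z \<subseteq> {3 * n + 1..<?m ''free'' 0}" "3 * n + 1 < ?m ''free'' 0"
      using Z by (force simp: store_apply Suc_le_eq)+
    show "?m ''pg'' 0 = 3 * n" "3 * n + 1 \<in> Z" "length ?us = length ?as"
      using h by (simp_all add: heap_def store_apply)
    show "?m ''t'' 0 = length ?as" using t by (simp add: store_apply)
    have lt: "m ''pg'' l < f" if "l \<le> length as" for l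
    proof (cases l)
      case 0
      then show ?thesis using \<open>3 * n + 1 < f\<close> h by (simp add: heap_def)
    next
      case (Suc l')
      then show ?thesis using bl[of l'] that f by (simp add: block_def)
    qed
    have inj: "inj_on (m ''pg'') {..length as}" using h by (simp add: heap_def)
    show "inj_on (?m ''pg'') {..length ?as}"
    proof (rule inj_onI)
      fix l l' assume l: "l \<in> {..length ?as}" "l' \<in> {..length ?as}" "?m ''pg'' l = ?m ''pg'' l'"
      have *: "?m ''pg'' x = (if x = Suc t then f else m ''pg'' x)" for x
        by (simp add: store_apply)
      have "l \<le> t" if "l \<noteq> Suc t" using that l(1) t by simp
      moreover have "l' \<le> t" if "l' \<noteq> Suc t" using that l(2) t by simp
      ultimately show "l = l'"
        using l(3) lt[of l] lt[of l'] inj t unfolding *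
        by (auto split: if_splits dest: inj_onD)
    qed
  qed (rule b')
  then show ?thesis using fx' by (simp add: core_def)
qed

section \<open>The program\<close>

notation Seq (infixr ";;" 60)

abbreviation sc :: "vname \<Rightarrow> aexp" where
  "sc x \<equiv> Cell x (N 0)"

abbreviation set_sc :: "vname \<Rightarrow> aexp \<Rightarrow> com" where
  "set_sc x e \<equiv> Assign x (N 0) e"

abbreviation point_gate :: aexp where
  "point_gate \<equiv> Plus (sc ''n'') (sc ''n'')"

text \<open>The two-entry table \<open>sel\<close> turns a bit into the offset used by
  \<open>lit_gate\<close>, so the gate of a literal is found by one addition without a test.\<close>

definition set_bit :: "aexp \<Rightarrow> com" where
  "set_bit e = Assign ''w'' (sc ''j'') e ;;
     Assign ''arg1'' (Plus point_gate (sc ''j'')) (Plus (sc ''j'') (Cell ''sel'' (Cell ''w'' (sc ''j''))))"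

definition copy_com :: "vname \<Rightarrow> vname \<Rightarrow> com" where
  "copy_com x y = for_com ''j'' (sc ''n'') (Assign x (sc ''j'') (Cell y (sc ''j'')))"

definition load_com :: "vname \<Rightarrow> com" where
  "load_com x = for_com ''j'' (sc ''n'') (set_bit (Cell x (sc ''j'')))"

text \<open>The path leads from \<open>s0\<close> to \<open>v\<close> one coordinate at a time, and
  \<open>inI\<close> selects the fence for the next point. Answer 0 means disjointness: for
  \<open>BmcBad\<close> this puts the point inside \<open>I\<close>, for \<open>BmcInit\<close>
  outside, which explains the subtraction in one branch only.\<close>

definition member_com :: com where
  "member_com = load_com ''s0'' ;; set_sc ''inI'' (N 1) ;;
     for_com ''j'' (sc ''n'')
       (set_bit (Cell ''v'' (sc ''j'')) ;;
        Cond (Less (N 0) (sc ''inI''))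
          (BmcBad point_gate ;; set_sc ''inI'' (Minus (N 1) (sc ''ans'')))
          (BmcInit point_gate ;; set_sc ''inI'' (sc ''ans'')))"

text \<open>The jumps have lengths \<open>2 ^ n\<close> down to 1. A jump beyond the last hypothesis
  is skipped, and any other is accepted if all hypotheses up to its target accept \<open>v\<close>.
  Afterwards the variable gates get their kind 2 back.\<close>

definition find_com :: com where
  "find_com = for_com ''j'' (sc ''n'') (Assign ''op'' (sc ''j'') (Cell ''v'' (sc ''j''))) ;;
     set_sc ''pos'' (N 0) ;;
     for_com ''j'' (Plus (sc ''n'') (N 1))
       (set_sc ''cand'' (Plus (sc ''pos'') (Cell ''pw'' (Minus (sc ''n'') (sc ''j'')))) ;;
        Cond (Less (sc ''t'') (sc ''cand'')) Skip
          (BmcInit (Cell ''pg'' (sc ''cand'')) ;;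
           Cond (Less (N 0) (sc ''ans'')) (set_sc ''pos'' (sc ''cand'')) Skip)) ;;
     for_com ''j'' (sc ''n'') (Assign ''op'' (sc ''j'') (N 2))"

definition walk_com :: com where
  "walk_com = load_com ''v'' ;; set_sc ''g'' (Cell ''pg'' (Plus (sc ''pos'') (N 1))) ;;
     for_com ''r'' (sc ''n'')
       (for_com ''j'' (sc ''n'')
         (set_sc ''old'' (Cell ''w'' (sc ''j'')) ;;
          set_bit (Cell ''A'' (Plus (sc ''g'') (sc ''j''))) ;;
          BmcBad point_gate ;;
          Cond (Less (N 0) (sc ''ans'')) (set_bit (sc ''old'')) Skip))"

text \<open>Expressions have no equality test, so a difference of the two bits is detected by
  comparing them in both directions; the constant true written before serves as the default.\<close>

definition add_term_com :: com where
  "add_term_com =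
     for_com ''j'' (sc ''n'')
       (Assign ''op'' (Plus (sc ''free'') (sc ''j'')) (N 4) ;;
        Assign ''arg2'' (Plus (sc ''free'') (sc ''j'')) (Plus (Plus (sc ''free'') (sc ''j'')) (N 1)) ;;
        Assign ''arg1'' (Plus (sc ''free'') (sc ''j'')) (Plus (sc ''n'') point_gate) ;;
        Cond (Less (Cell ''w'' (sc ''j'')) (Cell ''A'' (Plus (sc ''g'') (sc ''j''))))
          (Assign ''arg1'' (Plus (sc ''free'') (sc ''j'')) (Plus (sc ''j'') (Cell ''sel'' (Cell ''w''
            (sc ''j'')))))
          (Cond (Less (Cell ''A'' (Plus (sc ''g'') (sc ''j''))) (Cell ''w'' (sc ''j'')))
            (Assign ''arg1'' (Plus (sc ''free'') (sc ''j'')) (Plus (sc ''j'') (Cell ''sel'' (Cell ''w''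
              (sc ''j'')))))
            Skip)) ;;
     Assign ''op'' (Plus (sc ''free'') (sc ''n'')) (N 1) ;;
     Assign ''op'' (Plus (Plus (sc ''free'') (sc ''n'')) (N 1)) (N 5) ;;
     Assign ''arg1'' (Plus (Plus (sc ''free'') (sc ''n'')) (N 1)) (sc ''free'') ;;
     Assign ''arg2'' (Plus (Plus (sc ''free'') (sc ''n'')) (N 1)) (Cell ''arg2'' (sc ''g'')) ;;
     Assign ''arg2'' (sc ''g'') (Plus (Plus (sc ''free'') (sc ''n'')) (N 1)) ;;
     set_sc ''free'' (Plus (Plus (sc ''free'') (sc ''n'')) (N 2))"

definition add_block_com :: com where
  "add_block_com =
     for_com ''j'' (sc ''n'') (Assign ''A'' (Plus (sc ''free'') (sc ''j'')) (Cell ''cex1'' (sc ''j''))) ;;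
     Assign ''op'' (sc ''free'') (N 4) ;;
     Assign ''arg1'' (sc ''free'') (Cell ''pg'' (sc ''t'')) ;;
     Assign ''arg2'' (sc ''free'') (Plus (Plus (sc ''n'') point_gate) (N 1)) ;;
     set_sc ''t'' (Plus (sc ''t'') (N 1)) ;;
     Assign ''pg'' (sc ''t'') (sc ''free'') ;;
     set_sc ''free'' (Plus (Plus (sc ''free'') (sc ''n'')) (N 1))"

text \<open>Powers of two are made by doubling, as the machine cannot multiply. The initial point is
  all false, hence the negative literals at \<open>j + n\<close>.\<close>

definition init_com :: com where
  "init_com = copy_com ''s0'' ''cex1'' ;;
     (set_sc ''sel'' (sc ''n'') ;; Assign ''sel'' (N 1) (N 0) ;; set_sc ''pw'' (N 1)) ;;
     for_com ''j'' (sc ''n'')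
       (Assign ''pw'' (Plus (sc ''j'') (N 1)) (Plus (Cell ''pw'' (sc ''j'')) (Cell ''pw'' (sc ''j'')))) ;;
     for_com ''j'' (sc ''n'')
       (Assign ''op'' (sc ''j'') (N 2) ;;
        Assign ''arg1'' (sc ''j'') (sc ''j'') ;;
        Assign ''op'' (Plus (sc ''n'') (sc ''j'')) (N 3) ;;
        Assign ''arg1'' (Plus (sc ''n'') (sc ''j'')) (sc ''j'') ;;
        Assign ''op'' (Plus point_gate (sc ''j'')) (N 4) ;;
        Assign ''arg1'' (Plus point_gate (sc ''j'')) (Plus (sc ''j'') (sc ''n'')) ;;
        Assign ''arg2'' (Plus point_gate (sc ''j'')) (Plus (Plus point_gate (sc ''j'')) (N 1)) ;;
        Assign ''w'' (sc ''j'') (N 0)) ;;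
     Assign ''op'' (Plus (sc ''n'') point_gate) (N 1) ;;
     Assign ''op'' (Plus (Plus (sc ''n'') point_gate) (N 1)) (N 0) ;;
     set_sc ''t'' (N 0) ;;
     set_sc ''pg'' (Plus (sc ''n'') point_gate) ;;
     set_sc ''free'' (Plus (Plus (sc ''n'') point_gate) (N 2))"

definition refine_com :: com where
  "refine_com = find_com ;; walk_com ;; add_term_com"

text \<open>A bad state in the candidate is a new negative point and an initial state outside it is
  a positive one. For a step counterexample, a post-state in \<open>I\<close> is a positive point
  that the candidate rejects; otherwise the pre-state is a negative point that it accepts, because
  \<open>I\<close> is inductive.\<close>

definition step_com :: com where
  "step_com =
     Cond (Less (sc ''ans'') (N 1)) (set_sc ''done'' (N 1))
       (Cond (Less (N 2) (sc ''ans'')) add_block_com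
         (Cond (Less (sc ''ans'') (N 2))
           (copy_com ''v'' ''cex1'' ;; refine_com)
           (copy_com ''v'' ''cex2'' ;; member_com ;;
            Cond (Less (N 0) (sc ''inI'')) refine_com add_block_com)))"

definition cdnf_com :: com where
  "cdnf_com = IndCheck (N 0) ;; init_com ;; set_sc ''done'' (N 0) ;;
     While (Less (sc ''done'') (N 1)) (IndCheck (Cell ''pg'' (sc ''t'')) ;; step_com) ;;
     set_sc ''out'' (Cell ''pg'' (sc ''t''))"

section \<open>Bounded model checks as membership tests\<close>

locale fenced_system =
  fixes T :: tsys and k :: nat and I :: "state set" and \<omega> :: oracle_fun
  assumes sys: "transition_system T" and inv: "inductive_invariant T I"
    and bfence: "backwards_fenced T k I" and ffence: "forwards_fenced T k I"
    and answers: "correct_oracle T \<omega>"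
begin

abbreviation "n \<equiv> nvars T"

lemma I_states: "\<sigma> \<in> I \<Longrightarrow> length \<sigma> = n"
  using inv by (auto simp: inductive_invariant_def states_def)

lemma Init_I: "\<sigma> \<in> Init T \<Longrightarrow> \<sigma> \<in> I"
  using inv by (auto simp: inductive_invariant_def)

text \<open>No bad state is reachable from inside an invariant. If the update leaves
  \<open>I\<close>, it does so to a neighbor of \<open>w\<close>, hence into the outer boundary,
  from which the backwards fence leads to \<open>Bad\<close> within \<open>k\<close> steps.\<close>

lemma update_in_I_iff_Bad_unreachable:
  assumes "w \<in> I" "j < n"
  shows "w[j := b] \<in> I \<longleftrightarrow> reach_le (Trans T) k {w[j := b]} \<inter> Bad T = {}"
proof
  assume "w[j := b] \<in> I"
  then have "reach_le (Trans T) k {w[j := b]} \<subseteq> I" by (intro reach_le_invariant[OF inv]) auto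
  then show "reach_le (Trans T) k {w[j := b]} \<inter> Bad T = {}"
    using inv by (auto simp: inductive_invariant_def)
next
  assume unreach: "reach_le (Trans T) k {w[j := b]} \<inter> Bad T = {}"
  show "w[j := b] \<in> I"
  proof (rule ccontr)
    assume out: "w[j := b] \<notin> I"
    have len: "length w = n" using I_states assms(1) by simp
    have "w[j := b] \<noteq> w" using out assms(1) by metis
    then have "neighbors (w[j := b]) w" using neighbors_update len assms(2) by simp
    then have "w[j := b] \<in> outer_boundary n I"
      using out assms(1) len by (auto simp: outer_boundary_def states_def)
    then have "w[j := b] \<in> reach_le ((Trans T)\<inverse>) k (Bad T)"
      using bfence by (auto simp: backwards_fenced_def)
    then obtain \<beta> i where "\<beta> \<in> Bad T" "i \<le> k" "(w[j := b], \<beta>) \<in> Trans T ^^ i"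
      by (auto simp: reach_le_def relpow_converse_iff)
    then have "\<beta> \<in> reach_le (Trans T) k {w[j := b]} \<inter> Bad T" by (auto simp: reach_le_def)
    then show False using unreach by auto
  qed
qed

text \<open>Dually, an update that enters \<open>I\<close> lands on the inner boundary, which the
  forwards fence makes reachable; everything reachable from \<open>Init\<close> lies in
  \<open>I\<close>.\<close>

lemma update_in_I_iff_reachable:
  assumes "w \<notin> I" "length w = n" "j < n"
  shows "w[j := b] \<in> I \<longleftrightarrow> reach_le (Trans T) k (Init T) \<inter> {w[j := b]} \<noteq> {}"
proof
  assume inI: "w[j := b] \<in> I"
  have "w[j := b] \<noteq> w" using inI assms(1) by metis
  then have "neighbors (w[j := b]) w" using neighbors_update assms by simp
  then have "w[j := b] \<in> inner_boundary n I"
    using inI assms by (auto simp: inner_boundary_def states_def)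
  then show "reach_le (Trans T) k (Init T) \<inter> {w[j := b]} \<noteq> {}"
    using ffence by (auto simp: forwards_fenced_def)
next
  assume "reach_le (Trans T) k (Init T) \<inter> {w[j := b]} \<noteq> {}"
  moreover have "reach_le (Trans T) k (Init T) \<subseteq> I"
    using Init_I by (intro reach_le_invariant[OF inv]) auto
  ultimately show "w[j := b] \<in> I" by auto
qed

lemma wps_set_bit:
  assumes "core n p kd as us Z m" "m ''j'' 0 = j" "j < n" "aval e m = of_bool b"
    and "\<And>m'. core n (p[j := b]) kd as us Z m' \<Longrightarrow> frame {''w'', ''arg1''} m m' \<Longrightarrow> Q m'"
  shows "wps T k (set_bit e) Q m"
proof -
  let ?m = "store ''arg1'' (2 * n + j) (lit_gate n b j) (store ''w'' j (of_bool b) m)"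
  have nn: "m ''n'' 0 = n" "m ''sel'' 0 = n" "m ''sel'' (Suc 0) = 0"
    using assms(1) by (auto simp: core_def fixed_def)
  have "Q ?m"
    by (rule assms(5)) (use core_set_bit[OF assms(1,3)] in simp_all)
  moreover have "wps T k (set_bit e) Q m = Q ?m"
    using nn assms(2,4) by (cases b) (simp_all add: set_bit_def store_apply lit_gate_def mult_2)
  ultimately show ?thesis by simp
qed

lemma point_models:
  assumes "core n p (\<lambda>_. 2) as us Z m"
  shows "\<exists>f. represents_over n m (aval point_gate m) f \<and> models n f = {p}"
proof -
  have f: "fixed n p (\<lambda>_. 2) m" using assms by (simp add: core_def)
  then have "aval point_gate m = 2 * n" "length p = n" by (auto simp: fixed_def)
  moreover obtain f where "represents_over n m (2 * n) f"
    "models n f = {\<sigma> \<in> states n. \<forall>j<n. \<sigma> ! j = p ! j}"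
    using den_point[OF f den_vars[OF f]] unfolding den_models by blast
  moreover have "{\<sigma> \<in> states n. \<forall>j<n. \<sigma> ! j = p ! j} = {p}"
    using \<open>length p = n\<close> by (auto simp: states_def intro: nth_equalityI)
  ultimately show ?thesis by auto
qed

lemma wps_BmcBad_point:
  assumes "core n p (\<lambda>_. 2) as us Z m"
    and "Q (store ''ans'' 0 (if reach_le (Trans T) k {p} \<inter> Bad T = {} then 0 else 1) m)"
  shows "wps T k (BmcBad point_gate) Q m"
proof -
  obtain f where "represents_over n m (aval point_gate m) f" "models n f = {p}"
    using point_models[OF assms(1)] by blast
  then show ?thesis unfolding wps.simps using assms(2) by (intro exI[of _ f]) simp
qed

lemma wps_BmcInit_point:
  assumes "core n p (\<lambda>_. 2) as us Z m"
    and "Q (store ''ans'' 0 (if reach_le (Trans T) k (Init T) \<inter> {p} = {} then 0 else 1) m)"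
  shows "wps T k (BmcInit point_gate) Q m"
proof -
  obtain f where "represents_over n m (aval point_gate m) f" "models n f = {p}"
    using point_models[OF assms(1)] by blast
  then show ?thesis unfolding wps.simps using assms(2) by (intro exI[of _ f]) simp
qed

text \<open>With constants for variables the formula is satisfied by all states or by none.
  \<open>Init\<close> is not empty and is reached in zero steps, so the check fails to be disjoint
  exactly if the value at \<open>v\<close> is true.\<close>

lemma wps_BmcInit_prefix:
  assumes c: "core n p (\<lambda>j. of_bool (v ! j)) as us Z m" and "aval e m = m ''pg'' l" "l \<le> length as"
    and "Q (store ''ans'' 0 (of_bool (prefix_hyp n as us l v)) m)"
  shows "wps T k (BmcInit e) Q m"
proof -
  have f: "fixed n p (\<lambda>j. of_bool (v ! j)) m" "heap n as us Z m" using c by (auto simp: core_def)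
  obtain f where f: "represents_over n m (m ''pg'' l) f"
    "models n f = {\<sigma> \<in> states n. prefix_hyp n as us l v}"
    using den_prefix[OF f(1) _ f(2) assms(3), of "\<lambda>_. v"] den_consts[OF f(1)]
    unfolding den_models by blast
  obtain \<sigma> where "\<sigma> \<in> Init T" "\<sigma> \<in> states n" using sys by (auto simp: transition_system_def)
  then have "\<sigma> \<in> reach_le (Trans T) k (Init T)" unfolding reach_le_def by force
  then have "reach_le (Trans T) k (Init T) \<inter> models n f = {} \<longleftrightarrow> \<not> prefix_hyp n as us l v"
    using f(2) \<open>\<sigma> \<in> states n\<close> by auto
  then have "Q (store ''ans'' 0 (if reach_le (Trans T) k (Init T) \<inter> models n f = {} then 0 else 1) m)"
    using assms(4) by (cases "prefix_hyp n as us l v") simp_all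
  moreover have "represents_over n m (aval e m) f" using f(1) assms(2) by simp
  ultimately show ?thesis unfolding wps.simps by blast
qed

lemma n_var: "core n p kd as us Z m \<Longrightarrow> m ''n'' 0 = n"
  by (simp add: core_def fixed_def)

lemma core_length: "core n p kd as us Z m \<Longrightarrow> length p = n"
  by (simp add: core_def fixed_def)

section \<open>Loading a point and deciding membership\<close>

lemma take_drop_update:
  "length \<sigma> = length p \<Longrightarrow> j < length p \<Longrightarrow>
    (take j \<sigma> @ drop j p)[j := \<sigma> ! j] = take (Suc j) \<sigma> @ drop (Suc j) p"
  by (intro nth_equalityI) (auto simp: nth_list_update nth_append min_def less_Suc_eq)

lemma run_load:
  assumes "core n p kd as us Z m" "arr m x \<sigma>" "length \<sigma> = n" "x \<notin> {''w'', ''arg1'', ''j''}"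
  shows "run T k \<omega> (load_com x) (2 + n * 4)
    (\<lambda>m'. core n \<sigma> kd as us Z m' \<and> frame {''w'', ''arg1'', ''j''} m m') m"
  unfolding load_com_def
proof (rule run_for[where P = "\<lambda>j m'. core n (take j \<sigma> @ drop j p) kd as us Z m' \<and>
    frame {''w'', ''arg1'', ''j''} m m'" and M = n and D = 2])
  have len: "length p = n" using core_length assms(1) .
  fix j m1
  assume j: "j < n" "m1 ''j'' 0 = j" and
    P: "core n (take j \<sigma> @ drop j p) kd as us Z m1 \<and> frame {''w'', ''arg1'', ''j''} m m1"
  have "m1 x j = of_bool (\<sigma> ! j)"
    using frameD[OF conjunct2[OF P], of x] assms(2-4) j(1) by (simp add: arr_def)
  then have e: "aval (Cell x (sc ''j'')) m1 = of_bool (\<sigma> ! j)" using j by simp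
  show "run T k \<omega> (set_bit (Cell x (sc ''j''))) 2
    (\<lambda>m'. m' ''j'' 0 = j \<and> core n (take (Suc j) \<sigma> @ drop (Suc j) p) kd as us Z (store ''j'' 0 (Suc j) m') \<and>
      frame {''w'', ''arg1'', ''j''} m (store ''j'' 0 (Suc j) m')) m1"
  proof (intro run_wps wps_set_bit[OF conjunct1[OF P] j(2,1) e])
    fix m' assume m': "core n ((take j \<sigma> @ drop j p)[j := \<sigma> ! j]) kd as us Z m'" "frame {''w'', ''arg1''} m1 m'"
    have "frame {''w'', ''arg1'', ''j''} m m'" by (rule frame_trans[OF conjunct2[OF P] m'(2)]) auto
    then show "m' ''j'' 0 = j \<and>
      core n (take (Suc j) \<sigma> @ drop (Suc j) p) kd as us Z (store ''j'' 0 (Suc j) m') \<and>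
      frame {''w'', ''arg1'', ''j''} m (store ''j'' 0 (Suc j) m')"
      using m'(1) frameD[OF m'(2), of "''j''"] j len assms(3) by (simp add: core_store take_drop_update)
  qed (simp add: set_bit_def)
qed (use assms core_length[OF assms(1)] in \<open>auto simp: core_store n_var\<close>)

text \<open>The invariant concerns the hybrid of \<open>\<tau>\<close> and \<open>\<sigma>0\<close>.
  Its membership is already known in \<open>inI\<close>, and the next hybrid differs in at most one
  coordinate, which is the situation of the two fence lemmas.\<close>

lemma run_member:
  assumes c: "core n p (\<lambda>_. 2) as us Z m" and s0: "arr m ''s0'' \<sigma>0" "\<sigma>0 \<in> I"
    and v: "arr m ''v'' \<tau>" "length \<tau> = n"
  shows "run T k \<omega> member_com (5 + n * 11)
    (\<lambda>m'. core n \<tau> (\<lambda>_. 2) as us Z m' \<and> frame {''w'', ''arg1'', ''j'', ''inI'', ''ans''} m m' \<and>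
      m' ''inI'' 0 = of_bool (\<tau> \<in> I)) m"
  unfolding member_com_def
proof (rule run_Seq[OF run_load[OF c s0(1)]])
  let ?F = "frame {''w'', ''arg1'', ''j'', ''inI'', ''ans''} m"
  have len: "length \<sigma>0 = n" using I_states s0(2) .
  then show "length \<sigma>0 = n" .
  fix m0 assume m0: "core n \<sigma>0 (\<lambda>_. 2) as us Z m0 \<and> frame {''w'', ''arg1'', ''j''} m m0"
  let ?P = "\<lambda>j m'. core n (take j \<tau> @ drop j \<sigma>0) (\<lambda>_. 2) as us Z m' \<and> ?F m' \<and>
    m' ''inI'' 0 = of_bool (take j \<tau> @ drop j \<sigma>0 \<in> I)"
  show "run T k \<omega> (set_sc ''inI'' (N 1) ;;
     for_com ''j'' (sc ''n'')
       (set_bit (Cell ''v'' (sc ''j'')) ;;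
        Cond (Less (N 0) (sc ''inI''))
          (BmcBad point_gate ;; set_sc ''inI'' (Minus (N 1) (sc ''ans'')))
          (BmcInit point_gate ;; set_sc ''inI'' (sc ''ans'')))) (3 + n * 7)
    (\<lambda>m'. core n \<tau> (\<lambda>_. 2) as us Z m' \<and> ?F m' \<and> m' ''inI'' 0 = of_bool (\<tau> \<in> I)) m0"
  proof (rule run_Seq[OF run_wps[where Q = "?P 0" and D = 1]])
    show "wps T k (set_sc ''inI'' (N 1)) (?P 0) m0"
      using m0 s0 frame_trans[of _ m m0 "{}" m0] by (auto simp: core_store store_apply)
    fix m1 assume "?P 0 m1"
    then show "run T k \<omega> (for_com ''j'' (sc ''n'')
       (set_bit (Cell ''v'' (sc ''j'')) ;;
        Cond (Less (N 0) (sc ''inI''))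
          (BmcBad point_gate ;; set_sc ''inI'' (Minus (N 1) (sc ''ans'')))
          (BmcInit point_gate ;; set_sc ''inI'' (sc ''ans'')))) (2 + n * 7)
    (\<lambda>m'. core n \<tau> (\<lambda>_. 2) as us Z m' \<and> ?F m' \<and> m' ''inI'' 0 = of_bool (\<tau> \<in> I)) m1"
    proof (intro run_for[where P = ?P and M = n and D = 5])
      fix j m2 assume j: "j < n" "m2 ''j'' 0 = j" and P: "?P j m2"
      let ?w = "take j \<tau> @ drop j \<sigma>0" and ?w' = "take (Suc j) \<tau> @ drop (Suc j) \<sigma>0"
      have w': "?w' = ?w[j := \<tau> ! j]" using take_drop_update[of \<tau> \<sigma>0 j] len v(2) j by simp
      have wl: "length ?w = n" using len v(2) j by simp
      have "m2 ''v'' j = of_bool (\<tau> ! j)" using frameD[OF conjunct1[OF conjunct2[OF P]], of "''v''"] v j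
        by (simp add: arr_def)
      show "run T k \<omega> (set_bit (Cell ''v'' (sc ''j'')) ;;
        Cond (Less (N 0) (sc ''inI''))
          (BmcBad point_gate ;; set_sc ''inI'' (Minus (N 1) (sc ''ans'')))
          (BmcInit point_gate ;; set_sc ''inI'' (sc ''ans''))) 5
        (\<lambda>m'. m' ''j'' 0 = j \<and> ?P (Suc j) (store ''j'' 0 (Suc j) m')) m2"
      proof (rule run_wps)
        show "wps T k (set_bit (Cell ''v'' (sc ''j'')) ;;
          Cond (Less (N 0) (sc ''inI''))
            (BmcBad point_gate ;; set_sc ''inI'' (Minus (N 1) (sc ''ans'')))
            (BmcInit point_gate ;; set_sc ''inI'' (sc ''ans'')))
          (\<lambda>m'. m' ''j'' 0 = j \<and> ?P (Suc j) (store ''j'' 0 (Suc j) m')) m2"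
          unfolding wps.simps(3)
        proof (rule wps_set_bit[OF conjunct1[OF P] j(2,1), where b = "\<tau> ! j"])
          show "aval (Cell ''v'' (sc ''j'')) m2 = of_bool (\<tau> ! j)"
            using \<open>m2 ''v'' j = _\<close> j by simp
          fix m3 assume c3: "core n (?w[j := \<tau> ! j]) (\<lambda>_. 2) as us Z m3"
            and f3: "frame {''w'', ''arg1''} m2 m3"
          have in3: "m3 ''inI'' 0 = of_bool (?w \<in> I)" "m3 ''j'' 0 = j"
            using frameD[OF f3] P j by simp_all
          have F3: "?F m3" using frame_trans[OF conjunct1[OF conjunct2[OF P]] f3] by simp
          show "wps T k (Cond (Less (N 0) (sc ''inI''))
            (BmcBad point_gate ;; set_sc ''inI'' (Minus (N 1) (sc ''ans'')))
            (BmcInit point_gate ;; set_sc ''inI'' (sc ''ans'')))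
            (\<lambda>m'. m' ''j'' 0 = j \<and> ?P (Suc j) (store ''j'' 0 (Suc j) m')) m3"
          proof (cases "?w \<in> I")
            case True
            have "wps T k (BmcBad point_gate) (wps T k (set_sc ''inI'' (Minus (N 1) (sc ''ans'')))
              (\<lambda>m'. m' ''j'' 0 = j \<and> ?P (Suc j) (store ''j'' 0 (Suc j) m'))) m3"
              by (rule wps_BmcBad_point[OF c3])
                (use in3 F3 c3 update_in_I_iff_Bad_unreachable[OF True j(1), of "\<tau> ! j"]
                  in \<open>auto simp: w' core_store store_apply\<close>)
            then show ?thesis using True in3 by simp
          next
            case False
            have "wps T k (BmcInit point_gate) (wps T k (set_sc ''inI'' (sc ''ans''))
              (\<lambda>m'. m' ''j'' 0 = j \<and> ?P (Suc j) (store ''j'' 0 (Suc j) m'))) m3"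
              by (rule wps_BmcInit_point[OF c3])
                (use in3 F3 c3 update_in_I_iff_reachable[OF False wl j(1), of "\<tau> ! j"]
                  in \<open>auto simp: w' core_store store_apply\<close>)
            then show ?thesis using False in3 by simp
          qed
        qed
      qed (simp add: set_bit_def)
    qed (use v len in \<open>auto simp: core_store store_apply n_var\<close>)
  qed simp_all
qed simp_all

section \<open>Finding a hypothesis that rejects a positive point\<close>

lemma core_A:
  "core n p kd as us Z m \<Longrightarrow> i < length as \<Longrightarrow> j < n \<Longrightarrow> m ''A'' (m ''pg'' (Suc i) + j) = of_bool (as ! i ! j)"
  by (simp add: core_def heap_def block_def)

lemma core_w: "core n p kd as us Z m \<Longrightarrow> j < n \<Longrightarrow> m ''w'' j = of_bool (p ! j)"
  by (simp add: core_def fixed_def)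

lemma core_t: "core n p kd as us Z m \<Longrightarrow> m ''t'' 0 = length as"
  by (simp add: core_def heap_def)

lemma core_pw: "core n p kd as us Z m \<Longrightarrow> j \<le> n \<Longrightarrow> m ''pw'' j = 2 ^ j"
  by (simp add: core_def fixed_def)

lemma wps_Seq: "wps T k (c1 ;; c2) Q = wps T k c1 (wps T k c2 Q)"
  by (rule ext) simp

text \<open>Acceptance by prefixes is antitone in the length and fails at the full length. The
  invariant keeps an accepted prefix \<open>pos\<close> and a distance, halved in each round, at
  which acceptance has failed or the list has ended.\<close>

lemma run_search:
  assumes c: "core n p (\<lambda>j. of_bool (\<tau> ! j)) as us Z m" and pos: "m ''pos'' 0 = 0"
    and fail: "\<not> prefix_hyp n as us (length as) \<tau>" and t: "length as \<le> 2 ^ n"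
  shows "run T k \<omega>
    (for_com ''j'' (Plus (sc ''n'') (N 1))
       (set_sc ''cand'' (Plus (sc ''pos'') (Cell ''pw'' (Minus (sc ''n'') (sc ''j'')))) ;;
        Cond (Less (sc ''t'') (sc ''cand'')) Skip
          (BmcInit (Cell ''pg'' (sc ''cand'')) ;;
           Cond (Less (N 0) (sc ''ans'')) (set_sc ''pos'' (sc ''cand'')) Skip))) (9 + n * 7)
    (\<lambda>m'. core n p (\<lambda>j. of_bool (\<tau> ! j)) as us Z m' \<and> frame {''j'', ''pos'', ''cand'', ''ans''} m m' \<and>
      m' ''pos'' 0 < length as \<and> \<not> hyp n (as ! (m' ''pos'' 0)) (us ! (m' ''pos'' 0)) \<tau>) m"
    (is "run T k \<omega> _ _ (\<lambda>m'. ?C m' \<and> ?F m' \<and> ?R m') m")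
proof -
  let ?H = "\<lambda>l. prefix_hyp n as us l \<tau>"
  let ?P = "\<lambda>j m'. ?C m' \<and> ?F m' \<and> m' ''pos'' 0 \<le> length as \<and> ?H (m' ''pos'' 0) \<and>
    (length as < m' ''pos'' 0 + 2 ^ (Suc n - j) \<or> \<not> ?H (m' ''pos'' 0 + 2 ^ (Suc n - j)))"
  show ?thesis
  proof (rule run_for[where P = ?P and M = "Suc n" and D = 5])
    \<comment> \<open>The initial distance is \<open>2 ^ (n + 1)\<close>, beyond the end of the
      list, so the second half of the invariant holds before any probe.\<close>
    have "length as < 2 * 2 ^ n" using t by (metis le_less_trans less_mult_imp_div_less
        mult.commute mult_2 nat_less_le zero_less_numeral zero_less_power less_add_same_cancel1)
    then show "?P 0 (store ''j'' 0 0 m)"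
      using c pos by (simp add: core_store store_apply prefix_hyp_0)
  next
    fix j m1 assume j: "j < Suc n" "m1 ''j'' 0 = j" and P: "?P j m1"
    let ?pos = "m1 ''pos'' 0" let ?c = "?pos + 2 ^ (n - j)"
    have c1: "?C m1" using P by simp
    let ?m = "store ''cand'' 0 ?c m1"
    have cm: "?C ?m" using c1 by (simp add: core_store)
    have dbl: "(2::nat) ^ (Suc n - j) = 2 ^ (n - j) + 2 ^ (n - j)"
      using j(1) by (simp add: Suc_diff_le mult_2)
    have cand: "aval (Plus (sc ''pos'') (Cell ''pw'' (Minus (sc ''n'') (sc ''j'')))) m1 = ?c"
      using j n_var[OF c1] core_pw[OF c1, of "n - j"] by simp
    show "run T k \<omega> (set_sc ''cand'' (Plus (sc ''pos'') (Cell ''pw'' (Minus (sc ''n'') (sc ''j'')))) ;;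
        Cond (Less (sc ''t'') (sc ''cand'')) Skip
          (BmcInit (Cell ''pg'' (sc ''cand'')) ;;
           Cond (Less (N 0) (sc ''ans'')) (set_sc ''pos'' (sc ''cand'')) Skip)) 5
        (\<lambda>m'. m' ''j'' 0 = j \<and> ?P (Suc j) (store ''j'' 0 (Suc j) m')) m1"
    proof (rule run_wps)
      let ?Q = "\<lambda>m'. m' ''j'' 0 = j \<and> ?P (Suc j) (store ''j'' 0 (Suc j) m')"
      have "wps T k (Cond (Less (sc ''t'') (sc ''cand'')) Skip
          (BmcInit (Cell ''pg'' (sc ''cand'')) ;;
           Cond (Less (N 0) (sc ''ans'')) (set_sc ''pos'' (sc ''cand'')) Skip)) ?Q ?m"
      proof (cases "length as < ?c")
        case True
        then have "?Q ?m" using P j by (simp add: core_store store_apply)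
        then show ?thesis using True core_t[OF cm] by (simp add: store_apply)
      next
        case False
        have "wps T k (BmcInit (Cell ''pg'' (sc ''cand'')))
          (wps T k (Cond (Less (N 0) (sc ''ans'')) (set_sc ''pos'' (sc ''cand'')) Skip) ?Q) ?m"
        proof (rule wps_BmcInit_prefix[OF cm])
          show "aval (Cell ''pg'' (sc ''cand'')) ?m = ?m ''pg'' ?c" by (simp add: store_apply)
          show "?c \<le> length as" using False by simp
          show "wps T k (Cond (Less (N 0) (sc ''ans'')) (set_sc ''pos'' (sc ''cand'')) Skip) ?Q
            (store ''ans'' 0 (of_bool (?H ?c)) ?m)"
            using P j False dbl by (cases "?H ?c") (auto simp: core_store store_apply add.assoc)
        qed
        then show ?thesis using False core_t[OF cm] by (simp add: store_apply)
      qed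
      then show "wps T k (set_sc ''cand'' (Plus (sc ''pos'') (Cell ''pw'' (Minus (sc ''n'') (sc ''j'')))) ;;
        Cond (Less (sc ''t'') (sc ''cand'')) Skip
          (BmcInit (Cell ''pg'' (sc ''cand'')) ;;
           Cond (Less (N 0) (sc ''ans'')) (set_sc ''pos'' (sc ''cand'')) Skip)) ?Q m1"
        using cand by (simp only: wps.simps aval.simps)
    qed simp
  next
    fix m' assume P: "?P (Suc n) m'"
    \<comment> \<open>The distance is now 1. Since the full prefix is rejected, \<open>pos\<close>
      is a proper index, accepted up to \<open>pos\<close> but not one further: hypothesis
      \<open>pos\<close> is the culprit.\<close>
    have "m' ''pos'' 0 \<noteq> length as" using P fail by metis
    then have "m' ''pos'' 0 < length as" "\<not> ?H (Suc (m' ''pos'' 0))" using P by auto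
    then show "?C m' \<and> ?F m' \<and> ?R m'" using P by (simp add: prefix_hyp_Suc)
  qed (use n_var in auto)
qed

lemma run_set_kinds:
  assumes c: "core n p kd as us Z m"
    and e: "\<And>m' j. frame {''op'', ''j''} m m' \<Longrightarrow> m' ''j'' 0 = j \<Longrightarrow> j < n \<Longrightarrow> aval e m' = kd' j"
  shows "run T k \<omega> (for_com ''j'' (sc ''n'') (Assign ''op'' (sc ''j'') e)) (2 + n * 3)
    (\<lambda>m'. core n p kd' as us Z m' \<and> frame {''op'', ''j''} m m') m"
proof (rule run_for[where M = n and D = 1 and
    P = "\<lambda>j m'. core n p (\<lambda>i. if i < j then kd' i else kd i) as us Z m' \<and> frame {''op'', ''j''} m m'"])
  fix j m1 assume j: "j < n" "m1 ''j'' 0 = j" and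
    P: "core n p (\<lambda>i. if i < j then kd' i else kd i) as us Z m1 \<and> frame {''op'', ''j''} m m1"
  have "core n p (\<lambda>i. if i < Suc j then kd' i else kd i) as us Z (store ''op'' j (kd' j) m1)"
    by (rule core_kind_cong[OF core_set_kind[OF conjunct1[OF P] j(1)]]) auto
  then show "run T k \<omega> (Assign ''op'' (sc ''j'') e) 1
    (\<lambda>m'. m' ''j'' 0 = j \<and> core n p (\<lambda>i. if i < Suc j then kd' i else kd i) as us Z (store ''j'' 0 (Suc j) m') \<and>
      frame {''op'', ''j''} m (store ''j'' 0 (Suc j) m')) m1"
    using P j e[of m1 j] by (intro run_wps) (simp_all add: core_store store_apply)
next
  fix m' assume "core n p (\<lambda>i. if i < n then kd' i else kd i) as us Z m' \<and> frame {''op'', ''j''} m m'"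
  then show "core n p kd' as us Z m' \<and> frame {''op'', ''j''} m m'"
    using core_kind_cong[of n p "\<lambda>i. if i < n then kd' i else kd i" as us Z m' kd'] by simp
qed (use c in \<open>auto simp: core_store n_var\<close>)

lemma run_find:
  assumes c: "core n p (\<lambda>_. 2) as us Z m" and v: "arr m ''v'' \<tau>" "length \<tau> = n"
    and fail: "\<not> prefix_hyp n as us (length as) \<tau>" and t: "length as \<le> 2 ^ n"
  shows "run T k \<omega> find_com (14 + n * 13)
    (\<lambda>m'. core n p (\<lambda>_. 2) as us Z m' \<and> frame {''op'', ''j'', ''pos'', ''cand'', ''ans''} m m' \<and>
      m' ''pos'' 0 < length as \<and> \<not> hyp n (as ! (m' ''pos'' 0)) (us ! (m' ''pos'' 0)) \<tau>) m"
  unfolding find_com_def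
proof (rule run_Seq)
  show "run T k \<omega> (for_com ''j'' (sc ''n'') (Assign ''op'' (sc ''j'') (Cell ''v'' (sc ''j'')))) (2 + n * 3)
    (\<lambda>m'. core n p (\<lambda>j. of_bool (\<tau> ! j)) as us Z m' \<and> frame {''op'', ''j''} m m') m"
  proof (rule run_set_kinds[OF c])
    fix m' j assume "frame {''op'', ''j''} m m'" "m' ''j'' 0 = j" "j < n"
    then show "aval (Cell ''v'' (sc ''j'')) m' = of_bool (\<tau> ! j)"
      using v frameD[of _ m m' "''v''"] by (simp add: arr_def)
  qed
next
  fix m1 assume m1: "core n p (\<lambda>j. of_bool (\<tau> ! j)) as us Z m1 \<and> frame {''op'', ''j''} m m1"
  show "run T k \<omega> (set_sc ''pos'' (N 0) ;;
     for_com ''j'' (Plus (sc ''n'') (N 1))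
       (set_sc ''cand'' (Plus (sc ''pos'') (Cell ''pw'' (Minus (sc ''n'') (sc ''j'')))) ;;
        Cond (Less (sc ''t'') (sc ''cand'')) Skip
          (BmcInit (Cell ''pg'' (sc ''cand'')) ;;
           Cond (Less (N 0) (sc ''ans'')) (set_sc ''pos'' (sc ''cand'')) Skip)) ;;
     for_com ''j'' (sc ''n'') (Assign ''op'' (sc ''j'') (N 2))) (12 + n * 10)
    (\<lambda>m'. core n p (\<lambda>_. 2) as us Z m' \<and> frame {''op'', ''j'', ''pos'', ''cand'', ''ans''} m m' \<and>
      m' ''pos'' 0 < length as \<and> \<not> hyp n (as ! (m' ''pos'' 0)) (us ! (m' ''pos'' 0)) \<tau>) m1"
  proof (rule run_Seq[OF run_wps[where D = 1 and Q = "(=) (store ''pos'' 0 0 m1)"]])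
    fix m2 assume m2: "store ''pos'' 0 0 m1 = m2"
    have c2: "core n p (\<lambda>j. of_bool (\<tau> ! j)) as us Z m2" "m2 ''pos'' 0 = 0"
      "frame {''op'', ''j'', ''pos''} m m2"
      using m1 frame_trans[of "{''op'', ''j''}" m m1 "{}" m1 "{''op'', ''j'', ''pos''}"]
      unfolding m2[symmetric] by (auto simp: core_store store_apply)
    show "run T k \<omega> (for_com ''j'' (Plus (sc ''n'') (N 1))
       (set_sc ''cand'' (Plus (sc ''pos'') (Cell ''pw'' (Minus (sc ''n'') (sc ''j'')))) ;;
        Cond (Less (sc ''t'') (sc ''cand'')) Skip
          (BmcInit (Cell ''pg'' (sc ''cand'')) ;;
           Cond (Less (N 0) (sc ''ans'')) (set_sc ''pos'' (sc ''cand'')) Skip)) ;;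
      for_com ''j'' (sc ''n'') (Assign ''op'' (sc ''j'') (N 2))) (11 + n * 10)
      (\<lambda>m'. core n p (\<lambda>_. 2) as us Z m' \<and> frame {''op'', ''j'', ''pos'', ''cand'', ''ans''} m m' \<and>
        m' ''pos'' 0 < length as \<and> \<not> hyp n (as ! (m' ''pos'' 0)) (us ! (m' ''pos'' 0)) \<tau>) m2"
    proof (rule run_Seq[OF run_search[OF c2(1,2) fail t]])
      fix m3 assume m3: "core n p (\<lambda>j. of_bool (\<tau> ! j)) as us Z m3 \<and>
        frame {''j'', ''pos'', ''cand'', ''ans''} m2 m3 \<and> m3 ''pos'' 0 < length as \<and>
        \<not> hyp n (as ! (m3 ''pos'' 0)) (us ! (m3 ''pos'' 0)) \<tau>"
      have F: "frame {''op'', ''j'', ''pos'', ''cand'', ''ans''} m m3"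
        by (rule frame_trans[OF c2(3) conjunct1[OF conjunct2[OF m3]]]) auto
      show "run T k \<omega> (for_com ''j'' (sc ''n'') (Assign ''op'' (sc ''j'') (N 2))) (2 + n * 3)
        (\<lambda>m'. core n p (\<lambda>_. 2) as us Z m' \<and> frame {''op'', ''j'', ''pos'', ''cand'', ''ans''} m m' \<and>
          m' ''pos'' 0 < length as \<and> \<not> hyp n (as ! (m' ''pos'' 0)) (us ! (m' ''pos'' 0)) \<tau>) m3"
      proof (rule run_mono[OF run_set_kinds[OF conjunct1[OF m3], where kd' = "\<lambda>_. 2"]])
        fix m' assume m': "core n p (\<lambda>_. 2) as us Z m' \<and> frame {''op'', ''j''} m3 m'"
        have "frame {''op'', ''j'', ''pos'', ''cand'', ''ans''} m m'"
          by (rule frame_trans[OF F conjunct2[OF m']]) auto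
        then show "core n p (\<lambda>_. 2) as us Z m' \<and> frame {''op'', ''j'', ''pos'', ''cand'', ''ans''} m m' \<and>
          m' ''pos'' 0 < length as \<and> \<not> hyp n (as ! (m' ''pos'' 0)) (us ! (m' ''pos'' 0)) \<tau>"
          using m' m3 frameD[OF conjunct2[OF m'], of "''pos''"] by simp
      qed simp_all
    qed simp
  qed simp_all
qed simp

text \<open>The walk never stays outside \<open>I\<close>, so the backwards fence alone answers all
  of its checks. A flip is made tentatively, tested, and undone from \<open>old\<close> on failure,
  which is the else case of \<open>flip_step\<close>.\<close>

lemma run_pass:
  assumes c: "core n w (\<lambda>_. 2) as us Z m" and w: "w \<in> I"
    and i: "i < length as" and g: "m ''g'' 0 = m ''pg'' (Suc i)"
  shows "run T k \<omega> (for_com ''j'' (sc ''n'')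
         (set_sc ''old'' (Cell ''w'' (sc ''j'')) ;;
          set_bit (Cell ''A'' (Plus (sc ''g'') (sc ''j''))) ;;
          BmcBad point_gate ;;
          Cond (Less (N 0) (sc ''ans'')) (set_bit (sc ''old'')) Skip)) (2 + n * 9)
    (\<lambda>m'. core n (partial_pass I (as ! i) w n) (\<lambda>_. 2) as us Z m' \<and>
      frame {''w'', ''arg1'', ''j'', ''old'', ''ans''} m m') m"
proof -
  let ?F = "frame {''w'', ''arg1'', ''j'', ''old'', ''ans''} m"
  let ?w = "\<lambda>j. partial_pass I (as ! i) w j"
  let ?P = "\<lambda>j m'. core n (?w j) (\<lambda>_. 2) as us Z m' \<and> ?F m'"
  let ?test = "Cond (Less (N 0) (sc ''ans'')) (set_bit (sc ''old'')) Skip"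
  let ?flip = "set_bit (Cell ''A'' (Plus (sc ''g'') (sc ''j'')))"
  show ?thesis
  proof (rule run_for[where P = ?P and M = n and D = 7])
    fix j m1 assume j: "j < n" "m1 ''j'' 0 = j" and P: "?P j m1"
    let ?Q = "\<lambda>m'. m' ''j'' 0 = j \<and> ?P (Suc j) (store ''j'' 0 (Suc j) m')"
    let ?m = "store ''old'' 0 (m1 ''w'' j) m1"
    let ?a = "as ! i ! j"
    have c1: "core n (?w j) (\<lambda>_. 2) as us Z m1" and F1: "?F m1" using P by auto
    have len: "length (?w j) = n" using core_length[OF c1] .
    have cm: "core n (?w j) (\<lambda>_. 2) as us Z ?m" "?m ''j'' 0 = j"
      using c1 j by (simp_all add: core_store store_apply)
    have "m1 ''g'' 0 = m1 ''pg'' (Suc i)" using g frameD[OF F1] by simp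
    then have e: "aval (Cell ''A'' (Plus (sc ''g'') (sc ''j''))) ?m = of_bool ?a"
      using core_A[OF c1 i j(1)] j by (simp add: store_apply)
    have "wps T k ?flip (wps T k (BmcBad point_gate) (wps T k ?test ?Q)) ?m"
    proof (rule wps_set_bit[OF cm j(1) e])
      fix m2 assume c2: "core n ((?w j)[j := ?a]) (\<lambda>_. 2) as us Z m2"
        and f2: "frame {''w'', ''arg1''} ?m m2"
      have j2: "m2 ''j'' 0 = j" "m2 ''old'' 0 = of_bool (?w j ! j)"
        using frameD[OF f2] j core_w[OF c1 j(1)] by (simp_all add: store_apply)
      have F2: "?F m2" by (rule frame_trans[OF _ f2, of "{''w'', ''arg1'', ''j'', ''old'', ''ans''}" m])
        (use F1 in auto)
      have inI: "(?w j)[j := ?a] \<in> I \<longleftrightarrow> reach_le (Trans T) k {(?w j)[j := ?a]} \<inter> Bad T = {}"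
        by (rule update_in_I_iff_Bad_unreachable[OF partial_pass_in[OF w] j(1)])
      show "wps T k (BmcBad point_gate) (wps T k ?test ?Q) m2"
      proof (rule wps_BmcBad_point[OF c2], unfold inI[symmetric])
        show "wps T k ?test ?Q (store ''ans'' 0 (if (?w j)[j := ?a] \<in> I then 0 else 1) m2)"
        proof (cases "(?w j)[j := ?a] \<in> I")
          case True
          then have "?w (Suc j) = (?w j)[j := ?a]" by (simp add: flip_step_def)
          then show ?thesis using True c2 F2 j2 by (simp add: core_store store_apply)
        next
          case False
          let ?m3 = "store ''ans'' 0 1 m2"
          \<comment> \<open>The rejected point is written as two successive updates, tentative and
            undone, because this is the form in which \<open>wps_set_bit\<close> delivers
            it.\<close>
          have eq: "?w (Suc j) = (?w j)[j := ?a, j := ?w j ! j]"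
            using False by (simp add: flip_step_def)
          have "wps T k (set_bit (sc ''old'')) ?Q ?m3"
          proof (rule wps_set_bit)
            show "core n ((?w j)[j := ?a]) (\<lambda>_. 2) as us Z ?m3" using c2 by (simp add: core_store)
            show "?m3 ''j'' 0 = j" "aval (sc ''old'') ?m3 = of_bool (?w j ! j)"
              using j2 by (simp_all add: store_apply)
            fix m4 assume c4: "core n ((?w j)[j := ?a, j := ?w j ! j]) (\<lambda>_. 2) as us Z m4"
              and f4: "frame {''w'', ''arg1''} ?m3 m4"
            have "m4 ''j'' 0 = j" using frameD[OF f4] j2 by (simp add: store_apply)
            moreover have "?F m4"
              by (rule frame_trans[OF _ f4, of "{''w'', ''arg1'', ''j'', ''old'', ''ans''}" m]) (use F2 in auto)
            ultimately show "?Q m4" using c4 eq by (simp add: core_store del: partial_pass.simps)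
          qed (rule j(1))
          then show ?thesis using False by (simp add: store_apply)
        qed
      qed
    qed
    then have "wps T k (set_sc ''old'' (Cell ''w'' (sc ''j'')) ;; ?flip ;; BmcBad point_gate ;; ?test) ?Q m1"
      using j by (simp only: wps.simps(2) wps_Seq aval.simps)
    then show "run T k \<omega> (set_sc ''old'' (Cell ''w'' (sc ''j'')) ;; ?flip ;; BmcBad point_gate ;;
      ?test) 7 ?Q m1"
      by (rule run_wps) (simp add: set_bit_def)
  qed (use c in \<open>auto simp: core_store n_var\<close>)
qed

text \<open>The quadratic term, \<open>n\<close> passes of \<open>n\<close> tests, dominates the
  cost of a whole round.\<close>

lemma run_walk:
  assumes c: "core n p (\<lambda>_. 2) as us Z m" and v: "arr m ''v'' \<tau>" "\<tau> \<in> I"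
    and i: "i < length as" and pos: "m ''pos'' 0 = i"
  shows "run T k \<omega> walk_com (5 + n * 8 + n * n * 9)
    (\<lambda>m'. core n (passes n I (as ! i) \<tau> n) (\<lambda>_. 2) as us Z m' \<and>
      frame {''w'', ''arg1'', ''j'', ''g'', ''r'', ''old'', ''ans''} m m' \<and> m' ''g'' 0 = m' ''pg'' (Suc i)) m"
  unfolding walk_com_def
proof (rule run_Seq[OF run_load[OF c v(1) I_states[OF v(2)]]])
  let ?F = "frame {''w'', ''arg1'', ''j'', ''g'', ''r'', ''old'', ''ans''} m"
  let ?P = "\<lambda>r m'. core n (passes n I (as ! i) \<tau> r) (\<lambda>_. 2) as us Z m' \<and> ?F m' \<and> m' ''g'' 0 = m' ''pg'' (Suc i)"
  let ?pass = "for_com ''j'' (sc ''n'')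
         (set_sc ''old'' (Cell ''w'' (sc ''j'')) ;;
          set_bit (Cell ''A'' (Plus (sc ''g'') (sc ''j''))) ;;
          BmcBad point_gate ;;
          Cond (Less (N 0) (sc ''ans'')) (set_bit (sc ''old'')) Skip)"
  fix m1 assume m1: "core n \<tau> (\<lambda>_. 2) as us Z m1 \<and> frame {''w'', ''arg1'', ''j''} m m1"
  show "run T k \<omega> (set_sc ''g'' (Cell ''pg'' (Plus (sc ''pos'') (N 1))) ;; for_com ''r'' (sc ''n'') ?pass)
    (3 + n * (4 + n * 9)) (?P n) m1"
  proof (rule run_Seq[OF run_wps[where D = 1 and Q = "?P 0"]])
    have "?F m1" by (rule frame_trans[OF conjunct2[OF m1] frame_refl[of "{}"]]) auto
    then show "wps T k (set_sc ''g'' (Cell ''pg'' (Plus (sc ''pos'') (N 1)))) (?P 0) m1"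
      using m1 frameD[OF conjunct2[OF m1], of "''pos''"] pos by (simp add: core_store store_apply)
    fix m2 assume m2: "?P 0 m2"
    show "run T k \<omega> (for_com ''r'' (sc ''n'') ?pass) (2 + n * (4 + n * 9)) (?P n) m2"
    proof (rule run_for[where P = ?P and M = n and D = "2 + n * 9"])
      fix r m3 assume P: "?P r m3" and r: "m3 ''r'' 0 = r"
      show "run T k \<omega> ?pass (2 + n * 9) (\<lambda>m'. m' ''r'' 0 = r \<and> ?P (Suc r) (store ''r'' 0 (Suc r) m')) m3"
      proof (rule run_mono[OF run_pass[OF conjunct1[OF P] passes_in[OF v(2)] i]])
        show "m3 ''g'' 0 = m3 ''pg'' (Suc i)" using P by simp
        fix m4 assume m4: "core n (partial_pass I (as ! i) (passes n I (as ! i) \<tau> r) n) (\<lambda>_. 2) as us Z m4 \<and>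
          frame {''w'', ''arg1'', ''j'', ''old'', ''ans''} m3 m4"
        have "?F m4" by (rule frame_trans[OF conjunct1[OF conjunct2[OF P]] conjunct2[OF m4]]) auto
        then show "m4 ''r'' 0 = r \<and> ?P (Suc r) (store ''r'' 0 (Suc r) m4)"
          using m4 frameD[OF conjunct2[OF m4]] P r by (simp add: core_store store_apply)
      qed simp
    qed (use m2 in \<open>auto simp: core_store store_apply n_var algebra_simps\<close>)
  qed simp_all
qed (simp_all add: algebra_simps)

section \<open>Extending the candidate and setting up the memory\<close>

lemma run_add_term:
  assumes c: "core n u (\<lambda>_. 2) as us Z m" and i: "i < length as" and g: "m ''g'' 0 = m ''pg'' (Suc i)"
  shows "run T k \<omega> add_term_com (8 + n * 8)
    (\<lambda>m'. \<exists>Z'. core n u (\<lambda>_. 2) as (us[i := u # us ! i]) Z' m' \<and>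
      frame {''op'', ''arg1'', ''arg2'', ''j'', ''free''} m m') m"
  unfolding add_term_com_def
proof (rule run_Seq)
  let ?f = "m ''free'' 0" and ?g = "m ''pg'' (Suc i)" and ?a = "as ! i"
  let ?arg = "\<lambda>j. if u ! j = ?a ! j then 3 * n else lit_gate n (u ! j) j"
  let ?F = "frame {''op'', ''arg1'', ''arg2'', ''j''} m"
  let ?P = "\<lambda>l m'. core n u (\<lambda>_. 2) as us Z m' \<and> ?F m' \<and>
    (\<forall>j<l. m' ''op'' (?f + j) = 4 \<and> m' ''arg1'' (?f + j) = ?arg j \<and> m' ''arg2'' (?f + j) = Suc (?f + j))"
  let ?lit = "Assign ''arg1'' (Plus (sc ''free'') (sc ''j'')) (Plus (sc ''j'') (Cell ''sel'' (Cell ''w''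
    (sc ''j''))))"
  let ?body = "Assign ''op'' (Plus (sc ''free'') (sc ''j'')) (N 4) ;;
        Assign ''arg2'' (Plus (sc ''free'') (sc ''j'')) (Plus (Plus (sc ''free'') (sc ''j'')) (N 1)) ;;
        Assign ''arg1'' (Plus (sc ''free'') (sc ''j'')) (Plus (sc ''n'') point_gate) ;;
        Cond (Less (Cell ''w'' (sc ''j'')) (Cell ''A'' (Plus (sc ''g'') (sc ''j'')))) ?lit
          (Cond (Less (Cell ''A'' (Plus (sc ''g'') (sc ''j''))) (Cell ''w'' (sc ''j''))) ?lit Skip)"
  show "run T k \<omega> (for_com ''j'' (sc ''n'') ?body) (2 + n * 8) (?P n) m"
  proof (rule run_for[where P = ?P and M = n and D = 6])
    fix j m1 assume j: "j < n" "m1 ''j'' 0 = j" and P: "?P j m1"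
    let ?Q = "\<lambda>m'. m' ''j'' 0 = j \<and> ?P (Suc j) (store ''j'' 0 (Suc j) m')"
    let ?m = "store ''arg1'' (?f + j) (?arg j) (store ''arg2'' (?f + j) (Suc (?f + j)) (store ''op''
      (?f + j) 4 m1))"
    let ?m' = "store ''arg1'' (?f + j) (?arg j) (store ''arg1'' (?f + j) (3 * n)
      (store ''arg2'' (?f + j) (Suc (?f + j)) (store ''op'' (?f + j) 4 m1)))"
    have c1: "core n u (\<lambda>_. 2) as us Z m1" and F1: "?F m1" using P by auto
    have val: "m1 ''free'' 0 = ?f" "m1 ''g'' 0 = ?g" "m1 ''n'' 0 = n" "m1 ''w'' j = of_bool (u ! j)"
      "m1 ''A'' (?g + j) = of_bool (?a ! j)" "m1 ''sel'' 0 = n" "m1 ''sel'' (Suc 0) = 0"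
      using frameD[OF F1] g n_var[OF c1] core_w[OF c1 j(1)] core_A[OF c1 i j(1)] c1
      by (simp_all add: core_def fixed_def)
    have "?m' = ?m" by (auto simp: store_def fun_eq_iff)
    moreover have "?Q ?m"
    proof -
      have "core n u (\<lambda>_. 2) as us Z ?m"
        by (intro core_store_free) (use c1 val in \<open>simp_all add: store_apply\<close>)
      then show ?thesis using F1 P j by (simp add: core_store) (auto simp: store_apply less_Suc_eq)
    qed
    ultimately have "?Q ?m'" by simp
    have eq3: "n + (n + n) = 3 * n" by simp
    have id: "store ''arg1'' (?f + j) (3 * n) (store ''arg1'' (?f + j) (3 * n) m') =
      store ''arg1'' (?f + j) (3 * n) m'" for m' by (simp add: store_def)
    have "wps T k ?body ?Q m1 \<longleftrightarrow> ?Q ?m'"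
      using val j id
      by (cases "u ! j"; cases "?a ! j") (simp_all add: store_apply lit_gate_def eq3 del: store_other)
    then have "wps T k ?body ?Q m1" using \<open>?Q ?m'\<close> by blast
    then show "run T k \<omega> ?body 6 ?Q m1" by (rule run_wps) simp
  qed (use c in \<open>auto simp: core_store n_var\<close>)
next
  let ?f = "m ''free'' 0" and ?g = "m ''pg'' (Suc i)" and ?a = "as ! i"
  let ?arg = "\<lambda>j. if u ! j = ?a ! j then 3 * n else lit_gate n (u ! j) j"
  let ?F = "frame {''op'', ''arg1'', ''arg2'', ''j''} m"
  fix m1 assume P: "core n u (\<lambda>_. 2) as us Z m1 \<and> ?F m1 \<and>
    (\<forall>j<n. m1 ''op'' (?f + j) = 4 \<and> m1 ''arg1'' (?f + j) = ?arg j \<and> m1 ''arg2'' (?f + j) = Suc (?f + j))"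
  let ?m2 = "store ''arg1'' (Suc (?f + n)) ?f (store ''op'' (Suc (?f + n)) 5 (store ''op'' (?f + n) 1 m1))"
  let ?m3 = "store ''arg2'' (Suc (?f + n)) (m1 ''arg2'' ?g) ?m2"
  let ?m4 = "store ''free'' 0 (?f + n + 2) (store ''arg2'' ?g (Suc (?f + n)) ?m3)"
  let ?Q = "\<lambda>m'. \<exists>Z'. core n u (\<lambda>_. 2) as (us[i := u # us ! i]) Z' m' \<and>
      frame {''op'', ''arg1'', ''arg2'', ''j'', ''free''} m m'"
  have c1: "core n u (\<lambda>_. 2) as us Z m1" and F1: "?F m1" using P by auto
  have val: "m1 ''free'' 0 = ?f" "m1 ''g'' 0 = ?g" "m1 ''n'' 0 = n" "m1 ''pg'' (Suc i) = ?g"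
    using frameD[OF F1] g n_var[OF c1] by simp_all
  have "?g + n < ?f" using c i by (simp add: core_def heap_def block_def)
  then have glt: "?g < ?f" by linarith
  have "core n u (\<lambda>_. 2) as (us[i := u # us ! i]) (Z \<union> {?f..Suc (?f + n)}) ?m4"
  proof (rule core_add_term[OF _ i])
    show "core n u (\<lambda>_. 2) as us Z ?m3"
      by (intro core_store_free) (use c1 val in \<open>simp_all add: store_apply\<close>)
    show "?m3 ''pg'' (Suc i) = ?g" "?m3 ''free'' 0 = ?f" "?m3 ''op'' (Suc (?f + n)) = 5"
      "?m3 ''arg1'' (Suc (?f + n)) = ?f" "?m3 ''arg2'' (Suc (?f + n)) = ?m3 ''arg2'' ?g"
      using val glt by (simp_all add: store_apply)
    show "term_gates ?m3 n {?f..?f + n} ?a u ?f"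
      using P by (auto simp: term_gates_def store_apply)
  qed
  moreover have "frame {''op'', ''arg1'', ''arg2'', ''j'', ''free''} m m1"
    by (rule frame_trans[OF F1 frame_refl[of "{}"]]) auto
  ultimately have Q: "?Q ?m4" by auto
  show "run T k \<omega> (Assign ''op'' (Plus (sc ''free'') (sc ''n'')) (N 1) ;;
     Assign ''op'' (Plus (Plus (sc ''free'') (sc ''n'')) (N 1)) (N 5) ;;
     Assign ''arg1'' (Plus (Plus (sc ''free'') (sc ''n'')) (N 1)) (sc ''free'') ;;
     Assign ''arg2'' (Plus (Plus (sc ''free'') (sc ''n'')) (N 1)) (Cell ''arg2'' (sc ''g'')) ;;
     Assign ''arg2'' (sc ''g'') (Plus (Plus (sc ''free'') (sc ''n'')) (N 1)) ;;
     set_sc ''free'' (Plus (Plus (sc ''free'') (sc ''n'')) (N 2))) 6 ?Q m1"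
  proof (rule run_wps)
    show "wps T k (Assign ''op'' (Plus (sc ''free'') (sc ''n'')) (N 1) ;;
     Assign ''op'' (Plus (Plus (sc ''free'') (sc ''n'')) (N 1)) (N 5) ;;
     Assign ''arg1'' (Plus (Plus (sc ''free'') (sc ''n'')) (N 1)) (sc ''free'') ;;
     Assign ''arg2'' (Plus (Plus (sc ''free'') (sc ''n'')) (N 1)) (Cell ''arg2'' (sc ''g'')) ;;
     Assign ''arg2'' (sc ''g'') (Plus (Plus (sc ''free'') (sc ''n'')) (N 1)) ;;
     set_sc ''free'' (Plus (Plus (sc ''free'') (sc ''n'')) (N 2))) ?Q m1"
      using Q val by (simp add: store_apply)
  qed simp
qed simp

lemma run_add_block:
  assumes c: "core n p (\<lambda>_. 2) as us Z m" and a: "arr m ''cex1'' a" "length a = n"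
  shows "run T k \<omega> add_block_com (8 + n * 3)
    (\<lambda>m'. core n p (\<lambda>_. 2) (as @ [a]) (us @ [[]]) Z m' \<and>
      frame {''A'', ''op'', ''arg1'', ''arg2'', ''t'', ''pg'', ''j'', ''free''} m m') m"
  unfolding add_block_com_def
proof (rule run_Seq)
  let ?f = "m ''free'' 0"
  let ?P = "\<lambda>l m'. core n p (\<lambda>_. 2) as us Z m' \<and> frame {''A'', ''j''} m m' \<and>
    (\<forall>j<l. m' ''A'' (?f + j) = of_bool (a ! j))"
  show "run T k \<omega> (for_com ''j'' (sc ''n'')
    (Assign ''A'' (Plus (sc ''free'') (sc ''j'')) (Cell ''cex1'' (sc ''j'')))) (2 + n * 3) (?P n) m"
  proof (rule run_for[where P = ?P and M = n and D = 1])
    fix j m1 assume j: "j < n" "m1 ''j'' 0 = j" and P: "?P j m1"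
    have c1: "core n p (\<lambda>_. 2) as us Z m1" and F1: "frame {''A'', ''j''} m m1" using P by auto
    have val: "m1 ''free'' 0 = ?f" "m1 ''cex1'' j = of_bool (a ! j)"
      using frameD[OF F1] a j by (simp_all add: arr_def)
    have "core n p (\<lambda>_. 2) as us Z (store ''A'' (?f + j) (of_bool (a ! j)) m1)"
      by (intro core_store_free) (use c1 val in simp_all)
    then show "run T k \<omega> (Assign ''A'' (Plus (sc ''free'') (sc ''j'')) (Cell ''cex1'' (sc ''j''))) 1
      (\<lambda>m'. m' ''j'' 0 = j \<and> ?P (Suc j) (store ''j'' 0 (Suc j) m')) m1"
      using val j P by (intro run_wps) (simp_all add: core_store, auto simp: store_apply less_Suc_eq)
  qed (use c in \<open>auto simp: core_store n_var\<close>)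
next
  let ?f = "m ''free'' 0" and ?t = "length as"
  fix m1 assume P: "core n p (\<lambda>_. 2) as us Z m1 \<and> frame {''A'', ''j''} m m1 \<and>
    (\<forall>j<n. m1 ''A'' (?f + j) = of_bool (a ! j))"
  let ?m2 = "store ''arg2'' ?f (3 * n + 1) (store ''arg1'' ?f (m1 ''pg'' ?t) (store ''op'' ?f 4 m1))"
  let ?m3 = "store ''free'' 0 (?f + n + 1) (store ''pg'' (Suc ?t) ?f (store ''t'' 0 (Suc ?t) ?m2))"
  let ?X = "{''A'', ''op'', ''arg1'', ''arg2'', ''t'', ''pg'', ''j'', ''free''}"
  let ?Q = "\<lambda>m'. core n p (\<lambda>_. 2) (as @ [a]) (us @ [[]]) Z m' \<and> frame ?X m m'"
  have c1: "core n p (\<lambda>_. 2) as us Z m1" and F1: "frame {''A'', ''j''} m m1" using P by auto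
  have val: "m1 ''free'' 0 = ?f" "m1 ''n'' 0 = n" "m1 ''t'' 0 = ?t"
    using frameD[OF F1] n_var[OF c1] core_t[OF c1] by simp_all
  have "core n p (\<lambda>_. 2) (as @ [a]) (us @ [[]]) Z ?m3"
  proof (rule core_add_block)
    show "core n p (\<lambda>_. 2) as us Z ?m2"
      by (intro core_store_free) (use c1 val in \<open>simp_all add: store_apply\<close>)
  qed (use val P in \<open>simp_all add: store_apply\<close>)
  moreover have "frame ?X m m1" by (rule frame_trans[OF F1 frame_refl[of "{}"]]) auto
  ultimately have Q: "?Q ?m3" by simp
  have eq3: "n + (n + n) = 3 * n" by simp
  show "run T k \<omega> (Assign ''op'' (sc ''free'') (N 4) ;;
     Assign ''arg1'' (sc ''free'') (Cell ''pg'' (sc ''t'')) ;;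
     Assign ''arg2'' (sc ''free'') (Plus (Plus (sc ''n'') point_gate) (N 1)) ;;
     set_sc ''t'' (Plus (sc ''t'') (N 1)) ;;
     Assign ''pg'' (sc ''t'') (sc ''free'') ;;
     set_sc ''free'' (Plus (Plus (sc ''free'') (sc ''n'')) (N 1))) 6 ?Q m1"
    by (rule run_wps) (use Q val in \<open>simp_all add: store_apply eq3\<close>)
qed simp

lemma run_copy:
  assumes "m ''n'' 0 = n" "arr m y \<sigma>" "length \<sigma> = n" "x \<noteq> y" "''j'' \<noteq> x" "''j'' \<noteq> y" "''n'' \<noteq> x"
  shows "run T k \<omega> (copy_com x y) (2 + n * 3) (\<lambda>m'. arr m' x \<sigma> \<and> frame {x, ''j''} m m') m"
  unfolding copy_com_def
proof (rule run_for[where P = "\<lambda>j m'. (\<forall>i<j. m' x i = of_bool (\<sigma> ! i)) \<and> frame {x, ''j''} m m'" and M =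
  n and D = 1])
  fix j m1 assume j: "j < n" "m1 ''j'' 0 = j" and
    P: "(\<forall>i<j. m1 x i = of_bool (\<sigma> ! i)) \<and> frame {x, ''j''} m m1"
  have "m1 y = m y" by (rule frameD[OF conjunct2[OF P]]) (use assms in auto)
  then have "m1 y j = of_bool (\<sigma> ! j)" using assms(2,3) j by (simp add: arr_def)
  then show "run T k \<omega> (Assign x (sc ''j'') (Cell y (sc ''j''))) 1
    (\<lambda>m'. m' ''j'' 0 = j \<and> (\<forall>i<Suc j. store ''j'' 0 (Suc j) m' x i = of_bool (\<sigma> ! i)) \<and>
      frame {x, ''j''} m (store ''j'' 0 (Suc j) m')) m1"
    using P j assms by (intro run_wps) (auto simp: store_apply less_Suc_eq)
next
  fix j m' assume P: "(\<forall>i<j. m' x i = of_bool (\<sigma> ! i)) \<and> frame {x, ''j''} m m'"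
  show "aval (sc ''n'') m' = n" using frameD[OF conjunct2[OF P], of "''n''"] assms by simp
qed (use assms in \<open>auto simp: arr_def\<close>)

lemma run_init:
  assumes nv: "m ''n'' 0 = n" and s: "arr m ''cex1'' \<sigma>" "length \<sigma> = n"
  shows "run T k \<omega> init_com (15 + n * 16)
    (\<lambda>m'. core n (replicate n False) (\<lambda>_. 2) [] [] {3 * n + 1} m' \<and> arr m' ''s0'' \<sigma>) m"
  unfolding init_com_def
proof (rule run_Seq[OF run_copy[OF nv s]])
  let ?doubling = "Assign ''pw'' (Plus (sc ''j'') (N 1)) (Plus (Cell ''pw'' (sc ''j'')) (Cell ''pw''
    (sc ''j'')))"
  let ?gates = "Assign ''op'' (sc ''j'') (N 2) ;;
        Assign ''arg1'' (sc ''j'') (sc ''j'') ;;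
        Assign ''op'' (Plus (sc ''n'') (sc ''j'')) (N 3) ;;
        Assign ''arg1'' (Plus (sc ''n'') (sc ''j'')) (sc ''j'') ;;
        Assign ''op'' (Plus point_gate (sc ''j'')) (N 4) ;;
        Assign ''arg1'' (Plus point_gate (sc ''j'')) (Plus (sc ''j'') (sc ''n'')) ;;
        Assign ''arg2'' (Plus point_gate (sc ''j'')) (Plus (Plus point_gate (sc ''j'')) (N 1)) ;;
        Assign ''w'' (sc ''j'') (N 0)"
  let ?last = "Assign ''op'' (Plus (sc ''n'') point_gate) (N 1) ;;
     Assign ''op'' (Plus (Plus (sc ''n'') point_gate) (N 1)) (N 0) ;;
     set_sc ''t'' (N 0) ;;
     set_sc ''pg'' (Plus (sc ''n'') point_gate) ;;
     set_sc ''free'' (Plus (Plus (sc ''n'') point_gate) (N 2))"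
  let ?S = "\<lambda>m'. m' ''n'' 0 = n \<and> m' ''sel'' 0 = n \<and> m' ''sel'' 1 = 0 \<and> arr m' ''s0'' \<sigma>"
  let ?P = "\<lambda>l m'. ?S m' \<and> (\<forall>j\<le>l. m' ''pw'' j = 2 ^ j)"
  let ?R = "\<lambda>l m'. ?P n m' \<and> (\<forall>j<l. m' ''op'' j = 2 \<and> m' ''arg1'' j = j \<and>
        m' ''op'' (n + j) = 3 \<and> m' ''arg1'' (n + j) = j \<and>
        m' ''op'' (2 * n + j) = 4 \<and> m' ''arg1'' (2 * n + j) = j + n \<and>
        m' ''arg2'' (2 * n + j) = Suc (2 * n + j) \<and> m' ''w'' j = 0)"
  let ?Q = "\<lambda>m'. core n (replicate n False) (\<lambda>_. 2) [] [] {3 * n + 1} m' \<and> arr m' ''s0'' \<sigma>"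
  fix m1 assume m1: "arr m1 ''s0'' \<sigma> \<and> frame {''s0'', ''j''} m m1"
  show "run T k \<omega> ((set_sc ''sel'' (sc ''n'') ;; Assign ''sel'' (N 1) (N 0) ;; set_sc ''pw'' (N 1)) ;;
     for_com ''j'' (sc ''n'') ?doubling ;; for_com ''j'' (sc ''n'') ?gates ;; ?last) (13 + n * 13) ?Q m1"
  proof (rule run_Seq[OF run_wps[where D = 3 and Q = "?P 0"]])
    show "wps T k (set_sc ''sel'' (sc ''n'') ;; Assign ''sel'' (N 1) (N 0) ;; set_sc ''pw'' (N 1)) (?P 0) m1"
      using m1 frameD[OF conjunct2[OF m1], of "''n''"] nv by (simp add: store_apply)
    fix m2 assume m2: "?P 0 m2"
    show "run T k \<omega> (for_com ''j'' (sc ''n'') ?doubling ;; for_com ''j'' (sc ''n'') ?gates ;;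
      ?last) (10 + n * 13) ?Q m2"
    proof (rule run_Seq)
      show "run T k \<omega> (for_com ''j'' (sc ''n'') ?doubling) (2 + n * 3) (?P n) m2"
      proof (rule run_for[where P = ?P and M = n and D = 1])
        fix j m' assume "?P j m'" "m' ''j'' 0 = j"
        then show "run T k \<omega> ?doubling 1 (\<lambda>m'. m' ''j'' 0 = j \<and> ?P (Suc j) (store ''j'' 0 (Suc j) m')) m'"
          by (intro run_wps) (auto simp: store_apply le_Suc_eq)
      qed (use m2 in \<open>auto simp: store_apply\<close>)
      fix m3 assume m3: "?P n m3"
      show "run T k \<omega> (for_com ''j'' (sc ''n'') ?gates ;; ?last) (8 + n * 10) ?Q m3"
      proof (rule run_Seq)
        show "run T k \<omega> (for_com ''j'' (sc ''n'') ?gates) (2 + n * 10) (?R n) m3"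
        proof (rule run_for[where P = ?R and M = n and D = 8])
          fix j m' assume "j < n" "?R j m'" "m' ''j'' 0 = j"
          then show "run T k \<omega> ?gates 8 (\<lambda>m'. m' ''j'' 0 = j \<and> ?R (Suc j) (store ''j'' 0 (Suc j) m')) m'"
            by (intro run_wps) (simp_all add: store_apply less_Suc_eq all_conj_distrib)
        qed (use m3 in \<open>auto simp: store_apply\<close>)
        fix m4 assume m4: "?R n m4"
        have eq3: "n + (n + n) = 3 * n" by simp
        let ?m5 = "store ''free'' 0 (3 * n + 2) (store ''pg'' 0 (3 * n) (store ''t'' 0 0
          (store ''op'' (3 * n + 1) 0 (store ''op'' (3 * n) 1 m4))))"
        have "fixed n (replicate n False) (\<lambda>_. 2) ?m5"
          using m4 unfolding fixed_def by (auto simp: store_apply lit_gate_def)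
        moreover have "heap n [] [] {3 * n + 1} ?m5"
          by (simp add: heap_def store_apply)
        ultimately have "?Q ?m5" using m4 by (simp add: core_def)
        then show "run T k \<omega> ?last 5 ?Q m4"
          by (intro run_wps) (use m4 in \<open>simp_all add: store_apply eq3\<close>)
      qed simp
    qed simp
  qed simp_all
qed simp_all

end

section \<open>Convergence\<close>

locale learning = fenced_system +
  fixes F G :: "literal list list"
  assumes cnf: "I = {\<sigma> \<in> states n. cnf_holds \<sigma> F}" "literals_over n F"
    and dnf: "I = {\<sigma> \<in> states n. dnf_holds \<sigma> G}" "literals_over n G"
begin

text \<open>The third conjunct says that no two negative points falsify a common clause of the CNF,
  which bounds their number. The fourth makes every \<open>us ! i\<close> a duplicate-free list of
  local minima, whose length the DNF bounds.\<close>

definition learned :: "state list \<Rightarrow> state list list \<Rightarrow> bool" where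
  "learned as us \<longleftrightarrow> length us = length as \<and>
     (\<forall>a\<in>set as. a \<notin> I \<and> length a = n) \<and>
     (\<forall>i i'. i < i' \<and> i' < length as \<longrightarrow>
        (\<forall>c\<in>set F. \<exists>l\<in>set c. lit_holds (as ! i) l \<or> lit_holds (as ! i') l)) \<and>
     (\<forall>i<length as. distinct (us ! i) \<and> (\<forall>u\<in>set (us ! i). u \<in> I \<and> local_min n I (as ! i) u))"

text \<open>Every round except the last adds exactly one block or one term, so this number counts
  rounds.\<close>

definition progress :: "state list \<Rightarrow> state list list \<Rightarrow> nat" where
  "progress as us = length as + sum_list (map length us)"

lemma falsified_clause:
  "a \<notin> I \<Longrightarrow> length a = n \<Longrightarrow> \<exists>c\<in>set F. \<forall>l\<in>set c. \<not> lit_holds a l"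
  using cnf(1) by (auto simp: states_def cnf_holds_def)

text \<open>Choosing a falsified clause for each point is injective, which gives the first bound.
  The same separation makes the points distinct elements of \<open>states n\<close>; the second
  bound is the one the binary search relies on.\<close>

lemma learned_bounds:
  assumes "learned as us"
  shows "length as \<le> length F" "length as \<le> 2 ^ n"
proof -
  have "\<exists>c. c \<in> set F \<and> (\<forall>l\<in>set c. \<not> lit_holds (as ! i) l)" if "i < length as" for i
    using assms that falsified_clause[of "as ! i"] by (auto simp: learned_def)
  then obtain c where c: "\<And>i. i < length as \<Longrightarrow> c i \<in> set F \<and> (\<forall>l\<in>set (c i). \<not> lit_holds (as ! i) l)"
    by metis
  have sep: "\<exists>l\<in>set (c i). lit_holds (as ! i') l" if "i < i'" "i' < length as" for i i'
    using assms that c[of i] unfolding learned_def by (metis less_trans)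
  have "inj_on c {..<length as}"
  proof (rule inj_onI)
    fix i i' assume "i \<in> {..<length as}" "i' \<in> {..<length as}" "c i = c i'"
    then show "i = i'"
      using sep[of i i'] sep[of i' i] c[of i] c[of i'] by (cases i i' rule: linorder_cases) auto
  qed
  then have "card {..<length as} \<le> card (set F)"
    by (rule card_inj_on_le) (use c in auto)
  then show "length as \<le> length F" using card_length[of F] by simp
  have ne: "as ! i \<noteq> as ! i'" if "i < i'" "i' < length as" for i i'
    using sep[OF that] c[of i] that by (metis less_trans)
  then have "distinct as" unfolding distinct_conv_nth by (metis linorder_neqE_nat)
  moreover have "set as \<subseteq> states n" using assms by (auto simp: learned_def states_def)
  ultimately show "length as \<le> 2 ^ n"
    using card_mono[OF card_states(1), of "set as"] card_states(2) by (simp add: distinct_card)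
qed

lemma progress_le:
  assumes "learned as us"
  shows "progress as us \<le> length F + length F * length G"
proof -
  have "length (us ! i) \<le> length G" if "i < length as" for i
  proof -
    have "card (set (us ! i)) \<le> length G"
      by (rule card_local_min[OF dnf, of _ "as ! i"]) (use assms that in \<open>auto simp: learned_def\<close>)
    then show ?thesis using assms that by (simp add: learned_def distinct_card)
  qed
  then have "\<forall>u\<in>set us. length u \<le> length G" 
    using assms by (auto simp: in_set_conv_nth learned_def)
  then have "sum_list (map length us) \<le> length us * length G"
    by (induction us) auto
  also have "\<dots> \<le> length F * length G"
    using learned_bounds(1)[OF assms] assms by (simp add: learned_def)
  finally show ?thesis using learned_bounds(1)[OF assms] by (simp add: progress_def)
qed

text \<open>A term of the hypothesis for \<open>as ! i\<close> that covers \<open>a\<close> makes \<open>a\<close> agree with a point of \<open>I\<close>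
  wherever that point differs from \<open>as ! i\<close>; so \<open>a\<close> satisfies every clause that \<open>as ! i\<close>
  falsifies.\<close>

lemma learned_add_block:
  assumes l: "learned as us" and a: "a \<notin> I" "length a = n"
    and h: "prefix_hyp n as us (length as) a"
  shows "learned (as @ [a]) (us @ [[]])" "progress (as @ [a]) (us @ [[]]) = Suc (progress as us)"
proof -
  have new: "\<exists>l\<in>set c. lit_holds (as ! i) l \<or> lit_holds a l" if i: "i < length as" and c: "c \<in> set F" for i c
  proof -
    obtain u where u: "u \<in> set (us ! i)" "above n (as ! i) u a"
      using h i by (auto simp: prefix_hyp_def hyp_def)
    then have "u \<in> I" using l i by (auto simp: learned_def)
    then obtain l where l: "l \<in> set c" "lit_holds u l" using cnf(1) c by (auto simp: cnf_holds_def)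
    moreover have "fst l < n" using cnf(2) c l(1) by (auto simp: literals_over_def)
    \<comment> \<open>At the variable of \<open>l\<close>, either \<open>u\<close> agrees with
      \<open>as ! i\<close>, so \<open>as ! i\<close> satisfies \<open>l\<close>, or it differs, and
      then \<open>above\<close> makes \<open>a\<close> agree with \<open>u\<close>.\<close>
    ultimately have "lit_holds (as ! i) l \<or> lit_holds a l"
      using u(2) by (auto simp: above_def lit_holds_def)
    then show ?thesis using l(1) by blast
  qed
  show "learned (as @ [a]) (us @ [[]])"
    unfolding learned_def
  proof (intro conjI allI impI)
    show "length (us @ [[]]) = length (as @ [a])" "\<forall>a\<in>set (as @ [a]). a \<notin> I \<and> length a = n"
      using l a by (auto simp: learned_def)
    fix i i' assume i: "i < i' \<and> i' < length (as @ [a])"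
    show "\<forall>c\<in>set F. \<exists>l\<in>set c. lit_holds ((as @ [a]) ! i) l \<or> lit_holds ((as @ [a]) ! i') l"
      using i l new by (cases "i' = length as") (auto simp: nth_append learned_def)
  next
    fix i assume "i < length (as @ [a])"
    then show "distinct ((us @ [[]]) ! i)" 
      "\<forall>u\<in>set ((us @ [[]]) ! i). u \<in> I \<and> local_min n I ((as @ [a]) ! i) u"
      using l by (auto simp: nth_append learned_def less_Suc_eq)
  qed
  show "progress (as @ [a]) (us @ [[]]) = Suc (progress as us)" by (simp add: progress_def)
qed

text \<open>The new point is not yet in the list: its term covers \<open>\<tau>\<close>, while no
  term of the old hypothesis does. This freshness is what lets \<open>progress\<close> bound the
  rounds.\<close>

lemma learned_add_term:
  assumes l: "learned as us" and i: "i < length as" and \<tau>: "\<tau> \<in> I"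
    and h: "\<not> hyp n (as ! i) (us ! i) \<tau>" and u: "u = passes n I (as ! i) \<tau> n"
  shows "learned as (us[i := u # us ! i])" "progress as (us[i := u # us ! i]) = Suc (progress as us)"
proof -
  have len: "length us = length as" using l by (simp add: learned_def)
  have "u \<in> I" "local_min n I (as ! i) u" "above n (as ! i) u \<tau>"
    unfolding u using passes_in[OF \<tau>] local_min_passes above_passes I_states[OF \<tau>] by auto
  moreover from this(3) have "u \<notin> set (us ! i)" using h by (auto simp: hyp_def)
  ultimately show "learned as (us[i := u # us ! i])"
    using l i unfolding learned_def by (auto simp: nth_list_update)
  have "map length us ! i \<le> sum_list (map length us)" using i len by (intro elem_le_sum_list) simp
  then show "progress as (us[i := u # us ! i]) = Suc (progress as us)"
    using i len by (simp add: progress_def map_update sum_list_update)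
qed

section \<open>One round of learning\<close>

definition Inv :: "state list \<Rightarrow> state list list \<Rightarrow> mem \<Rightarrow> bool" where
  "Inv as us m \<longleftrightarrow> learned as us \<and> (\<exists>p Z \<sigma>. core n p (\<lambda>_. 2) as us Z m \<and> arr m ''s0'' \<sigma> \<and> \<sigma> \<in> I)"

definition advanced :: "state list \<Rightarrow> state list list \<Rightarrow> mem \<Rightarrow> bool" where
  "advanced as us m \<longleftrightarrow> m ''done'' 0 = 0 \<and>
     (\<exists>as' us'. Inv as' us' m \<and> progress as' us' = Suc (progress as us))"

lemma Inv_frame:
  assumes "Inv as us m" "frame X m m'"
    and "X \<inter> {''n'', ''sel'', ''pw'', ''w'', ''op'', ''arg1'', ''arg2'', ''pg'', ''t'', ''free'', ''A'',
      ''s0''} = {}"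
  shows "Inv as us m'"
proof -
  obtain p Z \<sigma> where *: "core n p (\<lambda>_. 2) as us Z m" "arr m ''s0'' \<sigma>" "\<sigma> \<in> I"
    using assms(1) by (auto simp: Inv_def)
  have "core n p (\<lambda>_. 2) as us Z m'" by (rule core_frame[OF *(1) assms(2)]) (use assms(3) in simp)
  moreover have "arr m' ''s0'' \<sigma>" by (rule arr_frame[OF assms(2) _ *(2)]) (use assms(3) in simp)
  ultimately show ?thesis using assms(1) *(3) by (auto simp: Inv_def)
qed

lemma run_refine:
  assumes inv: "Inv as us m" and v: "arr m ''v'' \<tau>" "\<tau> \<in> I"
    and fail: "\<not> prefix_hyp n as us (length as) \<tau>" and d: "m ''done'' 0 = 0"
  shows "run T k \<omega> refine_com (27 + n * 29 + n * n * 9) (advanced as us) m"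
  unfolding refine_com_def
proof -
  have l: "learned as us" using inv by (simp add: Inv_def)
  obtain p Z \<sigma> where c: "core n p (\<lambda>_. 2) as us Z m" "arr m ''s0'' \<sigma>" "\<sigma> \<in> I"
    using inv by (auto simp: Inv_def)
  show "run T k \<omega> (find_com ;; walk_com ;; add_term_com) (27 + n * 29 + n * n * 9) (advanced as us) m"
  proof (rule run_Seq[OF run_find[OF c(1) v(1) I_states[OF v(2)] fail learned_bounds(2)[OF l]]])
    fix m1 assume m1: "core n p (\<lambda>_. 2) as us Z m1 \<and> frame {''op'', ''j'', ''pos'', ''cand'', ''ans''} m m1 \<and>
      m1 ''pos'' 0 < length as \<and> \<not> hyp n (as ! (m1 ''pos'' 0)) (us ! (m1 ''pos'' 0)) \<tau>"
    let ?i = "m1 ''pos'' 0"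
    let ?u = "passes n I (as ! ?i) \<tau> n"
    have F1: "frame {''op'', ''j'', ''pos'', ''cand'', ''ans''} m m1" using m1 by simp
    have v1: "arr m1 ''v'' \<tau>" by (rule arr_frame[OF F1 _ v(1)]) simp
    have i: "?i < length as" using m1 by simp
    show "run T k \<omega> (walk_com ;; add_term_com) (13 + n * 16 + n * n * 9) (advanced as us) m1"
    proof (rule run_Seq[OF run_walk[OF conjunct1[OF m1] v1 v(2) i refl]])
      fix m2 assume m2: "core n ?u (\<lambda>_. 2) as us Z m2 \<and>
        frame {''w'', ''arg1'', ''j'', ''g'', ''r'', ''old'', ''ans''} m1 m2 \<and> m2 ''g'' 0 = m2 ''pg'' (Suc ?i)"
      have F2: "frame {''w'', ''arg1'', ''j'', ''g'', ''r'', ''old'', ''ans''} m1 m2" using m2 by simp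
      show "run T k \<omega> add_term_com (8 + n * 8) (advanced as us) m2"
      proof (rule run_mono[OF run_add_term[OF conjunct1[OF m2] i]])
        show "m2 ''g'' 0 = m2 ''pg'' (Suc ?i)" using m2 by simp
        fix m3 assume "\<exists>Z'. core n ?u (\<lambda>_. 2) as (us[?i := ?u # us ! ?i]) Z' m3 \<and>
          frame {''op'', ''arg1'', ''arg2'', ''j'', ''free''} m2 m3"
        then obtain Z' where m3: "core n ?u (\<lambda>_. 2) as (us[?i := ?u # us ! ?i]) Z' m3"
          "frame {''op'', ''arg1'', ''arg2'', ''j'', ''free''} m2 m3" by blast
        have same: "m3 x = m x" if "x \<in> {''s0'', ''done''}" for x
          using frameD[OF F1, of x] frameD[OF F2, of x] frameD[OF m3(2), of x] that by auto
        have "arr m3 ''s0'' \<sigma>" using c(2) same by (simp add: arr_def)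
        then have "Inv as (us[?i := ?u # us ! ?i]) m3"
          using learned_add_term(1)[OF l i v(2) _ refl] m1 m3(1) c(3) by (auto simp: Inv_def)
        then show "advanced as us m3"
          using learned_add_term(2)[OF l i v(2) _ refl] m1 d same unfolding advanced_def by auto
      qed simp
    qed simp
  qed simp
qed

lemma run_new_block:
  assumes inv: "Inv as us m" and a: "arr m ''cex1'' a" "length a = n" "a \<notin> I"
    and h: "prefix_hyp n as us (length as) a" and d: "m ''done'' 0 = 0"
  shows "run T k \<omega> add_block_com (8 + n * 3) (advanced as us) m"
proof -
  have l: "learned as us" using inv by (simp add: Inv_def)
  obtain p Z \<sigma> where c: "core n p (\<lambda>_. 2) as us Z m" "arr m ''s0'' \<sigma>" "\<sigma> \<in> I"
    using inv by (auto simp: Inv_def)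
  show ?thesis
  proof (rule run_mono[OF run_add_block[OF c(1) a(1,2)]])
    let ?X = "{''A'', ''op'', ''arg1'', ''arg2'', ''t'', ''pg'', ''j'', ''free''}"
    fix m1 assume m1: "core n p (\<lambda>_. 2) (as @ [a]) (us @ [[]]) Z m1 \<and> frame ?X m m1"
    have "arr m1 ''s0'' \<sigma>" by (rule arr_frame[OF conjunct2[OF m1] _ c(2)]) simp
    moreover have "m1 ''done'' 0 = 0" using frameD[OF conjunct2[OF m1], of "''done''"] d by simp
    ultimately show "advanced as us m1"
      using learned_add_block[OF l a(3,2) h] m1 c(3) unfolding advanced_def Inv_def by blast
  qed simp
qed

lemma frame_store_answer: "frame {''ans'', ''cex1'', ''cex2''} m (store_answer \<alpha> m)"
  by (cases \<alpha>) (auto simp: frame_def store_def store_state_def)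

lemma arr_store_state: "arr (store_state x \<sigma> m) x \<sigma>"
  by (simp add: arr_def store_state_def)

lemma arr_store_state_other: "x \<noteq> y \<Longrightarrow> arr (store_state y \<tau> m) x \<sigma> = arr m x \<sigma>"
  by (simp add: arr_def store_state_def)

abbreviation step_cost :: nat where
  "step_cost \<equiv> 40 + n * 43 + n * n * 9"

lemma run_step:
  assumes inv: "Inv as us m" and d: "m ''done'' 0 = 0"
    and \<alpha>: "correct_answer T {\<sigma> \<in> states n. prefix_hyp n as us (length as) \<sigma>} \<alpha>" "\<alpha> \<noteq> Yes"
  shows "run T k \<omega> step_com step_cost (advanced as us) (store_answer \<alpha> m)"
proof -
  let ?m = "store_answer \<alpha> m"
  have T_states: "Init T \<subseteq> states n" "Trans T \<subseteq> states n \<times> states n"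
    using sys by (auto simp: transition_system_def)
  have closed: "\<sigma> \<in> I \<Longrightarrow> (\<sigma>, \<sigma>') \<in> Trans T \<Longrightarrow> \<sigma>' \<in> I" for \<sigma> \<sigma>'
    using inv fenced_system_axioms unfolding fenced_system_def inductive_invariant_def by blast
  have Bad_I: "\<sigma> \<in> Bad T \<Longrightarrow> \<sigma> \<notin> I" for \<sigma>
    using fenced_system_axioms unfolding fenced_system_def inductive_invariant_def by blast
  have inv': "Inv as us ?m" by (rule Inv_frame[OF inv frame_store_answer]) simp
  have d': "?m ''done'' 0 = 0" using frameD[OF frame_store_answer] d by simp
  have n': "?m ''n'' 0 = n" using inv' by (auto simp: Inv_def n_var)
  have copied: "Inv as us m1 \<and> m1 ''done'' 0 = 0 \<and> arr m1 ''v'' \<tau> \<and> (\<forall>\<sigma>. arr ?m ''cex1'' \<sigma> \<longrightarrow> arr m1 ''cex1'' \<sigma>)"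
    if m1: "arr m1 ''v'' \<tau> \<and> frame {''v'', ''j''} ?m m1" for m1 \<tau>
  proof (intro conjI allI impI)
    show "Inv as us m1" by (rule Inv_frame[OF inv' conjunct2[OF m1]]) simp
    show "m1 ''done'' 0 = 0" using frameD[OF conjunct2[OF m1], of "''done''"] d' by simp
    show "arr m1 ''v'' \<tau>" using m1 by simp
    show "arr m1 ''cex1'' \<sigma>" if "arr ?m ''cex1'' \<sigma>" for \<sigma>
      by (rule arr_frame[OF conjunct2[OF m1] _ that]) simp
  qed
  show ?thesis
  proof (cases \<alpha>)
    case Yes
    then show ?thesis using \<alpha>(2) by simp
  next
    case (CexBad a)
    have a: "length a = n" "a \<notin> I" "prefix_hyp n as us (length as) a"
      using \<alpha>(1) CexBad Bad_I by (auto simp: states_def)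
    have cex: "arr ?m ''cex1'' a" and ans: "?m ''ans'' 0 = 3"
      using CexBad by (simp_all add: arr_store_state store_apply)
    show ?thesis unfolding step_com_def
    proof (rule run_Cond)
      show "run T k \<omega> (Cond (Less (N 2) (sc ''ans'')) add_block_com
         (Cond (Less (sc ''ans'') (N 2))
           (copy_com ''v'' ''cex1'' ;; refine_com)
           (copy_com ''v'' ''cex2'' ;; member_com ;;
            Cond (Less (N 0) (sc ''inI'')) refine_com add_block_com)))
        (9 + n * 3) (advanced as us) ?m"
        by (rule run_Cond[OF run_new_block[OF inv' cex a d']]) (use ans in simp_all)
    qed (use ans in simp_all)
  next
    case (CexInit \<tau>)
    have \<tau>: "length \<tau> = n" "\<tau> \<in> I" "\<not> prefix_hyp n as us (length as) \<tau>"
      using \<alpha>(1) CexInit Init_I T_states by (auto simp: states_def)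
    have cex: "arr ?m ''cex1'' \<tau>" and ans: "?m ''ans'' 0 = 1"
      using CexInit by (simp_all add: arr_store_state store_apply)
    have copy: "run T k \<omega> (copy_com ''v'' ''cex1'' ;; refine_com) (29 + n * 32 + n * n * 9) (advanced as us) ?m"
    proof (rule run_Seq[OF run_copy[OF n' cex \<tau>(1)]])
      fix m1 assume m1: "arr m1 ''v'' \<tau> \<and> frame {''v'', ''j''} ?m m1"
      show "run T k \<omega> refine_com (27 + n * 29 + n * n * 9) (advanced as us) m1"
        by (rule run_refine) (use copied[OF m1] \<tau> in auto)
    qed simp_all
    show ?thesis unfolding step_com_def
    proof (rule run_Cond)
      show "run T k \<omega> (Cond (Less (N 2) (sc ''ans'')) add_block_com
         (Cond (Less (sc ''ans'') (N 2))
           (copy_com ''v'' ''cex1'' ;; refine_com)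
           (copy_com ''v'' ''cex2'' ;; member_com ;;
            Cond (Less (N 0) (sc ''inI'')) refine_com add_block_com)))
        (31 + n * 32 + n * n * 9) (advanced as us) ?m"
      proof (rule run_Cond)
        show "run T k \<omega> (Cond (Less (sc ''ans'') (N 2))
           (copy_com ''v'' ''cex1'' ;; refine_com)
           (copy_com ''v'' ''cex2'' ;; member_com ;;
            Cond (Less (N 0) (sc ''inI'')) refine_com add_block_com))
          (30 + n * 32 + n * n * 9) (advanced as us) ?m"
          by (rule run_Cond[OF copy]) (use ans in simp_all)
      qed (use ans in simp_all)
    qed (use ans in simp_all)
  next
    case (CexStep a \<tau>)
    have \<tau>: "length \<tau> = n" "\<not> prefix_hyp n as us (length as) \<tau>"
      and a: "length a = n" "prefix_hyp n as us (length as) a" and step: "(a, \<tau>) \<in> Trans T"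
      using \<alpha>(1) CexStep T_states by (auto simp: states_def)
    have cex: "arr ?m ''cex2'' \<tau>" "arr ?m ''cex1'' a" and ans: "?m ''ans'' 0 = 2"
      using CexStep by (simp_all add: arr_store_state arr_store_state_other store_apply)
    have copy: "run T k \<omega> (copy_com ''v'' ''cex2'' ;; member_com ;;
      Cond (Less (N 0) (sc ''inI'')) refine_com add_block_com) (36 + n * 43 + n * n * 9) (advanced as us) ?m"
    proof (rule run_Seq[OF run_copy[OF n' cex(1) \<tau>(1)]])
      fix m1 assume "arr m1 ''v'' \<tau> \<and> frame {''v'', ''j''} ?m m1"
      note m1 = copied[OF this]
      obtain p Z \<sigma> where c: "core n p (\<lambda>_. 2) as us Z m1" "arr m1 ''s0'' \<sigma>" "\<sigma> \<in> I"
        using m1 by (auto simp: Inv_def)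
      have v1: "arr m1 ''v'' \<tau>" using m1 by simp
      show "run T k \<omega> (member_com ;; Cond (Less (N 0) (sc ''inI'')) refine_com add_block_com)
        (33 + n * 40 + n * n * 9) (advanced as us) m1"
      proof (rule run_Seq[OF run_member[OF c v1 \<tau>(1)]])
        let ?X = "{''w'', ''arg1'', ''j'', ''inI'', ''ans''}"
        fix m2 assume m2: "core n \<tau> (\<lambda>_. 2) as us Z m2 \<and> frame ?X m1 m2 \<and> m2 ''inI'' 0 = of_bool (\<tau> \<in> I)"
        have F2: "frame ?X m1 m2" using m2 by simp
        have "arr m2 ''s0'' \<sigma>" by (rule arr_frame[OF F2 _ c(2)]) simp
        then have inv2: "Inv as us m2" using m2 m1 c(3) unfolding Inv_def by blast
        have v2: "arr m2 ''v'' \<tau>" by (rule arr_frame[OF F2 _ v1]) simp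
        have cex2: "arr m2 ''cex1'' a" by (rule arr_frame[OF F2]) (use m1 cex in simp_all)
        have d2: "m2 ''done'' 0 = 0" using frameD[OF F2, of "''done''"] m1 by simp
        show "run T k \<omega> (Cond (Less (N 0) (sc ''inI'')) refine_com add_block_com)
          (28 + n * 29 + n * n * 9) (advanced as us) m2"
        proof (rule run_Cond)
          assume "bval (Less (N 0) (sc ''inI'')) m2"
          then have "\<tau> \<in> I" using m2 by (simp split: if_splits)
          then show "run T k \<omega> refine_com (27 + n * 29 + n * n * 9) (advanced as us) m2"
            using run_refine[OF inv2 v2] \<tau> d2 by simp
        next
          assume "\<not> bval (Less (N 0) (sc ''inI'')) m2"
          then have "\<tau> \<notin> I" using m2 by simp
          \<comment> \<open>The pre-state passed the candidate but lies outside \<open>I\<close>,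
            since \<open>I\<close> is closed under \<open>Trans\<close>; it qualifies as the next
            negative point.\<close>
          then have "a \<notin> I" using closed step by blast
          then show "run T k \<omega> add_block_com (27 + n * 29 + n * n * 9) (advanced as us) m2"
            by (intro run_mono[OF run_new_block[OF inv2 cex2 a(1) _ a(2) d2]]) auto
        qed simp
      qed simp
    qed simp_all
    show ?thesis unfolding step_com_def
    proof (rule run_Cond)
      show "run T k \<omega> (Cond (Less (N 2) (sc ''ans'')) add_block_com
         (Cond (Less (sc ''ans'') (N 2))
           (copy_com ''v'' ''cex1'' ;; refine_com)
           (copy_com ''v'' ''cex2'' ;; member_com ;;
            Cond (Less (N 0) (sc ''inI'')) refine_com add_block_com)))
        (38 + n * 43 + n * n * 9) (advanced as us) ?m"
      proof (rule run_Cond)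
        show "run T k \<omega> (Cond (Less (sc ''ans'') (N 2))
           (copy_com ''v'' ''cex1'' ;; refine_com)
           (copy_com ''v'' ''cex2'' ;; member_com ;;
            Cond (Less (N 0) (sc ''inI'')) refine_com add_block_com))
          (37 + n * 43 + n * n * 9) (advanced as us) ?m"
          by (rule run_Cond[OF _ copy]) (use ans in simp_all)
      qed (use ans in simp_all)
    qed (use ans in simp_all)
  qed
qed

section \<open>The complete run and its bounds\<close>

definition solved :: "mem \<Rightarrow> bool" where
  "solved m \<longleftrightarrow> (\<exists>p as us Z. core n p (\<lambda>_. 2) as us Z m \<and>
     inductive_invariant T {\<sigma> \<in> states n. prefix_hyp n as us (length as) \<sigma>})"

lemma candidate:
  assumes c: "core n p (\<lambda>_. 2) as us Z m"
  shows "\<exists>f. represents_over n m (m ''pg'' (length as)) f \<and>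
    models n f = {\<sigma> \<in> states n. prefix_hyp n as us (length as) \<sigma>}"
proof -
  have f: "fixed n p (\<lambda>_. 2) m" "heap n as us Z m" using c by (auto simp: core_def)
  show ?thesis
    using den_prefix[OF f(1) _ f(2) order_refl, of "\<lambda>\<sigma>. \<sigma>"] den_vars[OF f(1)] unfolding den_models by blast
qed

abbreviation max_progress :: nat where
  "max_progress \<equiv> length F + length F * length G"

text \<open>Induction on the progress that is still possible. The \<open>Suc\<close> pays for the
  last round, which answers \<open>Yes\<close> and makes no progress; \<open>+ 2\<close> is the loop
  test and the inductiveness check of a round, and \<open>+ 1\<close> the failing test at the
  end.\<close>

lemma exec_main_loop:
  assumes "Inv as us (mem_of s)" "mem_of s ''done'' 0 = 0"
  shows "\<exists>s'. exec T k \<omega> (While (Less (sc ''done'') (N 1)) (IndCheck (Cell ''pg'' (sc ''t'')) ;;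
    step_com)) s s' \<and>
    solved (mem_of s') \<and>
    ind_checks s' \<le> ind_checks s + (Suc max_progress - progress as us) \<and>
    steps s' \<le> steps s + (Suc max_progress - progress as us) * (step_cost + 2) + 1"
  using assms
proof (induction "max_progress - progress as us" arbitrary: as us s rule: less_induct)
  case less
  let ?b = "Less (sc ''done'') (N 1)"
  let ?body = "IndCheck (Cell ''pg'' (sc ''t'')) ;; step_com"
  let ?S = "{\<sigma> \<in> states n. prefix_hyp n as us (length as) \<sigma>}"
  obtain p Z where c: "core n p (\<lambda>_. 2) as us Z (mem_of s)" and l: "learned as us"
    using less.prems by (auto simp: Inv_def)
  define s1 where "s1 = tick (mem_of s) s"
  have s1: "mem_of s1 = mem_of s" "ind_checks s1 = ind_checks s" "steps s1 = steps s + 1"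
    by (simp_all add: s1_def tick_def)
  obtain f where f: "represents_over n (mem_of s1) (aval (Cell ''pg'' (sc ''t''))
    (mem_of s1)) f" "models n f = ?S"
    using candidate[OF c] core_t[OF c] s1 by auto
  define \<alpha> where "\<alpha> = \<omega> (ind_checks s1) ?S"
  have \<alpha>: "correct_answer T ?S \<alpha>"
  proof -
    have "?S \<subseteq> states n" by auto
    then show ?thesis using answers by (simp add: \<alpha>_def correct_oracle_def)
  qed
  define s2 where "s2 = tick_ind (store_answer \<alpha> (mem_of s1)) s1"
  have s2: "mem_of s2 = store_answer \<alpha> (mem_of s)" "ind_checks s2 = ind_checks s + 1" "steps s2 = steps s + 2"
    by (simp_all add: s2_def tick_ind_def tick_def s1)
  have check: "exec T k \<omega> (IndCheck (Cell ''pg'' (sc ''t''))) s1 s2"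
    using exec.IndCheck[OF f(1), of k \<omega>] unfolding s2_def \<alpha>_def f(2) .
  have test: "bval ?b (mem_of s)" using less.prems by simp
  have bound: "progress as us \<le> max_progress" by (rule progress_le[OF l])
  show ?case
  proof (cases "\<alpha> = Yes")
    case True
    have m2: "mem_of s2 = store ''ans'' 0 0 (mem_of s)" using s2(1) True by simp
    have "run T k \<omega> step_com 2 (\<lambda>m'. solved m' \<and> m' ''done'' 0 = 1) (mem_of s2)"
      unfolding step_com_def
    proof (rule run_Cond)
      show "run T k \<omega> (set_sc ''done'' (N 1)) 1 (\<lambda>m'. solved m' \<and> m' ''done'' 0 = 1) (mem_of s2)"
        using c \<alpha> True m2 by (intro run_wps) (auto simp: solved_def core_store store_apply)
    qed (use m2 in \<open>simp_all add: store_apply\<close>)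
    then obtain s3 where s3: "exec T k \<omega> step_com s2 s3" "solved (mem_of s3)" "mem_of s3 ''done'' 0 = 1"
      "ind_checks s3 = ind_checks s2" "steps s3 \<le> steps s2 + 2"
      unfolding run_def by blast
    let ?s' = "tick (mem_of s3) s3" and ?r = "Suc max_progress - progress as us"
    have s': "mem_of ?s' = mem_of s3" "ind_checks ?s' = ind_checks s3" "steps ?s' = steps s3 + 1"
      by (simp_all add: tick_def)
    have "exec T k \<omega> (While ?b ?body) s ?s'"
      using test exec.Seq[OF check s3(1)] s3(3) unfolding s1_def
      by (intro exec.WhileTrue[OF _ _ exec.WhileFalse]) simp_all
    \<comment> \<open>The last round takes four steps up to setting \<open>done\<close>; since at
      least one round is left in the budget, they are charged to it.\<close>
    moreover have "1 * 4 \<le> ?r * (step_cost + 2)"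
      using bound by (intro mult_le_mono) simp_all
    then have "steps ?s' \<le> steps s + ?r * (step_cost + 2) + 1" using s3(5) s2(3) s'(3) by linarith
    ultimately show ?thesis using s3 s2 s' bound by (intro exI[of _ ?s']) simp
  next
    case False
    have "run T k \<omega> step_com step_cost (advanced as us) (mem_of s2)"
      unfolding s2(1) by (rule run_step[OF less.prems \<alpha> False])
    then obtain s3 where s3: "exec T k \<omega> step_com s2 s3" "advanced as us (mem_of s3)"
      "ind_checks s3 = ind_checks s2" "steps s3 \<le> steps s2 + step_cost"
      unfolding run_def by blast
    then obtain as' us' where new: "Inv as' us' (mem_of s3)" "mem_of s3 ''done'' 0 = 0"
      "progress as' us' = Suc (progress as us)"
      unfolding advanced_def by blast
    have bound': "progress as' us' \<le> max_progress"
      using new(1) by (intro progress_le) (simp add: Inv_def)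
    have less_bound: "max_progress - progress as' us' < max_progress - progress as us"
      using new(3) bound' by linarith
    let ?r = "Suc max_progress - progress as' us'"
    obtain s' where s': "exec T k \<omega> (While ?b ?body) s3 s'" "solved (mem_of s')"
      "ind_checks s' \<le> ind_checks s3 + ?r" "steps s' \<le> steps s3 + ?r * (step_cost + 2) + 1"
      using less.hyps[OF less_bound new(1,2)] by blast
    have r: "Suc max_progress - progress as us = Suc ?r" using new(3) bound' by simp
    have "exec T k \<omega> (While ?b ?body) s s'"
      by (rule exec.WhileTrue[OF test exec.Seq[OF check[unfolded s1_def] s3(1)] s'(1)])
    then show ?thesis unfolding r using s' s3 s2 by (intro exI[of _ s']) simp
  qed
qed

lemma exec_cdnf:
  "\<exists>s. exec T k \<omega> cdnf_com (start n k) s \<and> outputs_invariant T s \<and>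
     ind_checks s \<le> max_progress + 2 \<and>
     steps s \<le> Suc max_progress * (step_cost + 2) + 19 + n * 16"
proof -
  let ?m0 = "mem_of (start n k)"
  \<comment> \<open>The memory is initially zero apart from \<open>n\<close> and \<open>k\<close>,
    so gate 0 already has the kind of the constant false.\<close>
  have "represents ?m0 0 FF" by (rule represents.intros) (simp add: start_def store_def)
  then have r0: "represents_over n ?m0 (aval (N 0) ?m0) FF" by (simp add: represents_over_def)
  have "models n FF = {}" by (simp add: models_def)
  have "correct_answer T {} (\<omega> 0 {})" using answers by (simp add: correct_oracle_def)
  moreover have "Init T \<noteq> {}" using sys by (simp add: transition_system_def)
  \<comment> \<open>The empty set contains no source of a step and no bad state, and it is not an
    invariant as \<open>Init\<close> is not empty. So the answer must be an initial state, and this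
    becomes the base point \<open>s0\<close> of all membership tests.\<close>
  ultimately obtain \<sigma> where \<sigma>: "\<omega> 0 {} = CexInit \<sigma>" "\<sigma> \<in> Init T"
    by (cases "\<omega> 0 {}") (auto simp: inductive_invariant_def)
  define s1 where "s1 = tick_ind (store_answer (CexInit \<sigma>) ?m0) (start n k)"
  have s1: "mem_of s1 = store ''ans'' 0 1 (store_state ''cex1'' \<sigma> ?m0)" "ind_checks s1 = 1" "steps s1 = 1"
    by (simp_all add: s1_def tick_ind_def tick_def start_def)
  have "ind_checks (start n k) = 0" by (simp add: start_def)
  then have e1: "exec T k \<omega> (IndCheck (N 0)) (start n k) s1"
    using exec.IndCheck[OF r0, of k \<omega>] \<sigma>(1) \<open>models n FF = {}\<close> by (simp add: s1_def)
  have "run T k \<omega> init_com (15 + n * 16)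
    (\<lambda>m'. core n (replicate n False) (\<lambda>_. 2) [] [] {3 * n + 1} m' \<and> arr m' ''s0'' \<sigma>) (mem_of s1)"
  proof (rule run_init)
    show "mem_of s1 ''n'' 0 = n" by (simp add: s1(1) store_def store_state_def start_def)
    show "arr (mem_of s1) ''cex1'' \<sigma>" by (simp add: s1(1) arr_store_state)
    show "length \<sigma> = n" using I_states Init_I \<sigma>(2) by blast
  qed
  then obtain s2 where s2: "exec T k \<omega> init_com s1 s2"
    "core n (replicate n False) (\<lambda>_. 2) [] [] {3 * n + 1} (mem_of s2)" "arr (mem_of s2) ''s0'' \<sigma>"
    "ind_checks s2 = 1" "steps s2 \<le> 16 + n * 16"
    unfolding run_def using s1 by fastforce
  define s3 where "s3 = tick (store ''done'' 0 0 (mem_of s2)) s2"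
  have s3: "mem_of s3 = store ''done'' 0 0 (mem_of s2)" "ind_checks s3 = 1" "steps s3 \<le> 17 + n * 16"
    using s2 by (simp_all add: s3_def tick_def)
  have e3: "exec T k \<omega> (set_sc ''done'' (N 0)) s2 s3"
    using exec.Assign[of T k \<omega> "''done''" "N 0" "N 0" s2] by (simp add: s3_def)
  have "Inv [] [] (mem_of s3)"
    using s2 s3(1) Init_I[OF \<sigma>(2)] by (auto simp: Inv_def learned_def core_store)
  moreover have "progress [] [] = 0" by (simp add: progress_def)
  ultimately obtain s4 where s4: "exec T k \<omega> (While (Less (sc ''done'') (N 1))
      (IndCheck (Cell ''pg'' (sc ''t'')) ;; step_com)) s3 s4" "solved (mem_of s4)"
    "ind_checks s4 \<le> 1 + Suc max_progress" "steps s4 \<le> steps s3 + Suc max_progress * (step_cost + 2) + 1"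
    using exec_main_loop[of "[]" "[]" s3] s3 by (auto simp: store_apply)
  obtain p as us Z where c: "core n p (\<lambda>_. 2) as us Z (mem_of s4)"
    and ii: "inductive_invariant T {\<sigma> \<in> states n. prefix_hyp n as us (length as) \<sigma>}"
    using s4(2) by (auto simp: solved_def)
  let ?m5 = "store ''out'' 0 (mem_of s4 ''pg'' (length as)) (mem_of s4)"
  define s5 where "s5 = tick ?m5 s4"
  have e5: "exec T k \<omega> (set_sc ''out'' (Cell ''pg'' (sc ''t''))) s4 s5"
    using exec.Assign[of T k \<omega> "''out''" "N 0" "Cell ''pg'' (sc ''t'')" s4] core_t[OF c] by (simp add: s5_def)
  have "core n p (\<lambda>_. 2) as us Z ?m5" using c by (simp add: core_store)
  from candidate[OF this] ii have "outputs_invariant T s5"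
    unfolding outputs_invariant_def by (auto simp: s5_def tick_def store_apply)
  moreover have "exec T k \<omega> cdnf_com (start n k) s5"
    unfolding cdnf_com_def by (intro exec.Seq[OF e1] exec.Seq[OF s2(1)] exec.Seq[OF e3] exec.Seq[OF s4(1)] e5)
  moreover have "ind_checks s5 \<le> max_progress + 2" "steps s5 \<le> Suc max_progress * (step_cost + 2) + 19 + n * 16"
    using s4 s3 by (simp_all add: s5_def tick_def)
  ultimately show ?thesis by blast
qed

end

text \<open>Each power of \<open>n\<close> is at most \<open>n ^ 3\<close>, so a round costs at most
  \<open>94 * n ^ 3\<close>, as 42 + 43 + 9 = 94. There are at most \<open>3 * x\<close> rounds, and
  the remainder contributes at most 35; 3 * 94 + 35 = 317 is rounded up to 400.\<close>

lemma step_cost_le: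
  fixes n x :: nat
  assumes "n \<ge> 1" "x \<ge> 1" "y \<le> 2 * x"
  shows "Suc y * (40 + n * 43 + n * n * 9 + 2) + 19 + n * 16 \<le> 400 * (x * n ^ 3)"
proof -
  have p: "n \<le> n ^ 3" "n * n \<le> n ^ 3" "1 \<le> n ^ 3"
    using assms(1) power_increasing[of 1 3 n] power_increasing[of 2 3 n] by (simp_all add: power2_eq_square)
  then have "40 + n * 43 + n * n * 9 + 2 \<le> 94 * n ^ 3" by linarith
  then have "Suc y * (40 + n * 43 + n * n * 9 + 2) \<le> (3 * x) * (94 * n ^ 3)"
    using assms(2,3) by (intro mult_mono) simp_all
  moreover have "1 * n ^ 3 \<le> x * n ^ 3" using assms(2) by (intro mult_right_mono) simp_all
  ultimately show ?thesis using p by linarith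
qed

theorem theorem7p8:
  "\<exists>(A :: com) (c1 :: nat) (c2 :: nat) (c3 :: nat).
     \<forall>(T :: tsys) (k :: nat) (I :: state set) (m1 :: nat) (m2 :: nat) (\<omega> :: oracle_fun).
       transition_system T \<and> inductive_invariant T I \<and>
       has_dnf (nvars T) I m1 \<and> has_cnf (nvars T) I m2 \<and>
       backwards_fenced T k I \<and> forwards_fenced T k I \<and>
       correct_oracle T \<omega> \<longrightarrow>
       (\<exists>s. exec T k \<omega> A (start (nvars T) k) s \<and>
            outputs_invariant T s \<and>
            ind_checks s \<le> c1 * (m1 * m2) \<and>
            bmc_checks s \<le> c2 * (m1 * m2 * nvars T ^ 3) \<and>
            steps s \<le> c3 * (m1 * m2 * nvars T ^ 3))"
proof (rule exI[of _ cdnf_com], rule exI[of _ 4], rule exI[of _ 400], rule exI[of _ 400], intro allI impI)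
  fix T :: tsys and k :: nat and I :: "state set" and m1 m2 :: nat and \<omega> :: oracle_fun
  assume *: "transition_system T \<and> inductive_invariant T I \<and>
       has_dnf (nvars T) I m1 \<and> has_cnf (nvars T) I m2 \<and>
       backwards_fenced T k I \<and> forwards_fenced T k I \<and> correct_oracle T \<omega>"
  obtain F where F: "length F = m2" "literals_over (nvars T) F" "I = {\<sigma> \<in> states (nvars T). cnf_holds \<sigma> F}"
    using * by (auto simp: has_cnf_def)
  obtain G where G: "length G = m1" "literals_over (nvars T) G" "I = {\<sigma> \<in> states (nvars T). dnf_holds \<sigma> G}"
    using * unfolding has_dnf_def by blast
  interpret learning T k I \<omega> F G
    by unfold_locales (use * F G in blast)+
  have nonempty: "I \<noteq> {}" "I \<noteq> states n"
    using * unfolding transition_system_def inductive_invariant_def by blast+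
  have m1: "m1 \<ge> 1" using dnf_nonempty nonempty(1) * by blast
  have m2: "m2 \<ge> 1" using cnf_nonempty nonempty(2) * by blast
  \<comment> \<open>Without variables there is a single state, and \<open>Bad\<close> could not be
    both nonempty and proper. This keeps the factor \<open>n ^ 3\<close> from vanishing.\<close>
  have "n \<noteq> 0"
  proof
    assume "n = 0"
    then have "states n = {[]}" by (auto simp: states_def)
    then show False using * by (auto simp: transition_system_def subset_singleton_iff)
  qed
  then have n: "n \<ge> 1" by simp
  have m: "m1 * m2 \<ge> 1" using m1 m2 by (metis mult_le_mono mult_1)
  \<comment> \<open>Here \<open>m2\<close> \<le> \<open>m1 * m2\<close> by \<open>m1\<close> \<ge>
    1. The check of false and the last round add 2, which is at most \<open>2 * (m1 * m2)\<close>;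
    this is the origin of the constant 4.\<close>
  have p: "length F + length F * length G \<le> 2 * (m1 * m2)"
    using F(1) G(1) m1 by (simp add: mult.commute)
  obtain s where s: "exec T k \<omega> cdnf_com (start n k) s" "outputs_invariant T s"
    "ind_checks s \<le> length F + length F * length G + 2"
    "steps s \<le> Suc (length F + length F * length G) * (40 + n * 43 + n * n * 9 + 2) + 19 + n * 16"
    using exec_cdnf by blast
  have steps: "steps s \<le> 400 * (m1 * m2 * n ^ 3)"
    using s(4) step_cost_le[OF n m p] by linarith
  moreover have "ind_checks s \<le> 4 * (m1 * m2)" using s(3) p m by linarith
  moreover have "bmc_checks s \<le> 400 * (m1 * m2 * n ^ 3)"
    using bmc_checks_le_steps[OF s(1)] steps by (simp add: start_def)
  ultimately show "\<exists>s. exec T k \<omega> cdnf_com (start n k) s \<and> outputs_invariant T s \<and>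
    ind_checks s \<le> 4 * (m1 * m2) \<and> bmc_checks s \<le> 400 * (m1 * m2 * n ^ 3) \<and>
    steps s \<le> 400 * (m1 * m2 * n ^ 3)"
    using s by blast
qed

end
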